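(* Let $\lambda>0$, $0<q\le 1$ and $\alpha\le p_s^*-1$, and let $u$ be a positive weak solution of $(P_\lambda)$. Then $u\in L^\infty(\Omega)$.
   Context: Let $1<p<\infty$, $s\in(0,1)$, $n>sp$, $p_s^*=\frac{np}{n-sp}$, and let $\Omega\subset\mathbb{R}^n$ be a bounded domain with smooth boundary. Put $Q=\mathbb{R}^{2n}\setminus((\mathbb{R}^n\setminus\Omega)\times(\mathbb{R}^n\setminus\Omega))$. $X_0$ is the space of measurable $u:\mathbb{R}^n\to\mathbb{R}$ with $u|_\Omega\in L^p(\Omega)$, $u=0$ a.e. in $\mathbb{R}^n\setminus\Omega$ and $\|u\|:=\left(\int_Q\frac{|u(x)-u(y)|^p}{|x-y|^{n+sp}}\,dx\,dy\right)^{1/p}<\infty$; $\|\cdot\|$ is the norm on $X_0$. $(P_\lambda)$ is the problem $(-\Delta_p)^su=\lambda u^{-q}+u^\alpha$, $u>0$ in $\Omega$, $u=0$ in $\mathbb{R}^n\setminus\Omega$. A positive weak solution of $(P_\lambda)$ is $u\in X_0$ with $u>0$ in $\Omega$ and, for all $\psi\in C_c^\infty(\Omega)$, $$\int_Q\frac{|u(x)-u(y)|^{p-2}(u(x)-u(y))(\psi(x)-\psi(y))}{|x-y|^{n+sp}}\,dx\,dy-\int_\Omega(\lambda u^{-q}+u^\alpha)\psi\,dx=0.$$ *)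

theory Defs
  imports "HOL-Analysis.Analysis" "HOL-Probability.Essential_Supremum"
begin

text \<open>
  \<open>\<real>\<^sup>n\<close> is rendered as the type \<open>real ^ 'n\<close>, so that \<open>n = CARD('n)\<close>. Functions on
  \<open>\<real>\<^sup>n\<close> are Lebesgue measurable, and double integrals are taken with respect to the Lebesgue
  measure of \<open>\<real>\<^sup>n \<times> \<real>\<^sup>n\<close>. Recall that \<open>0 powr a = 0\<close> for every \<open>a\<close> and
  \<open>x / 0 = 0\<close>, so the integrands below vanish on the (null) diagonal and where \<open>u x = u y\<close>.
\<close>

subsection \<open>Smooth functions and smooth domains\<close>

primrec Ck :: "nat \<Rightarrow> (real ^ 'n \<Rightarrow> real) \<Rightarrow> bool" where
  "Ck 0 f \<longleftrightarrow> continuous_on UNIV f"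
| "Ck (Suc k) f \<longleftrightarrow> (\<forall>x. f differentiable (at x)) \<and>
     (\<forall>i. Ck k (\<lambda>x. frechet_derivative f (at x) (axis i 1)))"

definition smooth :: "(real ^ 'n \<Rightarrow> real) \<Rightarrow> bool" where
  "smooth f \<longleftrightarrow> (\<forall>k. Ck k f)"

text \<open>\<open>C\<^sub>c\<^sup>\<infinity>(\<Omega>)\<close>; its elements are extended by zero outside \<open>\<Omega>\<close>.\<close>

definition test_functions :: "(real ^ 'n) set \<Rightarrow> (real ^ 'n \<Rightarrow> real) set" where
  "test_functions \<Omega> = {\<psi>. smooth \<psi> \<and> compact (closure {x. \<psi> x \<noteq> 0}) \<and> closure {x. \<psi> x \<noteq> 0} \<subseteq> \<Omega>}"

text \<open>
  Near each boundary point, \<open>\<Omega>\<close> is the region above the graph of a smooth function, after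
  reorienting the coordinate axes. The direction \<open>e\<close> is the new last axis; a function of the
  other \<open>n - 1\<close> coordinates is encoded as a function \<open>\<gamma>\<close> on \<open>\<real>\<^sup>n\<close> that is invariant under
  translation along \<open>e\<close>.
\<close>

definition smooth_boundary :: "(real ^ 'n) set \<Rightarrow> bool" where
  "smooth_boundary \<Omega> \<longleftrightarrow> (\<forall>x0 \<in> frontier \<Omega>. \<exists>r > 0. \<exists>e \<gamma>. norm e = 1 \<and> smooth \<gamma> \<and>
     (\<forall>x t. \<gamma> (x + t *\<^sub>R e) = \<gamma> x) \<and> \<Omega> \<inter> ball x0 r = {x \<in> ball x0 r. \<gamma> x < x \<bullet> e})"

definition smooth_bounded_domain :: "(real ^ 'n) set \<Rightarrow> bool" where
  "smooth_bounded_domain \<Omega> \<longleftrightarrow>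
     open \<Omega> \<and> connected \<Omega> \<and> \<Omega> \<noteq> {} \<and> bounded \<Omega> \<and> smooth_boundary \<Omega>"

subsection \<open>Function spaces\<close>

definition Q_set :: "(real ^ 'n) set \<Rightarrow> ((real ^ 'n) \<times> (real ^ 'n)) set" where
  "Q_set \<Omega> = UNIV - ((UNIV - \<Omega>) \<times> (UNIV - \<Omega>))"

text \<open>The last condition says that \<open>\<parallel>u\<parallel>\<^sup>p < \<infinity>\<close>, equivalently \<open>\<parallel>u\<parallel> < \<infinity>\<close>.\<close>

definition X0 :: "real \<Rightarrow> real \<Rightarrow> (real ^ 'n) set \<Rightarrow> (real ^ 'n \<Rightarrow> real) set" where
  "X0 p s \<Omega> = {u. u \<in> borel_measurable lebesgue \<and>
     set_integrable lebesgue \<Omega> (\<lambda>x. \<bar>u x\<bar> powr p) \<and>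
     (AE x in lebesgue. x \<notin> \<Omega> \<longrightarrow> u x = 0) \<and>
     (\<integral>\<^sup>+ z \<in> Q_set \<Omega>. (case z of (x, y) \<Rightarrow>
        ennreal (\<bar>u x - u y\<bar> powr p / norm (x - y) powr (real CARD('n) + s * p))) \<partial>lebesgue) < \<infinity>}"

definition Linfty :: "(real ^ 'n) set \<Rightarrow> (real ^ 'n \<Rightarrow> real) set" where
  "Linfty \<Omega> = {u. u \<in> borel_measurable (lebesgue_on \<Omega>) \<and>
     esssup (lebesgue_on \<Omega>) (\<lambda>x. ereal \<bar>u x\<bar>) < \<infinity>}"

subsection \<open>The singular problem\<close>

definition sobolev_exponent :: "real \<Rightarrow> real \<Rightarrow> real \<Rightarrow> real" where
  "sobolev_exponent n p s = n * p / (n - s * p)"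

definition frac_plap_form ::
  "real \<Rightarrow> real \<Rightarrow> (real ^ 'n) set \<Rightarrow> (real ^ 'n \<Rightarrow> real) \<Rightarrow> (real ^ 'n \<Rightarrow> real) \<Rightarrow> real" where
  "frac_plap_form p s \<Omega> u \<psi> =
     (LINT z : Q_set \<Omega> | lebesgue. (case z of (x, y) \<Rightarrow>
        \<bar>u x - u y\<bar> powr (p - 2) * (u x - u y) * (\<psi> x - \<psi> y)
          / norm (x - y) powr (real CARD('n) + s * p)))"

text \<open>
  For \<open>u \<in> X0 p s \<Omega>\<close> the integral in \<open>frac_plap_form\<close> converges absolutely by Hoelder's
  inequality. That of the singular right-hand side need not, and since the Bochner integral is
  \<open>0\<close> for non-integrable functions, its existence is an explicit part of the weak formulation.
  Positivity is understood almost everywhere, as \<open>u\<close> is an element of a Sobolev-type space.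
\<close>

definition positive_weak_solution ::
  "real \<Rightarrow> real \<Rightarrow> real \<Rightarrow> real \<Rightarrow> real \<Rightarrow> (real ^ 'n) set \<Rightarrow> (real ^ 'n \<Rightarrow> real) \<Rightarrow> bool" where
  "positive_weak_solution p s q \<alpha> \<mu> \<Omega> u \<longleftrightarrow>
     u \<in> X0 p s \<Omega> \<and> (AE x in lebesgue. x \<in> \<Omega> \<longrightarrow> 0 < u x) \<and>
     (\<forall>\<psi> \<in> test_functions \<Omega>.
        set_integrable lebesgue \<Omega> (\<lambda>x. (\<mu> * u x powr (- q) + u x powr \<alpha>) * \<psi> x) \<and>
        frac_plap_form p s \<Omega> u \<psi>
          - (LINT x : \<Omega> | lebesgue. (\<mu> * u x powr (- q) + u x powr \<alpha>) * \<psi> x) = 0)"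

end

theory Submission
  imports Defs "HOL-Probability.Probability_Measure"
begin

text \<open>
  Write \<open>P = p\<^sub>s\<^sup>*\<close>. Near the boundary the right-hand side is singular, but only truncations
  \<open>\<phi> = min ((u - k)\<^sup>+) M\<close> with \<open>k \<ge> 1\<close> are needed as test functions. They are admissible, with
  \<open>\<le>\<close> instead of equality, because they are limits of compactly supported functions
  \<open>u\<^sub>t \<le> \<phi>\<close> of bounded energy, obtained by pushing localized pieces of \<open>\<phi>\<close> into \<open>\<Omega>\<close>; these in turn are
  limits of their mollifications. In both cases boundedness of the energy and convergence almost
  everywhere give weak convergence, which is all the linear form needs.

  On \<open>{u \<ge> 1}\<close> the right-hand side is at most \<open>(\<mu> + 1) u\<^bsup>P - 1\<^esup>\<close>. Testing and the fractional Sobolev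
  inequality bound \<open>W k = \<integral> ((u - k)\<^sup>+)\<^sup>P\<close> by the power \<open>P / p\<close> of a multiple of
  \<open>\<integral> u\<^bsup>P - 1\<^esup> (u - k)\<^sup>+\<close>. As \<open>u \<le> l / (l - k) (u - k)\<close> where \<open>u > l > k\<close>, one gets
  \<open>W l \<le> (A (l / (l - k))\<^bsup>P - 1\<^esup> W k)\<^bsup>P / p\<^esup>\<close>. This is invariant under scaling of \<open>k\<close> and \<open>l\<close>, so that
  \<open>W k \<longlonglongrightarrow> 0\<close> alone lets the De Giorgi iteration \<open>l\<^sub>j = K (2 - 2\<^bsup>-j\<^esup>)\<close> start at a large level \<open>K\<close>, even for the
  critical exponent, and \<open>u \<le> 2 K\<close> almost everywhere.
\<close>

subsection \<open>Gagliardo energy and the fractional Sobolev inequality\<close>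

lemma nn_integral_lborel_shift:
  fixes f :: "'a::euclidean_space \<Rightarrow> ennreal"
  assumes [measurable]: "f \<in> borel_measurable borel"
  shows "(\<integral>\<^sup>+x. f (c + x) \<partial>lborel) = (\<integral>\<^sup>+x. f x \<partial>lborel)"
proof -
  have "(\<integral>\<^sup>+x. f x \<partial>lborel) = (\<integral>\<^sup>+x. f x \<partial>(distr lborel borel ((+) c)))"
    by (simp only: lborel_distr_plus)
  also have "\<dots> = (\<integral>\<^sup>+x. f (c + x) \<partial>lborel)"
    by (rule nn_integral_distr) auto
  finally show ?thesis ..
qed

definition energy :: "real \<Rightarrow> real \<Rightarrow> ('a::euclidean_space \<Rightarrow> real) \<Rightarrow> ennreal" where
  "energy p r w = (\<integral>\<^sup>+z. ennreal (\<bar>w (fst z) - w (snd z)\<bar> powr p / norm (fst z - snd z) powr r) \<partial>lborel)"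

lemma borel_measurable_pair [measurable]:
  fixes w :: "'a::euclidean_space \<Rightarrow> real"
  assumes "w \<in> borel_measurable borel"
  shows "(\<lambda>z::'a \<times> 'a. w (fst z)) \<in> borel_measurable borel" "(\<lambda>z::'a \<times> 'a. w (snd z)) \<in> borel_measurable borel"
proof -
  have "fst \<in> borel_measurable (borel :: ('a \<times> 'a) measure)" "snd \<in> borel_measurable (borel :: ('a \<times> 'a) measure)"
    by (intro borel_measurable_continuous_onI continuous_intros)+
  then show "(\<lambda>z::'a \<times> 'a. w (fst z)) \<in> borel_measurable borel" "(\<lambda>z::'a \<times> 'a. w (snd z)) \<in> borel_measurable borel"
    using assms measurable_compose by blast+
qed

lemma borel_measurable_norm_diff [measurable]:
  "(\<lambda>z::'a::euclidean_space \<times> 'a. norm (fst z - snd z)) \<in> borel_measurable borel"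
  by (intro borel_measurable_continuous_onI continuous_intros)

lemma nn_integral_lborel_pair:
  fixes f :: "'a::euclidean_space \<times> 'a \<Rightarrow> ennreal"
  assumes "f \<in> borel_measurable borel"
  shows "(\<integral>\<^sup>+z. f z \<partial>lborel) = (\<integral>\<^sup>+x. (\<integral>\<^sup>+y. f (x, y) \<partial>lborel) \<partial>lborel)"
    and "(\<integral>\<^sup>+z. f z \<partial>lborel) = (\<integral>\<^sup>+y. (\<integral>\<^sup>+x. f (x, y) \<partial>lborel) \<partial>lborel)"
proof -
  have f: "f \<in> borel_measurable (lborel \<Otimes>\<^sub>M lborel)"
    unfolding lborel_prod using assms by simp
  show 1: "(\<integral>\<^sup>+z. f z \<partial>lborel) = (\<integral>\<^sup>+x. (\<integral>\<^sup>+y. f (x, y) \<partial>lborel) \<partial>lborel)"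
    using lborel.nn_integral_fst[OF f] by (simp add: lborel_prod)
  show "(\<integral>\<^sup>+z. f z \<partial>lborel) = (\<integral>\<^sup>+y. (\<integral>\<^sup>+x. f (x, y) \<partial>lborel) \<partial>lborel)"
    using lborel_pair.Fubini'[of "curry f"] f 1 by (simp add: curry_def)
qed

lemma borel_measurable_energy [measurable]:
  fixes w :: "'a::euclidean_space \<Rightarrow> real"
  assumes [measurable]: "w \<in> borel_measurable borel"
  shows "(\<lambda>z::'a \<times> 'a. ennreal (\<bar>w (fst z) - w (snd z)\<bar> powr p / norm (fst z - snd z) powr r)) \<in> borel_measurable borel"
  by measurable

lemma energy_iterated:
  fixes w :: "'a::euclidean_space \<Rightarrow> real"
  assumes "w \<in> borel_measurable borel"
  shows "energy p r w = (\<integral>\<^sup>+x. (\<integral>\<^sup>+y. ennreal (\<bar>w x - w y\<bar> powr p / norm (x - y) powr r) \<partial>lborel) \<partial>lborel)"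
  unfolding energy_def nn_integral_lborel_pair(1)[OF borel_measurable_energy[OF assms]] by simp

lemma energy_shift:
  fixes w :: "'a::euclidean_space \<Rightarrow> real"
  assumes [measurable]: "w \<in> borel_measurable borel"
  shows "energy p r (\<lambda>x. w (c + x)) = energy p r w"
  using nn_integral_lborel_shift[of "\<lambda>z. ennreal (\<bar>w (fst z) - w (snd z)\<bar> powr p / norm (fst z - snd z) powr r)" "(c, c)"]
  by (simp add: energy_def)

lemma energy_le_sum:
  fixes w :: "'a::euclidean_space \<Rightarrow> real"
  assumes "finite I" and [measurable]: "\<And>i. i \<in> I \<Longrightarrow> v i \<in> borel_measurable borel"
    and dom: "\<And>x y. \<exists>i\<in>I. \<bar>w x - w y\<bar> \<le> \<bar>v i x - v i y\<bar>" and "0 < p"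
  shows "energy p r w \<le> (\<Sum>i\<in>I. energy p r (v i))"
proof -
  have "energy p r w \<le> (\<integral>\<^sup>+z. (\<Sum>i\<in>I. ennreal (\<bar>v i (fst z) - v i (snd z)\<bar> powr p / norm (fst z - snd z) powr r)) \<partial>lborel)"
    unfolding energy_def
  proof (rule nn_integral_mono)
    fix z :: "'a \<times> 'a"
    obtain i where i: "i \<in> I" "\<bar>w (fst z) - w (snd z)\<bar> \<le> \<bar>v i (fst z) - v i (snd z)\<bar>"
      using dom by blast
    have "ennreal (\<bar>w (fst z) - w (snd z)\<bar> powr p / norm (fst z - snd z) powr r)
      \<le> ennreal (\<bar>v i (fst z) - v i (snd z)\<bar> powr p / norm (fst z - snd z) powr r)"
      using i \<open>0 < p\<close> by (intro ennreal_leI divide_right_mono powr_mono2) auto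
    also have "\<dots> \<le> (\<Sum>i\<in>I. ennreal (\<bar>v i (fst z) - v i (snd z)\<bar> powr p / norm (fst z - snd z) powr r))"
      by (rule member_le_sum[OF i(1) _ \<open>finite I\<close>]) simp
    finally show "ennreal (\<bar>w (fst z) - w (snd z)\<bar> powr p / norm (fst z - snd z) powr r) \<le> \<dots>" .
  qed
  also have "\<dots> = (\<Sum>i\<in>I. energy p r (v i))"
    unfolding energy_def by (rule nn_integral_sum) measurable
  finally show ?thesis .
qed

lemma energy_mono:
  fixes w :: "'a::euclidean_space \<Rightarrow> real"
  assumes "v \<in> borel_measurable borel" "\<And>x y. \<bar>w x - w y\<bar> \<le> \<bar>v x - v y\<bar>" "0 < p"
  shows "energy p r w \<le> energy p r v"
  using energy_le_sum[of "{()}" "\<lambda>_. v" w p r] assms by simp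

text \<open>The ball around \<open>x\<close> is chosen with twice the volume that Markov's inequality allows for
  \<open>{y. w y > w x / 2}\<close>; on the remaining half of it, \<open>w\<close> differs from \<open>w x\<close> by at least \<open>w x / 2\<close>.\<close>

lemma sobolev_pointwise:
  fixes w :: "'a::euclidean_space \<Rightarrow> real"
  assumes p: "1 < p" and \<sigma>: "0 < \<sigma>" "\<sigma> < real DIM('a)"
    and P: "P = real DIM('a) * p / (real DIM('a) - \<sigma>)"
    and [measurable]: "w \<in> borel_measurable borel" and w: "\<And>x. 0 \<le> w x"
    and T: "(\<integral>\<^sup>+x. ennreal (w x powr P) \<partial>lborel) = ennreal T" "0 < T"
    and a: "0 < w x"
  defines "c \<equiv> (2 / unit_ball_vol (real DIM('a))) powr (- (real DIM('a) + \<sigma>) / real DIM('a)) * 2 powr (- P)"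
  shows "ennreal (c * T powr (- \<sigma> / real DIM('a)) * w x powr P) \<le>
    (\<integral>\<^sup>+y. ennreal (\<bar>w x - w y\<bar> powr p / norm (x - y) powr (real DIM('a) + \<sigma>)) \<partial>lborel)"
proof -
  define n where "n = real DIM('a)"
  define \<omega> where "\<omega> = unit_ball_vol n"
  define h where "h = w x / 2"
  define m where "m = T / h powr P"
  define \<rho> where "\<rho> = (2 * m / \<omega>) powr (1 / n)"
  have n: "0 < n" by (simp add: n_def)
  have \<omega>: "0 < \<omega>" by (simp add: \<omega>_def n_def)
  have h: "0 < h" using a by (simp add: h_def)
  have m: "0 < m" using T h by (simp add: m_def)
  have \<rho>: "0 < \<rho>" using m \<omega> by (simp add: \<rho>_def)
  have Ppos: "0 < P" using p \<sigma> n by (simp add: P n_def)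
  define E where "E = {y. h < w y}"
  have [measurable]: "E \<in> sets borel" unfolding E_def by measurable
  have "emeasure lborel E \<le> ennreal m"
  proof -
    have "emeasure lborel E = (\<integral>\<^sup>+y. indicator E y \<partial>lborel)" by simp
    also have "\<dots> \<le> (\<integral>\<^sup>+y. ennreal (1 / h powr P) * ennreal (w y powr P) \<partial>lborel)"
    proof (rule nn_integral_mono)
      fix y :: 'a
      show "indicator E y \<le> ennreal (1 / h powr P) * ennreal (w y powr P)"
      proof (cases "y \<in> E")
        case True
        then have "h powr P \<le> w y powr P"
          using h Ppos by (intro powr_mono2) (auto simp: E_def)
        then have "1 \<le> (1 / h powr P) * w y powr P"
          using h by (simp add: field_simps)
        then have "ennreal 1 \<le> ennreal (1 / h powr P * w y powr P)" by (rule ennreal_leI)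
        then show ?thesis using True h by (simp add: ennreal_mult[symmetric])
      qed simp
    qed
    also have "\<dots> = ennreal m"
      using T h by (subst nn_integral_cmult) (auto simp add: m_def ennreal_mult[symmetric])
    finally show ?thesis .
  qed
  have "ennreal (2 * m) = emeasure lborel (ball x \<rho>)"
  proof -
    have "\<rho> ^ DIM('a) = \<rho> powr n"
      using \<rho> by (simp add: n_def powr_realpow)
    also have "\<dots> = 2 * m / \<omega>"
      using m \<omega> n by (simp add: \<rho>_def powr_powr)
    finally show ?thesis
      using \<rho> \<omega> by (auto simp add: emeasure_ball \<omega>_def n_def)
  qed
  also have "\<dots> \<le> emeasure lborel (ball x \<rho> - E) + emeasure lborel E"
    by (rule order_trans[OF emeasure_mono emeasure_subadditive]) auto
  also have "\<dots> \<le> emeasure lborel (ball x \<rho> - E) + ennreal m"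
    using \<open>emeasure lborel E \<le> ennreal m\<close> by (rule add_left_mono)
  finally have "ennreal m + ennreal m \<le> emeasure lborel (ball x \<rho> - E) + ennreal m"
    using m by (simp flip: ennreal_plus)
  then have mB: "ennreal m \<le> emeasure lborel (ball x \<rho> - E)"
    by simp
  define q where "q = h powr p / \<rho> powr (n + \<sigma>)"
  have id: "c * T powr (- \<sigma> / n) * w x powr P = q * m"
  proof -
    have e: "p + P * \<sigma> / n = P"
      using \<sigma> n by (simp add: P n_def field_simps)
    have "\<rho> powr (n + \<sigma>) = (2 * m / \<omega>) powr ((n + \<sigma>) / n)"
      by (simp add: \<rho>_def powr_powr)
    also have "\<dots> = (2 / \<omega>) powr ((n + \<sigma>) / n) * m powr ((n + \<sigma>) / n)"
      using m \<omega> by (simp flip: powr_mult)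
    also have "m powr ((n + \<sigma>) / n) = m * m powr (\<sigma> / n)"
      using m n by (simp add: add_divide_distrib powr_add)
    also have "m powr (\<sigma> / n) = T powr (\<sigma> / n) / h powr (P * \<sigma> / n)"
      using T h by (simp add: m_def powr_divide powr_powr)
    finally have \<rho>e: "\<rho> powr (n + \<sigma>) = (2 / \<omega>) powr ((n + \<sigma>) / n) * (m * (T powr (\<sigma> / n) / h powr (P * \<sigma> / n)))" .
    have "h powr P = h powr p * h powr (P * \<sigma> / n)"
      by (simp add: powr_add[symmetric] e)
    moreover have "w x powr P = 2 powr P * h powr P"
      using h by (simp add: h_def powr_divide)
    moreover have "(2 / \<omega>) powr (- (n + \<sigma>) / n) = 1 / (2 / \<omega>) powr ((n + \<sigma>) / n)"
      unfolding minus_divide_left[symmetric] by (simp add: powr_minus_divide)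
    ultimately show ?thesis
      using m T h \<omega> unfolding q_def \<rho>e c_def n_def[symmetric] \<omega>_def[symmetric]
      by (simp add: powr_minus divide_simps)
  qed
  have "ennreal (q * m) = ennreal q * ennreal m"
    using m h by (intro ennreal_mult) (auto simp: q_def)
  also have "\<dots> \<le> ennreal q * emeasure lborel (ball x \<rho> - E)"
    using mB by (rule mult_left_mono) simp
  also have "\<dots> = (\<integral>\<^sup>+y. ennreal q * indicator (ball x \<rho> - E) y \<partial>lborel)"
    by (simp add: nn_integral_cmult_indicator)
  also have "\<dots> \<le> (\<integral>\<^sup>+y. ennreal (\<bar>w x - w y\<bar> powr p / norm (x - y) powr (n + \<sigma>)) \<partial>lborel)"
  proof (rule nn_integral_mono)
    fix y :: 'a
    show "ennreal q * indicator (ball x \<rho> - E) y \<le> ennreal (\<bar>w x - w y\<bar> powr p / norm (x - y) powr (n + \<sigma>))"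
    proof (cases "y \<in> ball x \<rho> - E")
      case True
      then have "w y \<le> w x / 2" by (simp add: E_def h_def)
      then have wy: "h \<le> \<bar>w x - w y\<bar>" unfolding h_def by linarith
      then have "x \<noteq> y" using h by auto
      moreover have "norm (x - y) < \<rho>" using True by (simp add: dist_norm)
      ultimately have "q \<le> \<bar>w x - w y\<bar> powr p / norm (x - y) powr (n + \<sigma>)"
        unfolding q_def using wy h p n \<sigma>
        by (intro frac_le powr_mono2) (auto simp del: dist_norm)
      then show ?thesis using True by (simp add: ennreal_leI)
    qed simp
  qed
  finally show ?thesis using id by (simp add: n_def)
qed

lemma sobolev:
  assumes p: "1 < p" and \<sigma>: "0 < \<sigma>" "\<sigma> < real DIM('a::euclidean_space)"
    and P: "P = real DIM('a) * p / (real DIM('a) - \<sigma>)"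
  obtains C where "0 < C"
    "\<And>w T. \<lbrakk>w \<in> borel_measurable borel; \<And>x::'a. 0 \<le> w x;
       (\<integral>\<^sup>+x. ennreal (w x powr P) \<partial>lborel) = ennreal T; 0 \<le> T\<rbrakk>
      \<Longrightarrow> ennreal (T powr (p / P)) \<le> ennreal C * energy p (real DIM('a) + \<sigma>) w"
proof
  define n where "n = real DIM('a)"
  define c where "c = (2 / unit_ball_vol n) powr (- (n + \<sigma>) / n) * 2 powr (- P)"
  have n: "0 < n" by (simp add: n_def)
  have "0 < unit_ball_vol n" using n by (intro unit_ball_vol_pos) simp
  then have c: "0 < c" by (simp add: c_def)
  then show "0 < 1 / c" by simp
  fix w :: "'a \<Rightarrow> real" and T
  assume [measurable]: "w \<in> borel_measurable borel" and w: "\<And>x. 0 \<le> w x"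
    and T: "(\<integral>\<^sup>+x. ennreal (w x powr P) \<partial>lborel) = ennreal T" "0 \<le> T"
  show "ennreal (T powr (p / P)) \<le> ennreal (1 / c) * energy p (real DIM('a) + \<sigma>) w"
  proof (cases "T = 0")
    case False
    with T have T0: "0 < T" by simp
    have "p / P = 1 - \<sigma> / n"
      using p n \<sigma> by (simp add: P n_def field_simps)
    then have "T powr (p / P) = T powr (- \<sigma> / n) * T powr 1"
      using powr_add[of T "- \<sigma> / n" 1] by (simp only:) (simp add: algebra_simps)
    then have "c * T powr (p / P) = (c * T powr (- \<sigma> / n)) * T"
      using T0 by simp
    then have "ennreal (c * T powr (p / P)) = ennreal (c * T powr (- \<sigma> / n)) * ennreal T"
      using c T0 by (subst ennreal_mult[symmetric]) auto
    also have "\<dots> = (\<integral>\<^sup>+x. ennreal (c * T powr (- \<sigma> / n)) * ennreal (w x powr P) \<partial>lborel)"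
      by (simp add: nn_integral_cmult T)
    also have "\<dots> \<le> (\<integral>\<^sup>+x. (\<integral>\<^sup>+y. ennreal (\<bar>w x - w y\<bar> powr p / norm (x - y) powr (n + \<sigma>)) \<partial>lborel) \<partial>lborel)"
    proof (rule nn_integral_mono)
      fix x :: 'a
      show "ennreal (c * T powr (- \<sigma> / n)) * ennreal (w x powr P) \<le>
        (\<integral>\<^sup>+y. ennreal (\<bar>w x - w y\<bar> powr p / norm (x - y) powr (n + \<sigma>)) \<partial>lborel)"
      proof (cases "w x = 0")
        case False
        then have "0 < w x" using w[of x] by simp
        from sobolev_pointwise[OF p \<sigma> P _ w T(1) T0 this] c show ?thesis
          by (simp add: n_def c_def ennreal_mult[symmetric])
      qed simp
    qed
    also have "\<dots> = energy p (n + \<sigma>) w"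
      by (rule energy_iterated[symmetric]) simp
    finally have "ennreal (c * T powr (p / P)) \<le> energy p (n + \<sigma>) w" .
    then have "ennreal (1 / c) * ennreal (c * T powr (p / P)) \<le> ennreal (1 / c) * energy p (n + \<sigma>) w"
      by (rule mult_left_mono) simp
    then show ?thesis using c by (simp add: ennreal_mult[symmetric] n_def)
  qed simp
qed

definition capped_kernel :: "real \<Rightarrow> real \<Rightarrow> 'a::euclidean_space \<Rightarrow> real" where
  "capped_kernel p r z = min 1 (norm z) powr p / norm z powr r"

lemma capped_kernel_measurable [measurable]: "capped_kernel p r \<in> borel_measurable borel"
  unfolding capped_kernel_def by measurable

lemma capped_kernel_shell:
  fixes z :: "'a::euclidean_space"
  assumes "z \<noteq> 0" "0 < p" "0 < r"
  shows "\<exists>k. (norm z < 2 powr (- real k) \<and> capped_kernel p r z \<le> 2 powr (- real k * p + real (Suc k) * r))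
     \<or> (norm z < 2 powr real (Suc k) \<and> capped_kernel p r z \<le> 2 powr (- real k * r))"
proof -
  define m where "m = \<lfloor>log 2 (norm z)\<rfloor>"
  have z: "0 < norm z" using assms by simp
  have lo: "2 powr m \<le> norm z" and hi: "norm z < 2 powr (m + 1)"
    using z by (auto simp: m_def le_log_iff[symmetric] log_less_iff[symmetric])
  show ?thesis
  proof (cases "0 \<le> m")
    case True
    define k where "k = nat m"
    have k: "real_of_int m = real k" using True by (simp add: k_def)
    have "capped_kernel p r z \<le> 1 / (2 powr real k) powr r"
      unfolding capped_kernel_def using lo z assms unfolding k
      by (intro frac_le powr_mono2 powr_le1) auto
    also have "\<dots> = 2 powr (- real k * r)"
      by (simp add: powr_powr powr_minus_divide)
    finally show ?thesis using hi k by (intro exI[of _ k]) (auto simp: add.commute)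
  next
    case False
    define k where "k = nat (- m - 1)"
    have k: "real_of_int m = - real (Suc k)" using False by (simp add: k_def)
    have "norm z < 2 powr (- real k)" using hi k by simp
    then have "capped_kernel p r z \<le> (2 powr (- real k)) powr p / (2 powr (- real (Suc k))) powr r"
      unfolding capped_kernel_def using lo z assms unfolding k
      by (intro frac_le powr_mono2) auto
    also have "\<dots> = 2 powr (- real k * p + real (Suc k) * r)"
      unfolding powr_powr powr_diff[symmetric] by (simp add: algebra_simps)
    finally show ?thesis using hi k by (intro exI[of _ k]) auto
  qed
qed

lemma suminf_geometric_powr_finite:
  assumes "0 < (e::real)"
  shows "(\<Sum>k. ennreal (A * 2 powr (- real k * e))) < \<infinity>"
proof -
  have "summable (\<lambda>k. A * (2 powr (- e)) ^ k)"
    using assms by (intro summable_mult summable_geometric) (auto simp: powr_less_one)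
  then have "summable (\<lambda>k. \<bar>A\<bar> * (2 powr (- e)) ^ k)"
    using assms by (intro summable_mult summable_geometric) (auto simp: powr_less_one)
  moreover have "(2 powr (- e)) ^ k = 2 powr (- real k * e)" for k
    by (simp add: powr_realpow[symmetric] powr_powr mult.commute)
  ultimately have s: "summable (\<lambda>k. \<bar>A\<bar> * 2 powr (- real k * e))" by simp
  have "(\<Sum>k. ennreal (A * 2 powr (- real k * e))) \<le> (\<Sum>k. ennreal (\<bar>A\<bar> * 2 powr (- real k * e)))"
    by (intro suminf_le ennreal_leI mult_right_mono) auto
  also have "\<dots> < \<infinity>"
    using s by (subst suminf_ennreal2) auto
  finally show ?thesis .
qed

text \<open>Replaces polar coordinates: the kernel is dominated by multiples of indicators of dyadic balls.\<close>

lemma nn_integral_capped_kernel_finite: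
  assumes p: "0 < p" and s: "0 < s" "s < 1"
  shows "(\<integral>\<^sup>+z. ennreal (capped_kernel p (real DIM('a) + s * p) z) \<partial>(lborel :: 'a::euclidean_space measure)) < \<infinity>"
proof -
  define n where "n = real DIM('a)"
  define r where "r = n + s * p"
  define \<omega> where "\<omega> = unit_ball_vol n"
  have n: "0 < n" by (simp add: n_def)
  have r: "0 < r" using n p s by (simp add: r_def add_pos_pos)
  have \<omega>: "0 < \<omega>" using n by (simp add: \<omega>_def)
  define a where "a k = 2 powr (- real k * p + real (Suc k) * r)" for k
  define b where "b k = 2 powr (- real k * r)" for k
  define A where "A k = ball (0::'a) (2 powr (- real k))" for k
  define B where "B k = ball (0::'a) (2 powr real (Suc k))" for k
  have [measurable]: "A k \<in> sets borel" "B k \<in> sets borel" for k by (auto simp: A_def B_def)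
  have pw: "(2 powr t) ^ DIM('a) = 2 powr (n * t)" for t
    by (simp add: powr_realpow[symmetric] powr_powr n_def mult.commute)
  have eA: "ennreal (a k) * emeasure lborel (A k) = ennreal (\<omega> * 2 powr r * 2 powr (- real k * (p * (1 - s))))" for k
  proof -
    have "ennreal (a k) * emeasure lborel (A k) = ennreal (a k * (\<omega> * 2 powr (n * - real k)))"
      using \<omega> by (simp add: A_def emeasure_ball n_def[symmetric] \<omega>_def[symmetric] pw a_def ennreal_mult)
    also have "a k * (\<omega> * 2 powr (n * - real k)) = \<omega> * 2 powr r * 2 powr (- real k * (p * (1 - s)))"
      by (simp add: a_def powr_add[symmetric] r_def algebra_simps)
    finally show ?thesis .
  qed
  have eB: "ennreal (b k) * emeasure lborel (B k) = ennreal (\<omega> * 2 powr n * 2 powr (- real k * (s * p)))" for k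
  proof -
    have "ennreal (b k) * emeasure lborel (B k) = ennreal (b k * (\<omega> * 2 powr (n * real (Suc k))))"
      using \<omega> by (simp add: B_def emeasure_ball n_def[symmetric] \<omega>_def[symmetric] pw b_def ennreal_mult)
    also have "b k * (\<omega> * 2 powr (n * real (Suc k))) = \<omega> * 2 powr n * 2 powr (- real k * (s * p))"
      by (simp add: b_def powr_add[symmetric] r_def algebra_simps)
    finally show ?thesis .
  qed
  have "(\<integral>\<^sup>+z. ennreal (capped_kernel p r z) \<partial>(lborel :: 'a measure)) \<le>
    (\<integral>\<^sup>+z. (\<Sum>k. ennreal (a k) * indicator (A k) z) + (\<Sum>k. ennreal (b k) * indicator (B k) z) \<partial>lborel)"
  proof (rule nn_integral_mono)
    fix z :: 'a
    show "ennreal (capped_kernel p r z) \<le> (\<Sum>k. ennreal (a k) * indicator (A k) z) + (\<Sum>k. ennreal (b k) * indicator (B k) z)"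
    proof (cases "z = 0")
      case False
      have le_suminf: "f k \<le> suminf f" for f :: "nat \<Rightarrow> ennreal" and k
        using sum_le_suminf[of f "{k}"] by simp
      from capped_kernel_shell[OF False p r] obtain k where
        "(z \<in> A k \<and> capped_kernel p r z \<le> a k) \<or> (z \<in> B k \<and> capped_kernel p r z \<le> b k)"
        by (auto simp: A_def B_def a_def b_def)
      then show ?thesis
      proof
        assume h: "z \<in> A k \<and> capped_kernel p r z \<le> a k"
        then have "ennreal (capped_kernel p r z) \<le> ennreal (a k) * indicator (A k) z"
          by (simp add: ennreal_leI)
        also have "\<dots> \<le> (\<Sum>k. ennreal (a k) * indicator (A k) z)"
          by (rule le_suminf)
        finally show ?thesis by (rule order_trans) simp
      next
        assume h: "z \<in> B k \<and> capped_kernel p r z \<le> b k"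
        then have "ennreal (capped_kernel p r z) \<le> ennreal (b k) * indicator (B k) z"
          by (simp add: ennreal_leI)
        also have "\<dots> \<le> (\<Sum>k. ennreal (b k) * indicator (B k) z)"
          by (rule le_suminf)
        finally show ?thesis by (rule order_trans) simp
      qed
    qed (simp add: capped_kernel_def)
  qed
  also have "\<dots> = (\<Sum>k. ennreal (a k) * emeasure lborel (A k)) + (\<Sum>k. ennreal (b k) * emeasure lborel (B k))"
    by (subst nn_integral_add) (auto simp: nn_integral_suminf nn_integral_cmult_indicator)
  also have "\<dots> < \<infinity>"
    unfolding eA eB using suminf_geometric_powr_finite[of "p * (1 - s)" "\<omega> * 2 powr r"]
      suminf_geometric_powr_finite[of "s * p" "\<omega> * 2 powr n"] p s by simp
  finally show ?thesis by (simp add: r_def n_def)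
qed

lemma energy_lipschitz_finite:
  fixes \<zeta> :: "'a::euclidean_space \<Rightarrow> real"
  assumes p: "0 < p" and s: "0 < s" "s < 1" and [measurable]: "\<zeta> \<in> borel_measurable borel"
    and L: "\<And>x y. \<bar>\<zeta> x - \<zeta> y\<bar> \<le> L * norm (x - y)" and B: "\<And>x. \<bar>\<zeta> x\<bar> \<le> B"
    and S: "bounded S" "S \<in> sets borel" "\<And>x. x \<notin> S \<Longrightarrow> \<zeta> x = 0"
  shows "energy p (real DIM('a) + s * p) \<zeta> < \<infinity>"
proof -
  define r where "r = real DIM('a) + s * p"
  define C where "C = max L (2 * B) powr p"
  define G where "G = (\<integral>\<^sup>+z. ennreal (capped_kernel p r z) \<partial>(lborel :: 'a measure))"
  have C: "0 \<le> C" by (simp add: C_def)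
  note S(2) [measurable]
  have B0: "0 \<le> B" using B[of 0] by linarith
  have mx: "0 \<le> max L (2 * B)" using B0 by simp
  have "energy p r \<zeta> \<le> (\<integral>\<^sup>+z. ennreal C * (indicator S (fst z) * ennreal (capped_kernel p r (fst z - snd z)))
     + ennreal C * (indicator S (snd z) * ennreal (capped_kernel p r (fst z - snd z))) \<partial>lborel)"
    unfolding energy_def
  proof (rule nn_integral_mono)
    fix z :: "'a \<times> 'a"
    define x y where "x = fst z" and "y = snd z"
    have "\<bar>\<zeta> x - \<zeta> y\<bar> \<le> max L (2 * B) * min 1 (norm (x - y))"
    proof (cases "norm (x - y) \<le> 1")
      case True
      have "\<bar>\<zeta> x - \<zeta> y\<bar> \<le> max L (2 * B) * norm (x - y)"
        by (rule order_trans[OF L mult_right_mono]) auto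
      then show ?thesis using True by simp
    next
      case False
      then show ?thesis using B[of x] B[of y] by simp
    qed
    then have "\<bar>\<zeta> x - \<zeta> y\<bar> powr p \<le> C * min 1 (norm (x - y)) powr p"
      using p mx unfolding C_def by (subst powr_mult[symmetric]) (auto intro!: powr_mono2)
    then have *: "\<bar>\<zeta> x - \<zeta> y\<bar> powr p / norm (x - y) powr r \<le> C * capped_kernel p r (x - y)"
      unfolding capped_kernel_def by (simp add: divide_right_mono)
    have "ennreal (\<bar>\<zeta> x - \<zeta> y\<bar> powr p / norm (x - y) powr r)
      \<le> ennreal C * (indicator S x * ennreal (capped_kernel p r (x - y))) + ennreal C * (indicator S y * ennreal (capped_kernel p r (x - y)))"
    proof (cases "x \<in> S \<or> y \<in> S")
      case False
      then show ?thesis using S p by simp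
    next
      case True
      have "ennreal (\<bar>\<zeta> x - \<zeta> y\<bar> powr p / norm (x - y) powr r) \<le> ennreal C * ennreal (capped_kernel p r (x - y))"
        using * C by (simp add: ennreal_mult[symmetric] capped_kernel_def ennreal_leI)
      also have "\<dots> \<le> ennreal C * (indicator S x * ennreal (capped_kernel p r (x - y))) + ennreal C * (indicator S y * ennreal (capped_kernel p r (x - y)))"
        using True by (auto simp: indicator_def)
      finally show ?thesis .
    qed
    then show "ennreal (\<bar>\<zeta> (fst z) - \<zeta> (snd z)\<bar> powr p / norm (fst z - snd z) powr r)
      \<le> ennreal C * (indicator S (fst z) * ennreal (capped_kernel p r (fst z - snd z)))
     + ennreal C * (indicator S (snd z) * ennreal (capped_kernel p r (fst z - snd z)))"
      by (simp add: x_def y_def)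
  qed
  also have "\<dots> = ennreal C * (emeasure lborel S * G) + ennreal C * (emeasure lborel S * G)"
  proof -
    have diff: "(\<lambda>z::'a\<times>'a. fst z - snd z) \<in> borel_measurable borel"
      by (intro borel_measurable_continuous_onI continuous_intros)
    have [measurable]: "(\<lambda>z::'a\<times>'a. capped_kernel p r (fst z - snd z)) \<in> borel_measurable borel"
      using measurable_compose[OF diff capped_kernel_measurable] .
    have [measurable]: "(\<lambda>z::'a\<times>'a. indicator S (fst z) :: ennreal) \<in> borel_measurable borel"
      "(\<lambda>z::'a\<times>'a. indicator S (snd z) :: ennreal) \<in> borel_measurable borel"
      using borel_measurable_pair[of "indicator S :: 'a \<Rightarrow> real"] S(2)
      by (auto simp: ennreal_indicator[symmetric] simp del: ennreal_indicator)
    have sym: "capped_kernel p r (x - y) = capped_kernel p r (- x + y)" for x y :: 'a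
      by (simp add: capped_kernel_def norm_minus_commute)
    have sym2: "capped_kernel p r (x - y) = capped_kernel p r (- y + x)" for x y :: 'a
      by simp
    have "(\<integral>\<^sup>+z. indicator S (fst z) * ennreal (capped_kernel p r (fst z - snd z)) \<partial>lborel) = emeasure lborel S * G"
    proof -
      have "(\<integral>\<^sup>+y. ennreal (capped_kernel p r (x - y)) \<partial>lborel) = G" for x :: 'a
        unfolding sym G_def by (rule nn_integral_lborel_shift) measurable
      then show ?thesis
        by (subst nn_integral_lborel_pair(1)) (auto simp: nn_integral_cmult nn_integral_multc)
    qed
    moreover have "(\<integral>\<^sup>+z. indicator S (snd z) * ennreal (capped_kernel p r (fst z - snd z)) \<partial>lborel) = emeasure lborel S * G"
    proof -
      have "(\<integral>\<^sup>+x. ennreal (capped_kernel p r (x - y)) \<partial>lborel) = G" for y :: 'a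
        unfolding sym2 G_def by (rule nn_integral_lborel_shift) measurable
      then show ?thesis
        by (subst nn_integral_lborel_pair(2)) (auto simp: nn_integral_cmult nn_integral_multc)
    qed
    ultimately show ?thesis
      by (subst nn_integral_add) (auto simp: nn_integral_cmult)
  qed
  also have "\<dots> < \<infinity>"
    using nn_integral_capped_kernel_finite[OF p s, where 'a='a] emeasure_bounded_finite[OF S(1)]
    by (auto simp: G_def r_def ennreal_mult_less_top)
  finally show ?thesis by (simp add: r_def)
qed

subsection \<open>Mollification\<close>

lemma nn_integral_translation_continuous:
  fixes w :: "'a::euclidean_space \<Rightarrow> real"
  assumes w[measurable]: "w \<in> borel_measurable borel" and B: "\<And>x. \<bar>w x\<bar> \<le> B"
    and R: "\<And>x. R < norm x \<Longrightarrow> w x = 0" and "0 < e"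
  shows "\<exists>d>0. \<forall>h. norm h < d \<longrightarrow> (\<integral>\<^sup>+x. ennreal \<bar>w (h + x) - w x\<bar> \<partial>lborel) \<le> ennreal e"
proof -
  have B0: "0 \<le> B" using B[of 0] by linarith
  have "w measurable_on UNIV"
    using w by (intro lebesgue_measurable_imp_measurable_on) (auto simp: measurable_completion)
  then obtain N g where N: "negligible N" and g: "\<And>n. continuous_on UNIV (g n)"
    and lim: "\<And>x. x \<notin> N \<Longrightarrow> (\<lambda>n. g n x) \<longlonglongrightarrow> w x"
    unfolding measurable_on_def by auto
  define S where "S = cball (0::'a) (R + 2)"
  define S1 where "S1 = cball (0::'a) (R + 1)"
  have [measurable]: "S \<in> sets borel" "S1 \<in> sets borel" by (auto simp: S_def S1_def)
  define G where "G n x = max (- B) (min B (g n x))" for n x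
  have Gc: "continuous_on UNIV (G n)" for n unfolding G_def by (intro continuous_intros g)
  then have [measurable]: "G n \<in> borel_measurable borel" for n
    by (rule borel_measurable_continuous_onI)
  have Gb: "\<bar>G n x\<bar> \<le> B" for n x using B0 by (auto simp: G_def)
  have Glim: "(\<lambda>n. G n x) \<longlonglongrightarrow> w x" if "x \<notin> N" for x
  proof -
    have "(\<lambda>n. G n x) \<longlonglongrightarrow> max (- B) (min B (w x))"
      unfolding G_def by (intro tendsto_intros lim that)
    moreover have "max (- B) (min B (w x)) = w x" using B[of x] by auto
    ultimately show ?thesis by simp
  qed
  have Sfin: "emeasure lborel S < \<infinity>" unfolding S_def by (rule emeasure_lborel_cball_finite)
  define D where "D n = (\<integral>x. indicator S x * \<bar>w x - G n x\<bar> \<partial>lborel)" for n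
  have domi: "integrable lborel (\<lambda>x. indicator S x * (2 * B))"
    using Sfin by (intro integrable_mult_left integrable_real_indicator) auto
  have nb: "norm (indicator S x * \<bar>w x - G n x\<bar>) \<le> indicator S x * (2 * B)" for x n
    using B[of x] Gb[of n x] by (auto simp: indicator_def)
  have Di: "integrable lborel (\<lambda>x. indicator S x * \<bar>w x - G n x\<bar>)" for n
    by (rule Bochner_Integration.integrable_bound[OF domi]) (use nb B0 in \<open>auto simp: indicator_def\<close>)
  have "D \<longlonglongrightarrow> (\<integral>x. 0 \<partial>(lborel :: 'a measure))"
    unfolding D_def
  proof (rule integral_dominated_convergence[OF _ _ domi])
    have "AE x in lborel. x \<notin> N"
      using N by (metis AE_completion_iff AE_not_in negligible_iff_null_sets)
    then show "AE x in lborel. (\<lambda>n. indicator S x * \<bar>w x - G n x\<bar>) \<longlonglongrightarrow> 0"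
    proof eventually_elim
      case (elim x)
      have "(\<lambda>n. indicator S x * \<bar>w x - G n x\<bar>) \<longlonglongrightarrow> indicator S x * \<bar>w x - w x\<bar>"
        by (intro tendsto_intros Glim elim)
      then show ?case by simp
    qed
    show "AE x in lborel. norm (indicator S x * \<bar>w x - G n x\<bar>) \<le> indicator S x * (2 * B)" for n
      using nb by simp
  qed simp_all
  then have "eventually (\<lambda>n. D n < e / 3) sequentially"
    using \<open>0 < e\<close> by (intro order_tendstoD(2)) auto
  then obtain n where n: "D n < e / 3" by (auto simp: eventually_sequentially)
  define m where "m = measure lborel S"
  have m: "0 \<le> m" by (simp add: m_def)
  have em: "emeasure lborel S = ennreal m"
    using Sfin unfolding m_def by (intro emeasure_eq_ennreal_measure) auto
  define e' where "e' = e / (3 * (m + 1))"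
  have e': "0 < e'" using \<open>0 < e\<close> m by (simp add: e'_def)
  have "uniformly_continuous_on (cball 0 (R + 2)) (G n)"
    by (rule compact_uniformly_continuous[OF continuous_on_subset[OF Gc]]) auto
  then obtain d where d: "0 < d" "\<And>x y. x \<in> S \<Longrightarrow> y \<in> S \<Longrightarrow> dist y x < d \<Longrightarrow> dist (G n y) (G n x) < e'"
    using e' unfolding uniformly_continuous_on_def S_def by metis
  have Dn: "(\<integral>\<^sup>+x. ennreal (indicator S x * \<bar>w x - G n x\<bar>) \<partial>lborel) = ennreal (D n)"
    unfolding D_def by (rule nn_integral_eq_integral[OF Di]) simp
  show ?thesis
  proof (intro exI[of _ "min d 1"] conjI allI impI)
    show "0 < min d 1" using d by simp
    fix h :: 'a assume h: "norm h < min d 1"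
    have pt: "\<bar>w (h + x) - w x\<bar> \<le> indicator S (h + x) * \<bar>w (h + x) - G n (h + x)\<bar> + indicator S x * e'
        + indicator S x * \<bar>w x - G n x\<bar>" for x
    proof (cases "norm x \<le> R + 1")
      case True
      then have xS: "x \<in> S" "h + x \<in> S"
        using h norm_triangle_ineq[of h x] by (auto simp: S_def)
      have "dist (G n (h + x)) (G n x) < e'"
        using h by (intro d xS) (simp add: dist_norm)
      then show ?thesis using xS by (simp add: dist_real_def)
    next
      case False
      then have "w x = 0" by (intro R) simp
      moreover have "w (h + x) = 0"
        using False h norm_triangle_ineq4[of "h + x" h] by (intro R) simp
      ultimately show ?thesis using e' by simp
    qed
    have "(\<integral>\<^sup>+x. ennreal \<bar>w (h + x) - w x\<bar> \<partial>lborel) \<le>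
      (\<integral>\<^sup>+x. (ennreal (indicator S (h + x) * \<bar>w (h + x) - G n (h + x)\<bar>) + ennreal (indicator S x * e'))
        + ennreal (indicator S x * \<bar>w x - G n x\<bar>) \<partial>lborel)"
      using pt e' by (intro nn_integral_mono) (simp flip: ennreal_plus add: ennreal_leI)
    also have "\<dots> = (\<integral>\<^sup>+x. ennreal (indicator S (h + x) * \<bar>w (h + x) - G n (h + x)\<bar>) \<partial>lborel)
      + (\<integral>\<^sup>+x. ennreal (indicator S x * e') \<partial>lborel) + (\<integral>\<^sup>+x. ennreal (indicator S x * \<bar>w x - G n x\<bar>) \<partial>lborel)"
      by (simp add: nn_integral_add)
    also have "(\<integral>\<^sup>+x. ennreal (indicator S (h + x) * \<bar>w (h + x) - G n (h + x)\<bar>) \<partial>lborel) = ennreal (D n)"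
      using nn_integral_lborel_shift[of "\<lambda>x. ennreal (indicator S x * \<bar>w x - G n x\<bar>)" h] by (simp add: Dn)
    also have "(\<integral>\<^sup>+x. ennreal (indicator S x * e') \<partial>lborel) = ennreal (m * e')"
      using e' m by (simp add: ennreal_mult em nn_integral_multc ennreal_indicator)
    also have "ennreal (D n) + ennreal (m * e') + (\<integral>\<^sup>+x. ennreal (indicator S x * \<bar>w x - G n x\<bar>) \<partial>lborel) = ennreal (D n + m * e' + D n)"
      using m e' by (simp add: Dn ennreal_plus[symmetric] D_def del: ennreal_plus)
    also have "\<dots> \<le> ennreal e"
    proof (rule ennreal_leI)
      have "m * e' \<le> e / 3"
        using m \<open>0 < e\<close> by (simp add: e'_def field_simps)
      then show "D n + m * e' + D n \<le> e" using n by simp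
    qed
    finally show "(\<integral>\<^sup>+x. ennreal \<bar>w (h + x) - w x\<bar> \<partial>lborel) \<le> ennreal e" .
  qed
qed

definition bump :: "real poly \<Rightarrow> nat \<Rightarrow> real \<Rightarrow> real" where
  "bump P m t = (if \<bar>t\<bar> < 1 then poly P t / (1 - t\<^sup>2) ^ m * exp (- 1 / (1 - t\<^sup>2)) else 0)"

definition bump_step :: "real poly \<times> nat \<Rightarrow> real poly \<times> nat" where
  "bump_step Pm = (case Pm of (P, m) \<Rightarrow>
     (pderiv P * [:1, 0, -1:]\<^sup>2 + [:0, 2 * real m:] * P * [:1, 0, -1:] - [:0, 2:] * P, m + 2))"

lemma exp_minus_inverse_le:
  assumes "0 < (y::real)"
  shows "exp (- 1 / y) \<le> fact k * y ^ k"
proof -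
  have "(1 / y) ^ k / fact k \<le> (\<Sum>n. (1 / y) ^ n /\<^sub>R fact n)"
    using sum_le_suminf[OF summable_exp_generic[of "1 / y"], of "{k}"] assms by (simp add: divide_inverse mult.commute)
  then have "(1 / y) ^ k / fact k \<le> exp (1 / y)" by (simp add: exp_def)
  then show ?thesis using assms
    by (simp add: exp_minus field_simps power_divide)
qed

lemma bump_bound: "\<exists>C\<ge>0. \<forall>t. \<bar>bump P m t\<bar> \<le> C * (if \<bar>t\<bar> < 1 then (1 - t\<^sup>2)\<^sup>2 else 0)"
proof -
  have "bounded (poly P ` {-1..1})"
    by (intro compact_imp_bounded compact_continuous_image continuous_intros) simp
  then obtain c where c: "\<And>t. t \<in> {-1..1} \<Longrightarrow> \<bar>poly P t\<bar> \<le> c"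
    unfolding bounded_iff by (metis imageI real_norm_def)
  have c0: "0 \<le> c" using c[of 0] by simp
  show ?thesis
  proof (intro exI[of _ "c * fact (m + 2)"] conjI allI)
    fix t :: real
    show "\<bar>bump P m t\<bar> \<le> c * fact (m + 2) * (if \<bar>t\<bar> < 1 then (1 - t\<^sup>2)\<^sup>2 else 0)"
    proof (cases "\<bar>t\<bar> < 1")
      case True
      define y where "y = 1 - t\<^sup>2"
      have y: "0 < y" using True by (simp add: y_def abs_square_less_1)
      have "\<bar>bump P m t\<bar> = \<bar>poly P t\<bar> * (exp (- 1 / y) / y ^ m)"
        using True y by (simp add: bump_def y_def[symmetric] abs_mult)
      also have "\<dots> \<le> c * (fact (m + 2) * y ^ (m + 2) / y ^ m)"
        using True y c0 by (intro mult_mono c divide_right_mono exp_minus_inverse_le) auto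
      also have "\<dots> = c * fact (m + 2) * y\<^sup>2"
        using y by (simp add: power_add power2_eq_square del: fact_Suc)
      finally show ?thesis using True by (simp add: y_def)
    qed (simp add: bump_def)
  qed (use c0 in simp)
qed

lemma DERIV_quadratic_zero:
  fixes f :: "real \<Rightarrow> real"
  assumes "\<And>t. \<bar>f t\<bar> \<le> C * (t - a)\<^sup>2"
  shows "(f has_real_derivative 0) (at a)"
proof -
  have fa: "f a = 0" using assms[of a] by simp
  have "((\<lambda>t. (f t - f a) / (t - a)) \<longlongrightarrow> 0) (at a)"
  proof (rule Lim_null_comparison)
    show "\<forall>\<^sub>F t in at a. norm ((f t - f a) / (t - a)) \<le> C * \<bar>t - a\<bar>"
      unfolding eventually_at_filter
    proof (rule always_eventually, intro allI impI)
      fix t assume "t \<noteq> a"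
      then show "norm ((f t - f a) / (t - a)) \<le> C * \<bar>t - a\<bar>"
        using assms[of t] by (simp add: fa power2_eq_square divide_le_eq abs_mult_self_eq mult.assoc)
    qed
    have "((\<lambda>t. C * \<bar>t - a\<bar>) \<longlongrightarrow> C * \<bar>a - a\<bar>) (at a)" by (intro tendsto_intros)
    then show "((\<lambda>t. C * \<bar>t - a\<bar>) \<longlongrightarrow> 0) (at a)" by simp
  qed
  then show ?thesis by (simp add: has_field_derivative_iff)
qed

lemma bump_deriv:
  "(bump P m has_real_derivative bump (fst (bump_step (P, m))) (snd (bump_step (P, m))) t) (at t)"
proof -
  consider "\<bar>t\<bar> < 1" | "\<bar>t\<bar> > 1" | "\<bar>t\<bar> = 1" by linarith
  then show ?thesis
  proof cases
    case 1
    define y where "y = 1 - t\<^sup>2"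
    have y: "0 < y" using 1 by (simp add: y_def abs_square_less_1)
    have dy: "((\<lambda>t. 1 - t\<^sup>2) has_real_derivative (- 2 * t)) (at t)"
      by (auto intro!: derivative_eq_intros)
    have dp: "((\<lambda>t. (1 - t\<^sup>2) ^ m) has_real_derivative real m * y ^ (m - 1) * (- 2 * t)) (at t)"
      by (rule DERIV_cong[OF DERIV_power[OF dy]]) (simp add: y_def)
    have de: "((\<lambda>t. exp (- 1 / (1 - t\<^sup>2))) has_real_derivative exp (- 1 / y) * (- 2 * t / (y * y))) (at t)"
      using y unfolding y_def by (auto intro!: derivative_eq_intros)
    have "((\<lambda>t. poly P t / (1 - t\<^sup>2) ^ m * exp (- 1 / (1 - t\<^sup>2))) has_real_derivative
       ((poly (pderiv P) t * y ^ m - poly P t * (real m * y ^ (m - 1) * (- 2 * t))) / (y ^ m * y ^ m)) * exp (- 1 / y)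
        + (exp (- 1 / y) * (- 2 * t / (y * y))) * (poly P t / y ^ m)) (at t)"
      using DERIV_mult[OF DERIV_divide[OF poly_DERIV[of P t] dp] de] y by (simp add: y_def)
    moreover have "((poly (pderiv P) t * y ^ m - poly P t * (real m * y ^ (m - 1) * (- 2 * t))) / (y ^ m * y ^ m)) * exp (- 1 / y)
        + (exp (- 1 / y) * (- 2 * t / (y * y))) * (poly P t / y ^ m)
      = bump (fst (bump_step (P, m))) (snd (bump_step (P, m))) t"
    proof -
      have pe: "poly [:1, 0, - 1:] t = y" by (simp add: y_def power2_eq_square)
      have pe': "poly [:0, 2 * real m:] t = 2 * real m * t" "poly [:0, 2:] t = 2 * t" by simp_all
      have "bump (fst (bump_step (P, m))) (snd (bump_step (P, m))) t =
        (poly (pderiv P) t * y\<^sup>2 + 2 * real m * t * poly P t * y - 2 * t * poly P t) / y ^ (m + 2) * exp (- 1 / y)"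
      proof -
        have "poly (fst (bump_step (P, m))) t = poly (pderiv P) t * y\<^sup>2 + 2 * real m * t * poly P t * y - 2 * t * poly P t"
          by (simp only: bump_step_def prod.case fst_conv poly_add poly_diff poly_mult poly_power pe pe')
        moreover have "snd (bump_step (P, m)) = m + 2" by (simp add: bump_step_def)
        ultimately show ?thesis using 1 by (simp add: bump_def y_def[symmetric])
      qed
      moreover have "real m * y ^ (m - 1) = real m * y ^ m / y"
        using y by (cases m) auto
      moreover have "y ^ (m + 2) = y ^ m * (y * y)" by (simp add: power_add power2_eq_square)
      moreover have "(Pd * Z - p * (M * Z / y * (- 2 * t))) / (Z * Z) * E + E * (- 2 * t / (y * y)) * (p / Z)
          = (Pd * y\<^sup>2 + 2 * M * t * p * y - 2 * t * p) / (Z * (y * y)) * E" if "0 < Z" for Pd Z p M E :: real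
        using y that by (simp add: divide_simps power2_eq_square) (simp add: algebra_simps)
      ultimately show ?thesis using y by (simp only: zero_less_power)
    qed
    ultimately have *: "((\<lambda>t. poly P t / (1 - t\<^sup>2) ^ m * exp (- 1 / (1 - t\<^sup>2))) has_real_derivative
       bump (fst (bump_step (P, m))) (snd (bump_step (P, m))) t) (at t)" by simp
    show ?thesis
      by (rule has_field_derivative_transform_within_open[OF *, of "{-1<..<1}"]) (use 1 in \<open>auto simp: bump_def\<close>)
  next
    case 2
    have *: "((\<lambda>_. 0::real) has_real_derivative 0) (at t)" by simp
    have "(bump P m has_real_derivative 0) (at t)"
      by (rule has_field_derivative_transform_within_open[OF *, of "- {-1..1}"]) (use 2 in \<open>auto simp: bump_def\<close>)
    then show ?thesis using 2 by (simp add: bump_def)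
  next
    case 3
    obtain C where C: "C \<ge> 0" "\<And>t. \<bar>bump P m t\<bar> \<le> C * (if \<bar>t\<bar> < 1 then (1 - t\<^sup>2)\<^sup>2 else 0)"
      using bump_bound by blast
    have t2: "t\<^sup>2 = 1" using 3 by (simp add: power2_eq_1_iff abs_if split: if_splits)
    have "\<bar>bump P m x\<bar> \<le> (4 * C) * (x - t)\<^sup>2" for x
    proof (cases "\<bar>x\<bar> < 1")
      case True
      have "1 - x\<^sup>2 = (t - x) * (t + x)" using t2 by (simp add: algebra_simps power2_eq_square)
      then have "(1 - x\<^sup>2)\<^sup>2 = (x - t)\<^sup>2 * (t + x)\<^sup>2" by (simp add: power_mult_distrib power2_commute)
      also have "\<dots> \<le> (x - t)\<^sup>2 * 4"
      proof (rule mult_left_mono)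
        have "\<bar>t + x\<bar> \<le> 2" using True 3 by linarith
        then have "\<bar>t + x\<bar>\<^sup>2 \<le> 2\<^sup>2" by (intro power_mono) auto
        then show "(t + x)\<^sup>2 \<le> 4" by simp
      qed simp
      finally have "C * (1 - x\<^sup>2)\<^sup>2 \<le> C * ((x - t)\<^sup>2 * 4)" using C(1) by (rule mult_left_mono)
      then show ?thesis using C(2)[of x] True by simp
    next
      case False
      then show ?thesis using C(1) by (simp add: bump_def)
    qed
    then have "(bump P m has_real_derivative 0) (at t)" by (rule DERIV_quadratic_zero)
    then show ?thesis using 3 by (simp add: bump_def)
  qed
qed

lemma bump_sequence:
  obtains D :: "nat \<Rightarrow> real \<Rightarrow> real" where
    "\<And>k t. (D k has_real_derivative D (Suc k) t) (at t)"
    "\<And>k. \<exists>C. \<forall>t. \<bar>D k t\<bar> \<le> C"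
    "\<And>k t. 1 \<le> \<bar>t\<bar> \<Longrightarrow> D k t = 0" "\<And>t. 0 \<le> D 0 t" "0 < D 0 0"
proof
  define Pm where "Pm k = (bump_step ^^ k) (1, 0)" for k
  define D where "D k = bump (fst (Pm k)) (snd (Pm k))" for k
  show "(D k has_real_derivative D (Suc k) t) (at t)" for k t
    using bump_deriv[of "fst (Pm k)" "snd (Pm k)" t] by (simp add: D_def Pm_def)
  show "\<exists>C. \<forall>t. \<bar>D k t\<bar> \<le> C" for k
  proof -
    obtain C where C: "C \<ge> 0" "\<And>t. \<bar>D k t\<bar> \<le> C * (if \<bar>t\<bar> < 1 then (1 - t\<^sup>2)\<^sup>2 else 0)"
      using bump_bound unfolding D_def by blast
    have "\<bar>D k t\<bar> \<le> C * 1" for t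
    proof (rule order_trans[OF C(2) mult_left_mono[OF _ C(1)]])
      show "(if \<bar>t\<bar> < 1 then (1 - t\<^sup>2)\<^sup>2 else 0) \<le> 1"
        by (auto simp: abs_square_less_1 abs_square_le_1 intro!: power_le_one)
    qed
    then show ?thesis by auto
  qed
  show "D k t = 0" if "1 \<le> \<bar>t\<bar>" for k t using that by (simp add: D_def bump_def)
  show "0 \<le> D 0 t" for t by (simp add: D_def Pm_def bump_def)
  show "0 < D 0 0" by (simp add: D_def Pm_def bump_def)
qed

lemma convolution_has_derivative:
  fixes K :: "real ^ 'n \<Rightarrow> real" and K' :: "'n \<Rightarrow> real ^ 'n \<Rightarrow> real"
  assumes w: "integrable lborel w"
    and der: "\<And>x. (K has_derivative (\<lambda>h. \<Sum>i\<in>UNIV. h $ i * K' i x)) (at x)"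
    and K'm [measurable]: "\<And>i. K' i \<in> borel_measurable borel"
    and C: "\<And>x. \<bar>K x\<bar> \<le> C" and M: "\<And>i x. \<bar>K' i x\<bar> \<le> M"
  shows "((\<lambda>x. \<integral>y. w y * K (x - y) \<partial>lborel) has_derivative
    (\<lambda>h. \<Sum>i\<in>UNIV. h $ i * (\<integral>y. w y * K' i (x - y) \<partial>lborel))) (at x)"
proof -
  have M0: "0 \<le> M" using M[of undefined undefined] by linarith
  have [measurable]: "w \<in> borel_measurable borel" using w by auto
  have "continuous_on UNIV K"
    using der by (meson continuous_at_imp_continuous_on has_derivative_continuous)
  then have [measurable]: "K \<in> borel_measurable borel" by (rule borel_measurable_continuous_onI)
  have bnd: "\<bar>\<Sum>i\<in>UNIV. h $ i * K' i z\<bar> \<le> real CARD('n) * M * norm h" for h z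
  proof -
    have "\<bar>\<Sum>i\<in>UNIV. h $ i * K' i z\<bar> \<le> (\<Sum>i\<in>UNIV. \<bar>h $ i * K' i z\<bar>)" by (rule sum_abs)
    also have "\<dots> \<le> (\<Sum>i\<in>(UNIV::'n set). norm h * M)"
      unfolding abs_mult by (intro sum_mono mult_mono M component_le_norm_cart) auto
    finally show ?thesis by (simp add: mult_ac)
  qed
  have lip: "\<bar>K (z + h) - K z\<bar> \<le> real CARD('n) * M * norm h" for z h
  proof -
    have "norm (K (z + h) - K z) \<le> real CARD('n) * M * norm (z + h - z)"
    proof (rule differentiable_bound[of UNIV])
      show "onorm (\<lambda>h. \<Sum>i\<in>UNIV. h $ i * K' i a) \<le> real CARD('n) * M" for a
        using bnd by (intro onorm_le) simp
    qed (use der in auto)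
    then show ?thesis by simp
  qed
  have Ki: "integrable lborel (\<lambda>y. w y * K (z - y))" for z
  proof (rule Bochner_Integration.integrable_bound[OF integrable_mult_right[OF w, of C]])
    show "AE y in lborel. norm (w y * K (z - y)) \<le> norm (C * w y)"
    proof (intro AE_I2)
      fix y
      have "\<bar>w y\<bar> * \<bar>K (z - y)\<bar> \<le> \<bar>w y\<bar> * \<bar>C\<bar>"
        using C[of "z - y"] by (intro mult_left_mono) auto
      then show "norm (w y * K (z - y)) \<le> norm (C * w y)" by (simp add: abs_mult mult.commute)
    qed
  qed measurable
  have K'i: "integrable lborel (\<lambda>y. w y * K' i (z - y))" for i z
  proof (rule Bochner_Integration.integrable_bound[OF integrable_mult_right[OF w, of M]])
    show "AE y in lborel. norm (w y * K' i (z - y)) \<le> norm (M * w y)"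
    proof (intro AE_I2)
      fix y
      have "\<bar>w y\<bar> * \<bar>K' i (z - y)\<bar> \<le> \<bar>w y\<bar> * M"
        by (intro mult_left_mono M) auto
      then show "norm (w y * K' i (z - y)) \<le> norm (M * w y)" using M0 by (simp add: abs_mult mult.commute)
    qed
  qed measurable
  define Rm where "Rm h y = (K (x - y + h) - K (x - y) - (\<Sum>i\<in>UNIV. h $ i * K' i (x - y))) / norm h" for h y
  have [measurable]: "Rm h \<in> borel_measurable borel" for h
    unfolding Rm_def by measurable
  have Rb: "\<bar>Rm h y\<bar> \<le> 2 * real CARD('n) * M" if "h \<noteq> 0" for h y
  proof -
    have "\<bar>K (x - y + h) - K (x - y) - (\<Sum>i\<in>UNIV. h $ i * K' i (x - y))\<bar> \<le> 2 * real CARD('n) * M * norm h"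
      using lip[of "x - y" h] bnd[of h "x - y"] by linarith
    then show ?thesis using that by (simp add: Rm_def divide_le_eq)
  qed
  have eq: "((\<integral>y. w y * K (x + h - y) \<partial>lborel) - (\<integral>y. w y * K (x - y) \<partial>lborel)
      - (\<Sum>i\<in>UNIV. h $ i * (\<integral>y. w y * K' i (x - y) \<partial>lborel))) / norm h = (\<integral>y. w y * Rm h y \<partial>lborel)" for h
  proof -
    have "(\<integral>y. w y * Rm h y \<partial>lborel) = (\<integral>y. (w y * K (x + h - y) - w y * K (x - y)
        - (\<Sum>i\<in>UNIV. h $ i * (w y * K' i (x - y)))) / norm h \<partial>lborel)"
      by (intro Bochner_Integration.integral_cong refl)
         (simp add: Rm_def algebra_simps diff_divide_distrib sum_distrib_left)
    also have "\<dots> = ((\<integral>y. w y * K (x + h - y) \<partial>lborel) - (\<integral>y. w y * K (x - y) \<partial>lborel)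
      - (\<Sum>i\<in>UNIV. h $ i * (\<integral>y. w y * K' i (x - y) \<partial>lborel))) / norm h"
      by (simp add: Bochner_Integration.integral_diff Bochner_Integration.integral_sum Ki K'i)
    finally show ?thesis ..
  qed
  have lim: "((\<lambda>h. \<integral>y. w y * Rm h y \<partial>lborel) \<longlongrightarrow> 0) (at 0)"
    unfolding tendsto_at_iff_sequentially comp_def
  proof (intro allI impI)
    fix X :: "nat \<Rightarrow> real ^ 'n"
    assume X: "\<forall>i. X i \<in> UNIV - {0}" "X \<longlonglongrightarrow> 0"
    have "(\<lambda>j. \<integral>y. w y * Rm (X j) y \<partial>lborel) \<longlonglongrightarrow> (\<integral>y. 0 \<partial>(lborel :: (real ^ 'n) measure))"
    proof (rule integral_dominated_convergence)
      show "integrable lborel (\<lambda>y. (2 * real CARD('n) * M) * \<bar>w y\<bar>)" using w by simp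
      show "AE y in lborel. (\<lambda>j. w y * Rm (X j) y) \<longlonglongrightarrow> 0"
      proof (intro AE_I2)
        fix y
        have "((\<lambda>h. norm (K (x - y + h) - K (x - y) - (\<Sum>i\<in>UNIV. h $ i * K' i (x - y))) / norm h) \<longlongrightarrow> 0) (at 0)"
          using der[of "x - y"] by (simp add: has_derivative_at)
        then have "(\<lambda>j. norm (K (x - y + X j) - K (x - y) - (\<Sum>i\<in>UNIV. X j $ i * K' i (x - y))) / norm (X j)) \<longlonglongrightarrow> 0"
          using X unfolding tendsto_at_iff_sequentially comp_def by blast
        then have "(\<lambda>j. norm (Rm (X j) y)) \<longlonglongrightarrow> 0"
          by (simp add: Rm_def)
        then have "(\<lambda>j. Rm (X j) y) \<longlonglongrightarrow> 0" by (rule tendsto_norm_zero_cancel)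
        then show "(\<lambda>j. w y * Rm (X j) y) \<longlonglongrightarrow> 0" by (rule tendsto_mult_right_zero)
      qed
      show "AE y in lborel. norm (w y * Rm (X j) y) \<le> (2 * real CARD('n) * M) * \<bar>w y\<bar>" for j
      proof (intro AE_I2)
        fix y
        have "\<bar>w y\<bar> * \<bar>Rm (X j) y\<bar> \<le> \<bar>w y\<bar> * (2 * real CARD('n) * M)"
          using X by (intro mult_left_mono Rb) auto
        then show "norm (w y * Rm (X j) y) \<le> (2 * real CARD('n) * M) * \<bar>w y\<bar>" by (simp add: abs_mult mult.commute)
      qed
    qed simp_all
    then show "(\<lambda>j. \<integral>y. w y * Rm (X j) y \<partial>lborel) \<longlonglongrightarrow> 0" by simp
  qed
  show ?thesis
    unfolding has_derivative_at
  proof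
    show "bounded_linear (\<lambda>h. \<Sum>i\<in>UNIV. h $ i * (\<integral>y. w y * K' i (x - y) \<partial>lborel))"
      by (intro bounded_linear_sum bounded_linear_mult_const[OF bounded_linear_vec_nth])
    show "((\<lambda>h. norm ((\<integral>y. w y * K (x + h - y) \<partial>lborel) - (\<integral>y. w y * K (x - y) \<partial>lborel)
      - (\<Sum>i\<in>UNIV. h $ i * (\<integral>y. w y * K' i (x - y) \<partial>lborel))) / norm h) \<longlongrightarrow> 0) (at 0)"
      using tendsto_norm_zero[OF lim] by (simp add: eq[symmetric])
  qed
qed

lemma convolution_smooth:
  fixes F :: "(real ^ 'n \<Rightarrow> real) set"
  assumes w: "integrable lborel w" and K: "K \<in> F"
    and F: "\<And>K. K \<in> F \<Longrightarrow> (\<exists>C. \<forall>x. \<bar>K x\<bar> \<le> C) \<and>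
      (\<exists>K'. (\<forall>i. K' i \<in> F) \<and> (\<forall>x. (K has_derivative (\<lambda>h. \<Sum>i\<in>UNIV. h $ i * K' i x)) (at x)))"
  shows "smooth (\<lambda>x. \<integral>y. w y * K (x - y) \<partial>lborel)"
proof -
  have meas: "K \<in> borel_measurable borel" if KF: "K \<in> F" for K
  proof -
    obtain K' where "\<forall>x. (K has_derivative (\<lambda>h. \<Sum>i\<in>UNIV. h $ i * K' i x)) (at x)"
      using F[OF KF] by blast
    then have "continuous_on UNIV K"
      by (auto intro!: continuous_at_imp_continuous_on intro: has_derivative_continuous)
    then show ?thesis by (rule borel_measurable_continuous_onI)
  qed
  have der: "\<exists>K'. (\<forall>i. K' i \<in> F) \<and> (\<forall>x. ((\<lambda>x. \<integral>y. w y * K (x - y) \<partial>lborel) has_derivative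
    (\<lambda>h. \<Sum>i\<in>UNIV. h $ i * (\<integral>y. w y * K' i (x - y) \<partial>lborel))) (at x))" if KF: "K \<in> F" for K
  proof -
    obtain C K' where C: "\<And>x. \<bar>K x\<bar> \<le> C" and K': "\<And>i. K' i \<in> F"
      "\<And>x. (K has_derivative (\<lambda>h. \<Sum>i\<in>UNIV. h $ i * K' i x)) (at x)"
      using F[OF KF] by blast
    obtain M where M: "\<And>i x. \<bar>K' i x\<bar> \<le> M i"
      using F[OF K'(1)] by metis
    have "\<bar>K' i x\<bar> \<le> Max (range M)" for i x
      by (rule order_trans[OF M Max_ge]) auto
    then show ?thesis
      using K' C meas[OF K'(1)] by (intro exI[of _ K']) (auto intro!: convolution_has_derivative[OF w])
  qed
  have "Ck k (\<lambda>x. \<integral>y. w y * K (x - y) \<partial>lborel)" if "K \<in> F" for k K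
    using that
  proof (induction k arbitrary: K)
    case 0
    from der[OF 0] show ?case
      by (auto intro!: continuous_at_imp_continuous_on intro: has_derivative_continuous)
  next
    case (Suc k)
    obtain K' where K': "\<And>i. K' i \<in> F" and d: "\<And>x. ((\<lambda>x. \<integral>y. w y * K (x - y) \<partial>lborel) has_derivative
      (\<lambda>h. \<Sum>i\<in>UNIV. h $ i * (\<integral>y. w y * K' i (x - y) \<partial>lborel))) (at x)"
      using der[OF Suc.prems] by blast
    have "frechet_derivative (\<lambda>x. \<integral>y. w y * K (x - y) \<partial>lborel) (at x) (axis i 1) = (\<integral>y. w y * K' i (x - y) \<partial>lborel)" for i x
      unfolding frechet_derivative_at[OF d, symmetric] by (simp add: axis_def if_distrib[of "\<lambda>a. a * _"] cong: if_cong)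
    moreover have "(\<lambda>x. \<integral>y. w y * K (x - y) \<partial>lborel) differentiable (at x)" for x
      using d by (rule differentiableI)
    ultimately show ?case
      using Suc.IH[OF K'] by simp
  qed
  then show ?thesis using K by (simp add: smooth_def)
qed

lemma mollifier_exists:
  assumes "0 < d"
  obtains \<rho> :: "real ^ 'n \<Rightarrow> real" where "\<rho> \<in> borel_measurable borel" "\<And>x. 0 \<le> \<rho> x" "\<And>x. d \<le> norm x \<Longrightarrow> \<rho> x = 0"
    "integrable lborel \<rho>" "(\<integral>x. \<rho> x \<partial>lborel) = 1"
    "\<And>w. integrable lborel w \<Longrightarrow> smooth (\<lambda>x. \<integral>y. w y * \<rho> (x - y) \<partial>lborel)"
proof -
  obtain D :: "nat \<Rightarrow> real \<Rightarrow> real" where D: "\<And>k t. (D k has_real_derivative D (Suc k) t) (at t)"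
    and Db: "\<And>k. \<exists>C. \<forall>t. \<bar>D k t\<bar> \<le> C" and D0: "\<And>k t. 1 \<le> \<bar>t\<bar> \<Longrightarrow> D k t = 0"
    and Dpos: "\<And>t. 0 \<le> D 0 t" "0 < D 0 0"
    using bump_sequence by blast
  define a where "a = real CARD('n) / d"
  have a: "0 < a" using assms by (simp add: a_def)
  define K where "K c \<sigma> x = c * (\<Prod>i\<in>UNIV. a ^ \<sigma> i * D (\<sigma> i) (a * x $ i))" for c \<sigma> and x :: "real ^ 'n"
  have der: "(K c \<sigma> has_derivative (\<lambda>h. \<Sum>i\<in>UNIV. h $ i * K c (\<sigma>(i := Suc (\<sigma> i))) x)) (at x)" for c \<sigma> x
  proof -
    have 1: "((\<lambda>x::real ^ 'n. a ^ \<sigma> i * D (\<sigma> i) (a * x $ i)) has_derivative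
      (\<lambda>h. h $ i * (a ^ Suc (\<sigma> i) * D (Suc (\<sigma> i)) (a * x $ i)))) (at x)" for i
    proof -
      have "((\<lambda>x::real ^ 'n. D (\<sigma> i) (a * x $ i)) has_derivative (\<lambda>h. (a * h $ i) * D (Suc (\<sigma> i)) (a * x $ i))) (at x)"
        by (rule DERIV_compose_FDERIV[OF D]) (intro has_derivative_mult_right bounded_linear_imp_has_derivative bounded_linear_vec_nth)
      from has_derivative_mult_right[OF this, of "a ^ \<sigma> i"] show ?thesis
        by (simp add: mult_ac)
    qed
    have 2: "a ^ Suc (\<sigma> i) * D (Suc (\<sigma> i)) (a * x $ i) * (\<Prod>j\<in>UNIV - {i}. a ^ \<sigma> j * D (\<sigma> j) (a * x $ j))
      = (\<Prod>j\<in>UNIV. a ^ (\<sigma>(i := Suc (\<sigma> i))) j * D ((\<sigma>(i := Suc (\<sigma> i))) j) (a * x $ j))" for i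
      by (subst (2) prod.remove[of _ i]) (auto intro!: prod.cong)
    have "c * (\<Sum>i\<in>UNIV. h $ i * (a ^ Suc (\<sigma> i) * D (Suc (\<sigma> i)) (a * x $ i)) * (\<Prod>j\<in>UNIV - {i}. a ^ \<sigma> j * D (\<sigma> j) (a * x $ j)))
      = (\<Sum>i\<in>UNIV. h $ i * K c (\<sigma>(i := Suc (\<sigma> i))) x)" for h :: "real ^ 'n"
      unfolding K_def sum_distrib_left
      by (rule sum.cong[OF refl], unfold 2[symmetric]) (simp only: mult_ac)
    note 3 = this
    have "((\<lambda>x. c * (\<Prod>i\<in>UNIV. a ^ \<sigma> i * D (\<sigma> i) (a * x $ i))) has_derivative
      (\<lambda>h. c * (\<Sum>i\<in>UNIV. h $ i * (a ^ Suc (\<sigma> i) * D (Suc (\<sigma> i)) (a * x $ i)) * (\<Prod>j\<in>UNIV - {i}. a ^ \<sigma> j * D (\<sigma> j) (a * x $ j))))) (at x)"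
      by (intro has_derivative_mult_right has_derivative_prod 1)
    moreover have "K c \<sigma> = (\<lambda>x. c * (\<Prod>i\<in>UNIV. a ^ \<sigma> i * D (\<sigma> i) (a * x $ i)))"
      by (simp add: K_def fun_eq_iff)
    ultimately show ?thesis
      unfolding 3 by (simp only:)
  qed
  have bd: "\<exists>C. \<forall>x. \<bar>K c \<sigma> x\<bar> \<le> C" for c \<sigma>
  proof -
    obtain B where B: "\<And>k t. \<bar>D k t\<bar> \<le> B k" using Db by metis
    have "\<bar>K c \<sigma> x\<bar> \<le> \<bar>c\<bar> * (\<Prod>i\<in>UNIV. a ^ \<sigma> i * B (\<sigma> i))" for x
      unfolding K_def abs_mult abs_prod using a B by (intro mult_left_mono prod_mono) (auto simp: abs_mult)
    then show ?thesis by blast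
  qed
  have smoothK: "smooth (\<lambda>x. \<integral>y. w y * K c \<sigma> (x - y) \<partial>lborel)" if "integrable lborel w" for w c \<sigma>
  proof (rule convolution_smooth[OF that, of _ "range (K c)"])
    fix L assume "L \<in> range (K c)"
    then obtain \<sigma> where \<sigma>: "L = K c \<sigma>" by blast
    show "(\<exists>C. \<forall>x. \<bar>L x\<bar> \<le> C) \<and>
      (\<exists>K'. (\<forall>i. K' i \<in> range (K c)) \<and> (\<forall>x. (L has_derivative (\<lambda>h. \<Sum>i\<in>UNIV. h $ i * K' i x)) (at x)))"
      unfolding \<sigma> using bd[of c \<sigma>] der[of c \<sigma>] by (intro conjI exI[of _ "\<lambda>i. K c (\<sigma>(i := Suc (\<sigma> i)))"]) auto
  qed auto
  have cont: "continuous_on UNIV (K c \<sigma>)" for c \<sigma>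
    using der by (meson continuous_at_imp_continuous_on has_derivative_continuous)
  then have meas [measurable]: "K c \<sigma> \<in> borel_measurable borel" for c \<sigma>
    by (rule borel_measurable_continuous_onI)
  define z where "z = (\<lambda>i::'n. 0::nat)"
  have Kpos: "0 \<le> K 1 z x" for x
    using Dpos by (auto simp: K_def z_def intro!: prod_nonneg)
  have K00: "0 < K 1 z 0" using Dpos by (auto simp: K_def z_def intro!: prod_pos)
  have supp: "K c z x = 0" if "d \<le> norm x" for x c
  proof -
    have "\<exists>i. 1 \<le> \<bar>a * x $ i\<bar>"
    proof (rule ccontr)
      assume "\<nexists>i. 1 \<le> \<bar>a * x $ i\<bar>"
      then have lt: "\<bar>x $ i\<bar> < 1 / a" for i
        using a by (auto simp: abs_mult not_le field_simps)
      have "norm x \<le> (\<Sum>i\<in>UNIV. \<bar>x $ i\<bar>)" by (rule norm_le_l1_cart)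
      also have "\<dots> < (\<Sum>i\<in>(UNIV::'n set). 1 / a)" by (rule sum_strict_mono) (auto simp: lt)
      also have "\<dots> = d" using assms by (simp add: a_def)
      finally show False using that by simp
    qed
    then obtain i where "1 \<le> \<bar>a * x $ i\<bar>" by blast
    then have "D 0 (a * x $ i) = 0" by (rule D0)
    then show ?thesis by (auto simp: K_def z_def intro!: prod_zero)
  qed
  have int: "integrable lborel (K c z)" for c
  proof -
    obtain C where C: "\<And>x. \<bar>K c z x\<bar> \<le> C" using bd by blast
    have "integrable lborel (\<lambda>x::real^'n. indicator (cball 0 d) x * C)"
      using emeasure_lborel_cball_finite[of "0::real^'n" d]
      by (intro integrable_mult_left integrable_real_indicator) auto
    then show ?thesis
    proof (rule Bochner_Integration.integrable_bound)
      show "AE x in lborel. norm (K c z x) \<le> norm (indicator (cball 0 d) x * C)"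
        using C supp[of _ c] order_trans[OF C abs_ge_self] by (intro AE_I2) (auto simp: indicator_def)
    qed measurable
  qed
  have ipos: "0 < (\<integral>x. K 1 z x \<partial>lborel)"
  proof -
    have "(\<integral>x. K 1 z x \<partial>lborel) \<noteq> 0"
    proof
      assume "(\<integral>x. K 1 z x \<partial>lborel) = 0"
      then have "AE x in lborel. K 1 z x = 0"
        using integral_nonneg_eq_0_iff_AE[OF int[of 1]] Kpos by auto
      then have "AE x in lebesgue. K 1 z x = 0" by (rule AE_completion)
      moreover have "open {x. 0 < K 1 z x}"
        using open_Collect_less[OF continuous_on_const cont[of 1 z]] by simp
      ultimately have "negligible {x. 0 < K 1 z x}"
        unfolding negligible_iff_null_sets by (subst AE_iff_null_sets) (auto elim!: eventually_mono simp: borel_open)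
      then show False using open_not_negligible[OF \<open>open _\<close>] K00 by auto
    qed
    moreover have "0 \<le> (\<integral>x. K 1 z x \<partial>lborel)" using Kpos by simp
    ultimately show ?thesis by simp
  qed
  define c where "c = 1 / (\<integral>x. K 1 z x \<partial>lborel)"
  have Kc: "K c z x = c * K 1 z x" for x by (simp add: K_def)
  show ?thesis
  proof
    show "K c z \<in> borel_measurable borel" by measurable
    show "0 \<le> K c z x" for x unfolding Kc using Kpos ipos by (simp add: c_def)
    show "d \<le> norm x \<Longrightarrow> K c z x = 0" for x by (rule supp)
    show "integrable lborel (K c z)" by (rule int)
    show "(\<integral>x. K c z x \<partial>lborel) = 1" unfolding Kc using ipos by (simp add: c_def)
    show "smooth (\<lambda>x. \<integral>y. w y * K c z (x - y) \<partial>lborel)" if "integrable lborel w" for w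
      by (rule smoothK[OF that])
  qed
qed

subsection \<open>Weak convergence in \<open>L\<^sup>p\<close>\<close>

lemma powr_mult_le_sum:
  fixes a b p :: real
  assumes "1 < p" "0 \<le> a" "0 \<le> b"
  shows "a powr (p - 1) * b \<le> a powr p + b powr p"
proof (cases "a = 0 \<or> b = 0")
  case False
  with assms have ab: "0 < a" "0 < b" by auto
  show ?thesis
  proof (cases "a \<le> b")
    case True
    have "a powr (p - 1) * b \<le> b powr (p - 1) * b powr 1"
      using True ab assms by (intro mult_mono powr_mono2) auto
    also have "\<dots> = b powr p" using ab powr_mult_base[of b "p - 1"] by (simp add: mult.commute)
    finally show ?thesis using powr_ge_zero[of a p] by linarith
  next
    case False
    have "a powr (p - 1) * b \<le> a powr (p - 1) * a powr 1"
      using False ab by (intro mult_left_mono) auto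
    also have "\<dots> = a powr p" using ab powr_mult_base[of a "p - 1"] by (simp add: mult.commute)
    finally show ?thesis using powr_ge_zero[of b p] by linarith
  qed
qed (use assms in auto)

lemma tangent_powr:
  assumes "1 \<le> p" "0 < a" "0 \<le> (y::real)"
  shows "a powr p + p * a powr (p - 1) * (y - a) \<le> y powr p"
proof (cases "y = 0")
  case True
  have "a powr (p - 1) * a = a powr p"
    using assms powr_mult_base[of a "p - 1"] by (simp add: mult.commute)
  moreover have "1 * a powr p \<le> p * a powr p" using assms by (intro mult_right_mono) auto
  ultimately show ?thesis using True by (simp add: mult.assoc)
next
  case False
  have "p * a powr (p - 1) * (y - a) \<le> y powr p - a powr p"
    using assms False
    by (intro convex_on_imp_above_tangent[of "{0<..}"] powr_convex)
       (auto simp: interior_open intro!: DERIV_subset[OF has_real_derivative_powr])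
  then show ?thesis by simp
qed

lemma (in prob_space) jensen_powr:
  fixes Y :: "'a \<Rightarrow> real"
  assumes p: "1 \<le> p" and Y: "integrable M Y" "\<And>x. 0 \<le> Y x" and "integrable M (\<lambda>x. Y x powr p)"
  shows "expectation Y powr p \<le> expectation (\<lambda>x. Y x powr p)"
proof (cases "expectation Y = 0")
  case False
  define a where "a = expectation Y"
  have "0 \<le> a" unfolding a_def using Y(2) by (intro integral_nonneg_AE AE_I2)
  with False have a: "0 < a" by (simp add: a_def)
  have "a powr p = expectation (\<lambda>x. a powr p + p * a powr (p - 1) * (Y x - a))"
    using Y(1) prob_space by (simp add: a_def)
  also have "\<dots> \<le> expectation (\<lambda>x. Y x powr p)"
    using assms a by (intro integral_mono) (auto intro!: tangent_powr)
  finally show ?thesis by (simp add: a_def)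
qed (use Y in simp)

lemma powr_diff_le:
  fixes a b p :: real
  assumes "0 < p"
  shows "\<bar>a - b\<bar> powr p \<le> 2 powr p * (\<bar>a\<bar> powr p + \<bar>b\<bar> powr p)"
proof -
  have "\<bar>a - b\<bar> powr p \<le> (2 * max \<bar>a\<bar> \<bar>b\<bar>) powr p"
    using assms by (intro powr_mono2) auto
  also have "\<dots> = 2 powr p * (max \<bar>a\<bar> \<bar>b\<bar>) powr p" by (simp add: powr_mult)
  also have "\<dots> \<le> 2 powr p * (\<bar>a\<bar> powr p + \<bar>b\<bar> powr p)"
    by (intro mult_left_mono) (auto simp: max_def)
  finally show ?thesis .
qed

text \<open>The integrand is split according to whether \<open>\<bar>g j - gl\<bar>\<close> exceeds a large multiple of \<open>\<bar>V\<bar>\<close>.\<close>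

lemma weak_limit_powr:
  fixes V gl :: "'a \<Rightarrow> real" and g :: "nat \<Rightarrow> 'a \<Rightarrow> real"
  assumes p: "1 < p" and V[measurable]: "V \<in> borel_measurable M" and [measurable]: "\<And>j. g j \<in> borel_measurable M"
    "gl \<in> borel_measurable M"
    and VI: "(\<integral>\<^sup>+x. ennreal (\<bar>V x\<bar> powr p) \<partial>M) < \<infinity>"
    and gB: "\<And>j. (\<integral>\<^sup>+x. ennreal (\<bar>g j x\<bar> powr p) \<partial>M) \<le> B" "B < \<infinity>"
    and lim: "AE x in M. (\<lambda>j. g j x) \<longlonglongrightarrow> gl x"
  shows "(\<lambda>j. \<integral>x. \<bar>V x\<bar> powr (p - 2) * V x * g j x \<partial>M) \<longlonglongrightarrow> (\<integral>x. \<bar>V x\<bar> powr (p - 2) * V x * gl x \<partial>M)"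
proof -
  have glB: "(\<integral>\<^sup>+x. ennreal (\<bar>gl x\<bar> powr p) \<partial>M) \<le> B"
  proof -
    have "(\<integral>\<^sup>+x. ennreal (\<bar>gl x\<bar> powr p) \<partial>M) = (\<integral>\<^sup>+x. liminf (\<lambda>j. ennreal (\<bar>g j x\<bar> powr p)) \<partial>M)"
    proof (intro nn_integral_cong_AE)
      show "AE x in M. ennreal (\<bar>gl x\<bar> powr p) = liminf (\<lambda>j. ennreal (\<bar>g j x\<bar> powr p))"
        using lim
      proof eventually_elim
        case (elim x)
        have "(\<lambda>j. ennreal (\<bar>g j x\<bar> powr p)) \<longlonglongrightarrow> ennreal (\<bar>gl x\<bar> powr p)"
          using p by (intro tendsto_ennrealI tendsto_powr' tendsto_intros elim) auto
        then show ?case by (rule lim_imp_Liminf[OF sequentially_bot, symmetric])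
      qed
    qed
    also have "\<dots> \<le> liminf (\<lambda>j. \<integral>\<^sup>+x. ennreal (\<bar>g j x\<bar> powr p) \<partial>M)"
      by (rule nn_integral_liminf) measurable
    also have "\<dots> \<le> liminf (\<lambda>j. B)"
      by (intro Liminf_mono always_eventually allI gB)
    finally show ?thesis by (simp add: Liminf_const)
  qed
  have abs_eq: "\<bar>\<bar>V x\<bar> powr (p - 2) * V x * b\<bar> = \<bar>V x\<bar> powr (p - 1) * \<bar>b\<bar>" for x b
  proof -
    have "\<bar>V x\<bar> powr (p - 2) * \<bar>V x\<bar> = \<bar>V x\<bar> powr (p - 1)"
      using powr_mult_base[of "\<bar>V x\<bar>" "p - 2"] by (simp add: mult.commute)
    then show ?thesis by (simp add: abs_mult)
  qed
  have int: "integrable M (\<lambda>x. \<bar>V x\<bar> powr (p - 2) * V x * h x)"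
    if [measurable]: "h \<in> borel_measurable M" and h: "(\<integral>\<^sup>+x. ennreal (\<bar>h x\<bar> powr p) \<partial>M) < \<infinity>" for h
  proof (rule integrableI_bounded)
    have "(\<integral>\<^sup>+x. ennreal (norm (\<bar>V x\<bar> powr (p - 2) * V x * h x)) \<partial>M)
      \<le> (\<integral>\<^sup>+x. ennreal (\<bar>V x\<bar> powr p) + ennreal (\<bar>h x\<bar> powr p) \<partial>M)"
      using p by (intro nn_integral_mono) (auto simp: abs_eq simp flip: ennreal_plus intro!: ennreal_leI powr_mult_le_sum)
    also have "\<dots> < \<infinity>" using VI h by (simp add: nn_integral_add)
    finally show "(\<integral>\<^sup>+x. ennreal (norm (\<bar>V x\<bar> powr (p - 2) * V x * h x)) \<partial>M) < \<infinity>" .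
  qed measurable
  define f where "f j x = g j x - gl x" for j x
  have [measurable]: "f j \<in> borel_measurable M" for j unfolding f_def by measurable
  have gfin: "(\<integral>\<^sup>+x. ennreal (\<bar>g j x\<bar> powr p) \<partial>M) < \<infinity>" for j
    using gB by (rule le_less_trans)
  have glfin: "(\<integral>\<^sup>+x. ennreal (\<bar>gl x\<bar> powr p) \<partial>M) < \<infinity>"
    using glB gB(2) by (rule le_less_trans)
  define B' where "B' = enn2real (ennreal (2 powr p) * (B + B))"
  have B'e: "ennreal B' = ennreal (2 powr p) * (B + B)"
    unfolding B'_def using gB(2) by (intro ennreal_enn2real) (auto simp: ennreal_mult_less_top)
  have B'0: "0 \<le> B'" by (simp add: B'_def)
  have fB: "(\<integral>\<^sup>+x. ennreal (\<bar>f j x\<bar> powr p) \<partial>M) \<le> ennreal B'" for j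
  proof -
    have "(\<integral>\<^sup>+x. ennreal (\<bar>f j x\<bar> powr p) \<partial>M)
      \<le> (\<integral>\<^sup>+x. ennreal (2 powr p) * (ennreal (\<bar>g j x\<bar> powr p) + ennreal (\<bar>gl x\<bar> powr p)) \<partial>M)"
      unfolding f_def using p
      by (intro nn_integral_mono) (simp flip: ennreal_plus ennreal_mult add: ennreal_leI powr_diff_le)
    also have "\<dots> = ennreal (2 powr p) * ((\<integral>\<^sup>+x. ennreal (\<bar>g j x\<bar> powr p) \<partial>M) + (\<integral>\<^sup>+x. ennreal (\<bar>gl x\<bar> powr p) \<partial>M))"
      by (simp add: nn_integral_cmult nn_integral_add)
    also have "\<dots> \<le> ennreal B'"
      unfolding B'e by (intro mult_left_mono add_mono gB glB) auto
    finally show ?thesis .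
  qed
  have If: "integrable M (\<lambda>x. \<bar>V x\<bar> powr (p - 1) * \<bar>f j x\<bar>)" for j
  proof -
    have "(\<integral>\<^sup>+x. ennreal (\<bar>f j x\<bar> powr p) \<partial>M) < \<infinity>" using fB[of j] by (rule le_less_trans) simp
    from integrable_abs[OF int[OF _ this]] show ?thesis by (simp add: abs_eq)
  qed
  have Ifp: "integrable M (\<lambda>x. \<bar>f j x\<bar> powr p)" "(\<integral>x. \<bar>f j x\<bar> powr p \<partial>M) \<le> B'" for j
  proof -
    show i: "integrable M (\<lambda>x. \<bar>f j x\<bar> powr p)"
      using fB[of j] by (intro integrableI_bounded) (auto intro: le_less_trans)
    show "(\<integral>x. \<bar>f j x\<bar> powr p \<partial>M) \<le> B'"
      using fB[of j] B'0 nn_integral_eq_integral[OF i] by simp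
  qed
  have VIi: "integrable M (\<lambda>x. \<bar>V x\<bar> powr p)"
    using VI by (intro integrableI_bounded) auto
  have main: "(\<lambda>j. \<integral>x. \<bar>V x\<bar> powr (p - 1) * \<bar>f j x\<bar> \<partial>M) \<longlonglongrightarrow> 0"
  proof (rule LIMSEQ_I)
    fix e :: real assume e: "0 < e"
    define m where "m = (2 * B' / e + 1) powr (1 / (p - 1))"
    have base: "0 < 2 * B' / e + 1" using B'0 e by (simp add: add_nonneg_pos)
    have m: "0 < m" using base by (simp add: m_def)
    have mp: "m powr (p - 1) = 2 * B' / e + 1" using base p by (simp add: m_def powr_powr)
    have me: "B' / m powr (p - 1) < e / 2"
      unfolding mp using base e B'0 by (simp add: field_simps)
    define F where "F j x = \<bar>V x\<bar> powr (p - 1) * min \<bar>f j x\<bar> (m * \<bar>V x\<bar>)" for j x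
    have [measurable]: "F j \<in> borel_measurable M" for j unfolding F_def by measurable
    have Fb: "\<bar>F j x\<bar> \<le> m * \<bar>V x\<bar> powr p" for j x
    proof -
      have "\<bar>F j x\<bar> \<le> \<bar>V x\<bar> powr (p - 1) * (m * \<bar>V x\<bar>)"
        unfolding F_def using m by (subst abs_of_nonneg) (auto intro!: mult_left_mono)
      also have "\<dots> = m * (\<bar>V x\<bar> * \<bar>V x\<bar> powr (p - 1))" by simp
      also have "\<bar>V x\<bar> * \<bar>V x\<bar> powr (p - 1) = \<bar>V x\<bar> powr p" by (simp add: powr_mult_base)
      finally show ?thesis .
    qed
    have "(\<lambda>j. \<integral>x. F j x \<partial>M) \<longlonglongrightarrow> (\<integral>x. 0 \<partial>M)"
    proof (rule integral_dominated_convergence)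
      show "integrable M (\<lambda>x. m * \<bar>V x\<bar> powr p)" using VIi by simp
      show "AE x in M. (\<lambda>j. F j x) \<longlonglongrightarrow> 0" using lim
      proof eventually_elim
        case (elim x)
        have "(\<lambda>j. f j x) \<longlonglongrightarrow> gl x - gl x" unfolding f_def by (intro tendsto_intros elim)
        then have "(\<lambda>j. F j x) \<longlonglongrightarrow> \<bar>V x\<bar> powr (p - 1) * min \<bar>gl x - gl x\<bar> (m * \<bar>V x\<bar>)"
          unfolding F_def by (intro tendsto_intros)
        then show ?case using m by simp
      qed
      show "AE x in M. norm (F j x) \<le> m * \<bar>V x\<bar> powr p" for j using Fb by simp
    qed simp_all
    then have "(\<lambda>j. \<integral>x. F j x \<partial>M) \<longlonglongrightarrow> 0" by simp
    then have "eventually (\<lambda>j. (\<integral>x. F j x \<partial>M) < e / 2) sequentially"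
      using e by (intro order_tendstoD(2)) auto
    then obtain j0 where j0: "\<And>j. j0 \<le> j \<Longrightarrow> (\<integral>x. F j x \<partial>M) < e / 2"
      by (auto simp: eventually_sequentially)
    have FI: "integrable M (F j)" for j
      by (rule Bochner_Integration.integrable_bound[of _ "\<lambda>x. m * \<bar>V x\<bar> powr p"])
         (use VIi Fb m in \<open>auto simp: abs_mult\<close>)
    have "norm (\<integral>x. \<bar>V x\<bar> powr (p - 1) * \<bar>f j x\<bar> \<partial>M) < e" if "j0 \<le> j" for j
    proof -
      have "(\<integral>x. \<bar>V x\<bar> powr (p - 1) * \<bar>f j x\<bar> \<partial>M) \<le> (\<integral>x. F j x + \<bar>f j x\<bar> powr p / m powr (p - 1) \<partial>M)"
      proof (rule integral_mono[OF If])
        show "integrable M (\<lambda>x. F j x + \<bar>f j x\<bar> powr p / m powr (p - 1))" using FI Ifp(1) by simp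
        fix x
        show "\<bar>V x\<bar> powr (p - 1) * \<bar>f j x\<bar> \<le> F j x + \<bar>f j x\<bar> powr p / m powr (p - 1)"
        proof (cases "\<bar>f j x\<bar> \<le> m * \<bar>V x\<bar>")
          case False
          then have "m * \<bar>V x\<bar> \<le> \<bar>f j x\<bar>" by simp
          then have "\<bar>V x\<bar> powr (p - 1) \<le> (\<bar>f j x\<bar> / m) powr (p - 1)"
            using m p by (intro powr_mono2) (auto simp: field_simps)
          then have "\<bar>V x\<bar> powr (p - 1) * \<bar>f j x\<bar> \<le> (\<bar>f j x\<bar> / m) powr (p - 1) * \<bar>f j x\<bar>"
            by (rule mult_right_mono) simp
          also have "\<dots> = (\<bar>f j x\<bar> * \<bar>f j x\<bar> powr (p - 1)) / m powr (p - 1)"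
            using m by (simp add: powr_divide)
          also have "\<bar>f j x\<bar> * \<bar>f j x\<bar> powr (p - 1) = \<bar>f j x\<bar> powr p" by (simp add: powr_mult_base)
          finally have "\<bar>V x\<bar> powr (p - 1) * \<bar>f j x\<bar> \<le> \<bar>f j x\<bar> powr p / m powr (p - 1)" .
          moreover have "0 \<le> F j x" using m by (simp add: F_def)
          ultimately show ?thesis by linarith
        qed (simp add: F_def)
      qed
      also have "\<dots> = (\<integral>x. F j x \<partial>M) + (\<integral>x. \<bar>f j x\<bar> powr p \<partial>M) / m powr (p - 1)"
        using FI Ifp(1) by simp
      also have "\<dots> \<le> (\<integral>x. F j x \<partial>M) + B' / m powr (p - 1)"
        using Ifp(2) by (intro add_left_mono divide_right_mono) auto
      also have "\<dots> < e" using j0[OF that] me by linarith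
      finally show ?thesis by simp
    qed
    then show "\<exists>no. \<forall>n\<ge>no. norm ((\<integral>x. \<bar>V x\<bar> powr (p - 1) * \<bar>f n x\<bar> \<partial>M) - 0) < e" by auto
  qed
  show ?thesis
  proof (rule Lim_transform2[OF tendsto_const], rule Lim_null_comparison[OF _ main])
    show "\<forall>\<^sub>F j in sequentially. norm ((\<integral>x. \<bar>V x\<bar> powr (p - 2) * V x * gl x \<partial>M) - (\<integral>x. \<bar>V x\<bar> powr (p - 2) * V x * g j x \<partial>M))
      \<le> (\<integral>x. \<bar>V x\<bar> powr (p - 1) * \<bar>f j x\<bar> \<partial>M)"
    proof (intro always_eventually allI)
      fix j
      have "(\<integral>x. \<bar>V x\<bar> powr (p - 2) * V x * gl x \<partial>M) - (\<integral>x. \<bar>V x\<bar> powr (p - 2) * V x * g j x \<partial>M)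
        = (\<integral>x. \<bar>V x\<bar> powr (p - 2) * V x * gl x - \<bar>V x\<bar> powr (p - 2) * V x * g j x \<partial>M)"
      proof (rule Bochner_Integration.integral_diff[symmetric])
        show "integrable M (\<lambda>x. \<bar>V x\<bar> powr (p - 2) * V x * gl x)" by (rule int[OF _ glfin]) measurable
        show "integrable M (\<lambda>x. \<bar>V x\<bar> powr (p - 2) * V x * g j x)" by (rule int[OF _ gfin]) measurable
      qed
      then have "norm ((\<integral>x. \<bar>V x\<bar> powr (p - 2) * V x * gl x \<partial>M) - (\<integral>x. \<bar>V x\<bar> powr (p - 2) * V x * g j x \<partial>M))
        = norm (\<integral>x. \<bar>V x\<bar> powr (p - 2) * V x * gl x - \<bar>V x\<bar> powr (p - 2) * V x * g j x \<partial>M)"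
        by (rule arg_cong)
      also have "\<dots> \<le> (\<integral>x. norm (\<bar>V x\<bar> powr (p - 2) * V x * gl x - \<bar>V x\<bar> powr (p - 2) * V x * g j x) \<partial>M)"
        by (rule integral_norm_bound)
      also have "\<dots> = (\<integral>x. \<bar>V x\<bar> powr (p - 1) * \<bar>f j x\<bar> \<partial>M)"
      proof (intro Bochner_Integration.integral_cong refl)
        fix x
        have "norm (\<bar>V x\<bar> powr (p - 2) * V x * gl x - \<bar>V x\<bar> powr (p - 2) * V x * g j x)
          = \<bar>\<bar>V x\<bar> powr (p - 2) * V x * (g j x - gl x)\<bar>"
          unfolding real_norm_def right_diff_distrib by (rule abs_minus_commute)
        then show "norm (\<bar>V x\<bar> powr (p - 2) * V x * gl x - \<bar>V x\<bar> powr (p - 2) * V x * g j x)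
          = \<bar>V x\<bar> powr (p - 1) * \<bar>f j x\<bar>" by (simp only: abs_eq f_def)
      qed
      finally show "norm ((\<integral>x. \<bar>V x\<bar> powr (p - 2) * V x * gl x \<partial>M) - (\<integral>x. \<bar>V x\<bar> powr (p - 2) * V x * g j x \<partial>M))
      \<le> (\<integral>x. \<bar>V x\<bar> powr (p - 1) * \<bar>f j x\<bar> \<partial>M)" .
    qed
  qed
qed

lemma lborel_distr_reflect:
  fixes t :: "'a::euclidean_space"
  shows "distr lborel borel (\<lambda>x. t - x) = lborel"
  using lborel_affine[of "-1" t] by (simp add: density_1)

lemma integral_lborel_reflect:
  fixes f :: "'a::euclidean_space \<Rightarrow> real"
  assumes [measurable]: "f \<in> borel_measurable borel"
  shows "(\<integral>x. f (t - x) \<partial>lborel) = (\<integral>x. f x \<partial>lborel)"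
proof -
  have "(\<integral>x. f x \<partial>lborel) = (\<integral>x. f x \<partial>(distr lborel borel (\<lambda>x. t - x)))"
    by (simp only: lborel_distr_reflect)
  also have "\<dots> = (\<integral>x. f (t - x) \<partial>lborel)"
    by (rule integral_distr) auto
  finally show ?thesis ..
qed

lemma convolution_eq_integral_density:
  fixes w \<rho> :: "'a::euclidean_space \<Rightarrow> real"
  assumes [measurable]: "w \<in> borel_measurable borel" "\<rho> \<in> borel_measurable borel" and "\<And>x. 0 \<le> \<rho> x"
  shows "(\<integral>y. w y * \<rho> (x - y) \<partial>lborel) = (\<integral>z. w (x - z) \<partial>(density lborel \<rho>))"
proof -
  have "(\<integral>z. w (x - z) \<partial>(density lborel \<rho>)) = (\<integral>z. \<rho> z * w (x - z) \<partial>lborel)"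
    using assms by (subst integral_density) auto
  also have "\<dots> = (\<integral>y. \<rho> (x - y) * w (x - (x - y)) \<partial>lborel)"
    by (rule integral_lborel_reflect[symmetric]) measurable
  finally show ?thesis by (simp add: mult.commute)
qed

lemma energy_convolution_le:
  fixes w \<rho> :: "'a::euclidean_space \<Rightarrow> real"
  assumes w[measurable]: "w \<in> borel_measurable borel" and \<rho>[measurable]: "\<rho> \<in> borel_measurable borel"
    and \<rho>0: "\<And>x. 0 \<le> \<rho> x" and N: "prob_space (density lborel \<rho>)" and B: "\<And>x. \<bar>w x\<bar> \<le> B" and p: "1 \<le> p"
  shows "energy p r (\<lambda>x. \<integral>y. w y * \<rho> (x - y) \<partial>lborel) \<le> energy p r w"
proof -
  define N where "N = density lborel (\<lambda>x. ennreal (\<rho> x))"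
  interpret N: prob_space N using N by (simp add: N_def)
  have sN [measurable_cong]: "sets N = sets borel" by (simp add: N_def)
  interpret NP: pair_sigma_finite "lborel :: ('a \<times> 'a) measure" N
    by (intro pair_sigma_finite.intro sigma_finite_lborel N.sigma_finite_measure_axioms)
  have shift [measurable]: "(\<lambda>z. w (x - z)) \<in> borel_measurable N" for x by measurable
  have B0: "0 \<le> B" using B[of 0] by linarith
  have wI: "integrable N (\<lambda>z. w (x - z))" for x
    by (rule N.integrable_const_bound[of _ B]) (use B in auto)
  have wdI: "integrable N (\<lambda>z. \<bar>w (x - z) - w (y - z)\<bar> powr p)" for x y
  proof (rule N.integrable_const_bound[of _ "(2 * B) powr p"])
    show "AE z in N. norm (\<bar>w (x - z) - w (y - z)\<bar> powr p) \<le> (2 * B) powr p"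
    proof (intro AE_I2)
      fix z
      have "\<bar>w (x - z) - w (y - z)\<bar> \<le> 2 * B" using B[of "x - z"] B[of "y - z"] by linarith
      then show "norm (\<bar>w (x - z) - w (y - z)\<bar> powr p) \<le> (2 * B) powr p"
        using p by (simp add: powr_mono2)
    qed
  qed measurable
  define c where "c x = (\<integral>z. w (x - z) \<partial>N)" for x
  have ceq: "(\<lambda>x. \<integral>y. w y * \<rho> (x - y) \<partial>lborel) = c"
    unfolding c_def N_def by (intro ext convolution_eq_integral_density w \<rho> \<rho>0)
  define F where "F a z = ennreal (\<bar>w (fst a - z) - w (snd a - z)\<bar> powr p / norm (fst a - snd a) powr r)" for a :: "'a \<times> 'a" and z
  have Fm: "case_prod F \<in> borel_measurable (lborel \<Otimes>\<^sub>M N)"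
  proof -
    have s: "sets (lborel \<Otimes>\<^sub>M N) = sets (borel :: (('a \<times> 'a) \<times> 'a) measure)"
      using sN by (metis borel_prod sets_lborel sets_pair_measure_cong)
    have "(\<lambda>b::('a \<times> 'a) \<times> 'a. fst (fst b) - snd b) \<in> borel_measurable borel"
      "(\<lambda>b::('a \<times> 'a) \<times> 'a. snd (fst b) - snd b) \<in> borel_measurable borel"
      by (intro borel_measurable_continuous_onI continuous_intros)+
    from measurable_compose[OF this(1) w] measurable_compose[OF this(2) w]
    have [measurable]: "(\<lambda>b::('a \<times> 'a) \<times> 'a. w (fst (fst b) - snd b)) \<in> borel_measurable borel"
      "(\<lambda>b::('a \<times> 'a) \<times> 'a. w (snd (fst b) - snd b)) \<in> borel_measurable borel" by auto
    have [measurable]: "(\<lambda>b::('a \<times> 'a) \<times> 'a. norm (fst (fst b) - snd (fst b))) \<in> borel_measurable borel"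
      by (intro borel_measurable_continuous_onI continuous_intros)
    have "(\<lambda>b. F (fst b) (snd b)) \<in> borel_measurable borel"
      unfolding F_def by measurable
    then show ?thesis
      unfolding measurable_cong_sets[OF s refl] by (simp add: case_prod_beta')
  qed
  have "energy p r c \<le> (\<integral>\<^sup>+a. (\<integral>\<^sup>+z. F a z \<partial>N) \<partial>lborel)"
    unfolding energy_def
  proof (rule nn_integral_mono)
    fix a :: "'a \<times> 'a"
    define x y where "x = fst a" and "y = snd a"
    have "\<bar>c x - c y\<bar> = \<bar>\<integral>z. w (x - z) - w (y - z) \<partial>N\<bar>"
      unfolding c_def using wI by simp
    also have "\<dots> \<le> (\<integral>z. \<bar>w (x - z) - w (y - z)\<bar> \<partial>N)" by (rule integral_abs_bound)
    finally have "\<bar>c x - c y\<bar> powr p \<le> (\<integral>z. \<bar>w (x - z) - w (y - z)\<bar> \<partial>N) powr p"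
      using p by (intro powr_mono2) auto
    also have "\<dots> \<le> (\<integral>z. \<bar>w (x - z) - w (y - z)\<bar> powr p \<partial>N)"
      using wI wdI p by (intro N.jensen_powr integrable_abs Bochner_Integration.integrable_diff) auto
    finally have "ennreal (\<bar>c x - c y\<bar> powr p / norm (x - y) powr r) \<le>
      ennreal ((\<integral>z. \<bar>w (x - z) - w (y - z)\<bar> powr p \<partial>N) / norm (x - y) powr r)"
      by (intro ennreal_leI divide_right_mono) auto
    also have "\<dots> = ennreal (\<integral>z. \<bar>w (x - z) - w (y - z)\<bar> powr p / norm (x - y) powr r \<partial>N)"
      by simp
    also have "\<dots> = (\<integral>\<^sup>+z. F a z \<partial>N)"
      unfolding F_def x_def[symmetric] y_def[symmetric]
      by (rule nn_integral_eq_integral[symmetric]) (use wdI in auto)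
    finally show "ennreal (\<bar>c (fst a) - c (snd a)\<bar> powr p / norm (fst a - snd a) powr r) \<le> (\<integral>\<^sup>+z. F a z \<partial>N)"
      by (simp add: x_def y_def)
  qed
  also have "\<dots> = (\<integral>\<^sup>+z. (\<integral>\<^sup>+a. F a z \<partial>lborel) \<partial>N)"
    using NP.Fubini'[OF Fm] by simp
  also have "\<dots> = (\<integral>\<^sup>+z. energy p r w \<partial>N)"
  proof (intro nn_integral_cong)
    fix z
    show "(\<integral>\<^sup>+a. F a z \<partial>lborel) = energy p r w"
      using energy_shift[of w p r "- z"] by (simp add: energy_def F_def)
  qed
  also have "\<dots> = energy p r w" by (simp add: N.emeasure_space_1)
  finally show ?thesis by (simp add: ceq)
qed

lemma AE_density_norm_less:
  fixes \<rho> :: "'a::euclidean_space \<Rightarrow> real"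
  assumes "\<rho> \<in> borel_measurable borel" and d: "\<And>x. d \<le> norm x \<Longrightarrow> \<rho> x = 0"
  shows "AE x in density lborel \<rho>. norm x < d"
proof -
  have "0 < ennreal (\<rho> x) \<longrightarrow> norm x < d" for x
    using d[of x] by (cases "d \<le> norm x") auto
  then show ?thesis using assms(1) by (subst AE_density) auto
qed

lemma nn_integral_convolution_diff_le:
  fixes w \<rho> :: "'a::euclidean_space \<Rightarrow> real"
  assumes w[measurable]: "w \<in> borel_measurable borel" and \<rho>[measurable]: "\<rho> \<in> borel_measurable borel"
    and \<rho>0: "\<And>x. 0 \<le> \<rho> x" and N: "prob_space (density lborel \<rho>)" and B: "\<And>x. \<bar>w x\<bar> \<le> B"
    and d: "\<And>x. d \<le> norm x \<Longrightarrow> \<rho> x = 0"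
    and e: "\<And>h. norm h < d \<Longrightarrow> (\<integral>\<^sup>+x. ennreal \<bar>w (h + x) - w x\<bar> \<partial>lborel) \<le> e"
  shows "(\<integral>\<^sup>+x. ennreal \<bar>(\<integral>y. w y * \<rho> (x - y) \<partial>lborel) - w x\<bar> \<partial>lborel) \<le> e"
proof -
  define N where "N = density lborel (\<lambda>x. ennreal (\<rho> x))"
  interpret N: prob_space N using N by (simp add: N_def)
  have sN [measurable_cong]: "sets N = sets borel" by (simp add: N_def)
  interpret NP: pair_sigma_finite "lborel :: 'a measure" N
    by (intro pair_sigma_finite.intro sigma_finite_lborel N.sigma_finite_measure_axioms)
  have wI: "integrable N (\<lambda>z. w (x - z))" for x
    by (rule N.integrable_const_bound[of _ B]) (use B in auto)
  have "(\<integral>\<^sup>+x. ennreal \<bar>(\<integral>y. w y * \<rho> (x - y) \<partial>lborel) - w x\<bar> \<partial>lborel)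
    \<le> (\<integral>\<^sup>+x. (\<integral>\<^sup>+z. ennreal \<bar>w (x - z) - w x\<bar> \<partial>N) \<partial>lborel)"
  proof (rule nn_integral_mono)
    fix x
    have "\<bar>(\<integral>y. w y * \<rho> (x - y) \<partial>lborel) - w x\<bar> = \<bar>\<integral>z. w (x - z) - w x \<partial>N\<bar>"
      unfolding convolution_eq_integral_density[OF w \<rho> \<rho>0] N_def[symmetric]
      using wI N.prob_space by simp
    also have "\<dots> \<le> (\<integral>z. \<bar>w (x - z) - w x\<bar> \<partial>N)" by (rule integral_abs_bound)
    finally have "ennreal \<bar>(\<integral>y. w y * \<rho> (x - y) \<partial>lborel) - w x\<bar> \<le> ennreal (\<integral>z. \<bar>w (x - z) - w x\<bar> \<partial>N)"
      by (rule ennreal_leI)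
    also have "\<dots> = (\<integral>\<^sup>+z. ennreal \<bar>w (x - z) - w x\<bar> \<partial>N)"
      using wI by (intro nn_integral_eq_integral[symmetric]) auto
    finally show "ennreal \<bar>(\<integral>y. w y * \<rho> (x - y) \<partial>lborel) - w x\<bar> \<le> (\<integral>\<^sup>+z. ennreal \<bar>w (x - z) - w x\<bar> \<partial>N)" .
  qed
  also have "\<dots> = (\<integral>\<^sup>+z. (\<integral>\<^sup>+x. ennreal \<bar>w (x - z) - w x\<bar> \<partial>lborel) \<partial>N)"
    by (rule NP.Fubini'[symmetric]) measurable
  also have "\<dots> \<le> (\<integral>\<^sup>+z. e \<partial>N)"
  proof (rule nn_integral_mono_AE)
    have "AE z in N. norm z < d"
      unfolding N_def by (rule AE_density_norm_less[OF \<rho> d])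
    then show "AE z in N. (\<integral>\<^sup>+x. ennreal \<bar>w (x - z) - w x\<bar> \<partial>lborel) \<le> e"
    proof eventually_elim
      case (elim z)
      then show ?case using e[of "- z"] by simp
    qed
  qed
  also have "\<dots> = e" by (simp add: N.emeasure_space_1)
  finally show ?thesis .
qed

lemma convolution_abs_le:
  fixes w \<rho> :: "'a::euclidean_space \<Rightarrow> real"
  assumes w[measurable]: "w \<in> borel_measurable borel" and \<rho>: "\<rho> \<in> borel_measurable borel"
    and \<rho>0: "\<And>x. 0 \<le> \<rho> x" and N: "prob_space (density lborel \<rho>)" and B: "\<And>x. \<bar>w x\<bar> \<le> B"
  shows "\<bar>\<integral>y. w y * \<rho> (x - y) \<partial>lborel\<bar> \<le> B"
proof -
  interpret N: prob_space "density lborel \<rho>" by fact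
  have "\<bar>\<integral>z. w (x - z) \<partial>(density lborel \<rho>)\<bar> \<le> (\<integral>z. \<bar>w (x - z)\<bar> \<partial>(density lborel \<rho>))"
    by (rule integral_abs_bound)
  also have "\<dots> \<le> (\<integral>z. B \<partial>(density lborel \<rho>))"
    using B order_trans[OF abs_ge_zero B] by (intro integral_mono N.integrable_const_bound[of _ B]) auto
  finally show ?thesis
    using N.prob_space by (simp add: convolution_eq_integral_density[OF w \<rho> \<rho>0])
qed

lemma prob_space_density_lborel:
  fixes \<rho> :: "'a::euclidean_space \<Rightarrow> real"
  assumes "integrable lborel \<rho>" "\<And>x. 0 \<le> \<rho> x" "(\<integral>x. \<rho> x \<partial>lborel) = 1"
  shows "prob_space (density lborel \<rho>)"
proof
  have "emeasure (density lborel \<rho>) (space (density lborel \<rho>)) = (\<integral>\<^sup>+x. ennreal (\<rho> x) \<partial>lborel)"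
    using assms(1) by (subst emeasure_density) auto
  also have "\<dots> = 1"
    using assms by (simp add: nn_integral_eq_integral)
  finally show "emeasure (density lborel \<rho>) (space (density lborel \<rho>)) = 1" .
qed

lemma compact_thickening:
  fixes \<Omega> :: "'a::euclidean_space set"
  assumes "compact C" "open \<Omega>" "C \<subseteq> \<Omega>"
  obtains d where "0 < d" "compact {x + y |x y. x \<in> C \<and> y \<in> cball 0 d}" "{x + y |x y. x \<in> C \<and> y \<in> cball 0 d} \<subseteq> \<Omega>"
proof -
  obtain d where d: "0 < d" "(\<Union>x\<in>C. cball x d) \<subseteq> \<Omega>"
    using compact_subset_open_imp_cball_epsilon_subset[OF assms] by auto
  show ?thesis
  proof
    show "0 < d" by fact
    show "compact {x + y |x y. x \<in> C \<and> y \<in> cball 0 d}"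
      using assms by (intro compact_sums) auto
    have "x + y \<in> cball x d" if "y \<in> cball 0 d" for x y :: 'a using that by (simp add: dist_norm)
    then show "{x + y |x y. x \<in> C \<and> y \<in> cball 0 d} \<subseteq> \<Omega>" using d(2) by blast
  qed
qed

lemma convolution_local:
  fixes w \<rho> :: "'a::euclidean_space \<Rightarrow> real"
  assumes w: "w \<in> borel_measurable borel" and \<rho>[measurable]: "\<rho> \<in> borel_measurable borel"
    and \<rho>0: "\<And>x. 0 \<le> \<rho> x" and N: "prob_space (density lborel \<rho>)"
    and d: "\<And>x. d \<le> norm x \<Longrightarrow> \<rho> x = 0"
    and loc: "\<And>z. norm z \<le> d \<Longrightarrow> w (x - z) = c"
  shows "(\<integral>y. w y * \<rho> (x - y) \<partial>lborel) = c"
proof -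
  interpret N: prob_space "density lborel \<rho>" by fact
  have "(\<integral>z. w (x - z) \<partial>(density lborel \<rho>)) = (\<integral>z. c \<partial>(density lborel \<rho>))"
  proof (rule integral_cong_AE)
    have "AE z in density lborel \<rho>. norm z < d"
      by (rule AE_density_norm_less[OF \<rho> d])
    then show "AE z in density lborel \<rho>. w (x - z) = c"
      by eventually_elim (rule loc, simp)
  qed (use w in measurable)
  then show ?thesis
    using N.prob_space by (simp add: convolution_eq_integral_density[OF w \<rho> \<rho>0])
qed

lemma test_functionI:
  assumes "smooth \<psi>" "compact C" "C \<subseteq> \<Omega>" "\<And>x. x \<notin> C \<Longrightarrow> \<psi> x = 0"
  shows "\<psi> \<in> test_functions \<Omega>"
proof -
  have c: "closure {x. \<psi> x \<noteq> 0} \<subseteq> C"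
    using assms by (intro closure_minimal) (auto simp: compact_imp_closed)
  then have "compact (closure {x. \<psi> x \<noteq> 0})"
    using compact_Int_closed[OF assms(2) closed_closure[of "{x. \<psi> x \<noteq> 0}"]] by (simp only: Int_absorb1)
  then show ?thesis using c assms by (auto simp only: test_functions_def)
qed

lemma mollified_sequence:
  fixes w :: "real ^ 'n \<Rightarrow> real"
  assumes w[measurable]: "w \<in> borel_measurable borel" and B: "\<And>x. \<bar>w x\<bar> \<le> B"
    and C: "compact C" "open \<Omega>" "C \<subseteq> \<Omega>" and w0: "\<And>x. x \<notin> C \<Longrightarrow> w x = 0" and p: "1 \<le> p"
  obtains \<psi> C' where "compact C'" "C' \<subseteq> \<Omega>" "\<And>j. \<psi> j \<in> test_functions \<Omega>" "\<And>j x. x \<notin> C' \<Longrightarrow> \<psi> j x = 0"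
    "\<And>j x. \<bar>\<psi> j x\<bar> \<le> B" "\<And>j. energy p r (\<psi> j) \<le> energy p r w" "\<And>j. continuous_on UNIV (\<psi> j)"
    "AE x in lborel. (\<lambda>j. \<psi> j x) \<longlonglongrightarrow> w x"
proof -
  obtain d where d: "0 < d" "compact {x + y |x y. x \<in> C \<and> y \<in> cball 0 d}" "{x + y |x y. x \<in> C \<and> y \<in> cball 0 d} \<subseteq> \<Omega>"
    using compact_thickening[OF C] by blast
  define C' where "C' = {x + y |x y. x \<in> C \<and> y \<in> cball 0 d}"
  obtain R where R: "\<And>x. x \<in> C \<Longrightarrow> norm x \<le> R"
    using compact_imp_bounded[OF C(1)] unfolding bounded_iff by blast
  have Rw: "R < norm x \<Longrightarrow> w x = 0" for x using R[of x] w0[of x] by force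
  have wI: "integrable lborel w"
  proof -
    have "integrable lborel (\<lambda>x::real^'n. indicator C x * B)"
      using emeasure_compact_finite[OF C(1)] compact_imp_closed[OF C(1)]
      by (intro integrable_mult_left integrable_real_indicator) auto
    then show ?thesis
      by (rule Bochner_Integration.integrable_bound)
         (use B w0 order_trans[OF B abs_ge_self] in \<open>auto simp: indicator_def\<close>)
  qed
  define good where "good j \<rho> d' \<longleftrightarrow> 0 < d' \<and> d' \<le> d \<and> \<rho> \<in> borel_measurable borel \<and> (\<forall>x. 0 \<le> \<rho> x) \<and>
    (\<forall>x. d' \<le> norm x \<longrightarrow> \<rho> x = 0) \<and> integrable lborel \<rho> \<and> (\<integral>x. \<rho> x \<partial>lborel) = 1 \<and>
    smooth (\<lambda>x. \<integral>y. w y * \<rho> (x - y) \<partial>lborel) \<and>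
    (\<forall>h. norm h < d' \<longrightarrow> (\<integral>\<^sup>+x. ennreal \<bar>w (h + x) - w x\<bar> \<partial>lborel) \<le> ennreal (1 / Suc j))"
    for j :: nat and \<rho> :: "real ^ 'n \<Rightarrow> real" and d' :: real
  have "\<exists>\<rho> d'. good j \<rho> d'" for j :: nat
  proof -
    obtain d1 where d1: "0 < d1" "\<And>h. norm h < d1 \<Longrightarrow> (\<integral>\<^sup>+x. ennreal \<bar>w (h + x) - w x\<bar> \<partial>lborel) \<le> ennreal (1 / Suc j)"
      using nn_integral_translation_continuous[OF w B Rw, where e = "1 / Suc j"] by auto
    have "0 < min d d1" using d d1 by simp
    then obtain \<rho> :: "real^'n \<Rightarrow> real" where "\<rho> \<in> borel_measurable borel" "\<And>x. 0 \<le> \<rho> x"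
      "\<And>x. min d d1 \<le> norm x \<Longrightarrow> \<rho> x = 0" "integrable lborel \<rho>" "(\<integral>x. \<rho> x \<partial>lborel) = 1"
      "\<And>w. integrable lborel w \<Longrightarrow> smooth (\<lambda>x. \<integral>y. w y * \<rho> (x - y) \<partial>lborel)"
      by (rule mollifier_exists) blast
    then have "good j \<rho> (min d d1)" using d d1 wI by (auto simp only: good_def min_less_iff_conj)
    then show ?thesis by blast
  qed
  then obtain \<rho> d' where good: "\<And>j. good j (\<rho> j) (d' j)" by metis
  have d': "\<And>j. 0 < d' j" "\<And>j. d' j \<le> d" and \<rho>m[measurable]: "\<And>j. \<rho> j \<in> borel_measurable borel"
    and \<rho>0: "\<And>j x. 0 \<le> \<rho> j x" and \<rho>s: "\<And>j x. d' j \<le> norm x \<Longrightarrow> \<rho> j x = 0"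
    and \<rho>I: "\<And>j. integrable lborel (\<rho> j)" "\<And>j. (\<integral>x. \<rho> j x \<partial>lborel) = 1" and sm: "\<And>j. smooth (\<lambda>x. \<integral>y. w y * \<rho> j (x - y) \<partial>lborel)"
    and L1: "\<And>j h. norm h < d' j \<Longrightarrow> (\<integral>\<^sup>+x. ennreal \<bar>w (h + x) - w x\<bar> \<partial>lborel) \<le> ennreal (1 / Suc j)"
    using good unfolding good_def by blast+
  note N = prob_space_density_lborel[OF \<rho>I(1) \<rho>0 \<rho>I(2)]
  define \<psi> where "\<psi> j x = (\<integral>y. w y * \<rho> j (x - y) \<partial>lborel)" for j x
  have sm\<psi>: "smooth (\<psi> j)" for j using sm[of j] by (simp add: \<psi>_def[abs_def])
  then have cont: "continuous_on UNIV (\<psi> j)" for j unfolding smooth_def using Ck.simps(1) by blast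
  then have [measurable]: "\<psi> j \<in> borel_measurable borel" for j by (rule borel_measurable_continuous_onI)
  have supp: "\<psi> j x = 0" if "x \<notin> C'" for j x
    unfolding \<psi>_def
  proof (rule convolution_local[OF w \<rho>m \<rho>0 N \<rho>s])
    fix z :: "real^'n" assume z: "norm z \<le> d' j"
    show "w (x - z) = 0"
    proof (rule w0, rule notI)
      assume "x - z \<in> C"
      then have "(x - z) + z \<in> C'" unfolding C'_def using z d'(2)[of j] by (intro CollectI exI conjI) auto
      then show False using that by simp
    qed
  qed
  have test: "\<psi> j \<in> test_functions \<Omega>" for j
    using sm\<psi> d(2,3) supp unfolding C'_def[symmetric] by (rule test_functionI)
  have nn: "(\<integral>\<^sup>+x. ennreal \<bar>\<psi> j x - w x\<bar> \<partial>lborel) \<le> ennreal (1 / Suc j)" for j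
    unfolding \<psi>_def by (rule nn_integral_convolution_diff_le[OF w \<rho>m \<rho>0 N B \<rho>s L1])
  have Id: "integrable lborel (\<lambda>x. \<psi> j x - w x)" for j
    using nn[of j] by (intro integrableI_bounded) (auto intro: le_less_trans)
  have "(\<lambda>j. \<integral>x. norm (\<psi> j x - w x) \<partial>lborel) \<longlonglongrightarrow> 0"
  proof (rule tendsto_sandwich[OF _ _ tendsto_const LIMSEQ_inverse_real_of_nat])
    show "\<forall>\<^sub>F j in sequentially. 0 \<le> (\<integral>x. norm (\<psi> j x - w x) \<partial>lborel)" by simp
    show "\<forall>\<^sub>F j in sequentially. (\<integral>x. norm (\<psi> j x - w x) \<partial>lborel) \<le> inverse (real (Suc j))"
    proof (intro always_eventually allI)
      fix j
      have "ennreal (\<integral>x. norm (\<psi> j x - w x) \<partial>lborel) \<le> ennreal (1 / Suc j)"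
        using nn[of j] nn_integral_eq_integral[OF integrable_norm[OF Id[of j]]] by simp
      then show "(\<integral>x. norm (\<psi> j x - w x) \<partial>lborel) \<le> inverse (real (Suc j))"
        by (subst (asm) ennreal_le_iff) (auto simp: divide_inverse)
    qed
  qed
  from tendsto_L1_AE_subseq[OF Id this] obtain s where s: "strict_mono s" "AE x in lborel. (\<lambda>j. \<psi> (s j) x - w x) \<longlonglongrightarrow> 0"
    by blast
  show ?thesis
  proof (rule that[of C' "\<lambda>j. \<psi> (s j)"])
    show "compact C'" "C' \<subseteq> \<Omega>" using d by (auto simp: C'_def)
    show "\<psi> (s j) \<in> test_functions \<Omega>" for j by (rule test)
    show "\<psi> (s j) x = 0" if "x \<notin> C'" for j x using that by (rule supp)
    show "\<bar>\<psi> (s j) x\<bar> \<le> B" for j x unfolding \<psi>_def by (rule convolution_abs_le[OF w \<rho>m \<rho>0 N B])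
    show "energy p r (\<psi> (s j)) \<le> energy p r w" for j
      unfolding \<psi>_def by (rule energy_convolution_le[OF w \<rho>m \<rho>0 N B p])
    show "continuous_on UNIV (\<psi> (s j))" for j by (rule cont)
    show "AE x in lborel. (\<lambda>j. \<psi> (s j) x) \<longlonglongrightarrow> w x"
      using s(2) by eventually_elim (simp add: LIM_zero_iff)
  qed
qed

lemma cutoff_exists:
  fixes C \<Omega> :: "(real ^ 'n) set"
  assumes C: "compact C" "open \<Omega>" "C \<subseteq> \<Omega>"
  obtains \<psi> where "\<psi> \<in> test_functions \<Omega>" "\<And>x. x \<in> C \<Longrightarrow> \<psi> x = 1"
proof -
  obtain d where d: "0 < d" "compact {x + y |x y. x \<in> C \<and> y \<in> cball 0 d}" "{x + y |x y. x \<in> C \<and> y \<in> cball 0 d} \<subseteq> \<Omega>"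
    using compact_thickening[OF C] by blast
  have d2: "0 < d / 2" using d by simp
  define C1 where "C1 = {x + y |x y. x \<in> C \<and> y \<in> cball 0 (d / 2)}"
  define C' where "C' = {x + y |x y. x \<in> C \<and> y \<in> cball 0 d}"
  have C1: "compact C1" unfolding C1_def by (intro compact_sums C) auto
  define w :: "real^'n \<Rightarrow> real" where "w = indicator C1"
  have w[measurable]: "w \<in> borel_measurable borel" unfolding w_def using compact_imp_closed[OF C1] by simp
  have wI: "integrable lborel w"
    unfolding w_def using emeasure_compact_finite[OF C1] compact_imp_closed[OF C1]
    by (intro integrable_real_indicator) auto
  obtain \<rho> :: "real^'n \<Rightarrow> real" where \<rho>: "\<rho> \<in> borel_measurable borel" "\<And>x. 0 \<le> \<rho> x"
      "\<And>x. d / 2 \<le> norm x \<Longrightarrow> \<rho> x = 0"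
      "integrable lborel \<rho>" "(\<integral>x. \<rho> x \<partial>lborel) = 1" "\<And>w. integrable lborel w \<Longrightarrow> smooth (\<lambda>x. \<integral>y. w y * \<rho> (x - y) \<partial>lborel)"
    by (rule mollifier_exists[OF d2]) blast
  note N = prob_space_density_lborel[OF \<rho>(4,2,5)]
  define \<psi> where "\<psi> x = (\<integral>y. w y * \<rho> (x - y) \<partial>lborel)" for x
  have supp: "\<psi> x = 0" if "x \<notin> C'" for x
    unfolding \<psi>_def
  proof (rule convolution_local[OF w \<rho>(1,2) N \<rho>(3)])
    fix z :: "real^'n" assume z: "norm z \<le> d / 2"
    have "x - z \<notin> C1"
    proof
      assume "x - z \<in> C1"
      then obtain a b where ab: "x - z = a + b" "a \<in> C" "norm b \<le> d / 2" by (auto simp: C1_def)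
      have "norm (b + z) \<le> d" using norm_triangle_ineq[of b z] ab z by linarith
      moreover have "x = a + (b + z)" using ab(1) by (simp add: algebra_simps)
      ultimately have "x \<in> C'" unfolding C'_def using ab by (intro CollectI exI conjI) auto
      then show False using that by simp
    qed
    then show "w (x - z) = 0" by (simp add: w_def)
  qed
  show ?thesis
  proof
    show "\<psi> \<in> test_functions \<Omega>"
      using \<rho>(6)[OF wI, folded \<psi>_def] d(2,3) supp unfolding C'_def[symmetric] by (rule test_functionI)
    fix x assume "x \<in> C"
    show "\<psi> x = 1"
      unfolding \<psi>_def
    proof (rule convolution_local[OF w \<rho>(1,2) N \<rho>(3)])
      fix z :: "real^'n" assume z: "norm z \<le> d / 2"
      have "x + (- z) \<in> C1" unfolding C1_def using z \<open>x \<in> C\<close> by (intro CollectI exI[of _ x] exI[of _ "- z"] conjI) auto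
      then show "w (x - z) = 1" by (simp add: w_def)
    qed
  qed
qed

subsection \<open>Admissible test functions\<close>

lemma AE_lborel_pair:
  assumes "AE x in (lborel :: 'a::euclidean_space measure). P x"
  shows "AE z in (lborel :: ('a \<times> 'a) measure). P (fst z) \<and> P (snd z)"
proof -
  obtain N where N: "N \<in> null_sets (lborel :: 'a measure)" "\<And>x. x \<in> space lborel - N \<Longrightarrow> P x"
    using AE_E3[OF assms] by blast
  have "emeasure (lborel \<Otimes>\<^sub>M lborel) (N \<times> (UNIV :: 'a set)) = 0"
    "emeasure (lborel \<Otimes>\<^sub>M lborel) ((UNIV :: 'a set) \<times> N) = 0"
    using N(1) by (auto simp: lborel.emeasure_pair_measure_Times null_sets_def)
  then have "N \<times> (UNIV :: 'a set) \<in> null_sets lborel" "(UNIV :: 'a set) \<times> N \<in> null_sets lborel"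
    using N(1) by (auto simp: lborel_prod[symmetric] null_sets_def)
  then have "AE z in (lborel :: ('a \<times> 'a) measure). z \<notin> N \<times> UNIV \<and> z \<notin> UNIV \<times> N"
    by (intro AE_conjI AE_not_in)
  then show ?thesis
    by eventually_elim (use N(2) in \<open>auto simp: mem_Times_iff\<close>)
qed

definition plap_form :: "real \<Rightarrow> real \<Rightarrow> ('a::euclidean_space \<Rightarrow> real) \<Rightarrow> ('a \<Rightarrow> real) \<Rightarrow> real" where
  "plap_form p r v \<psi> = (\<integral>z. \<bar>v (fst z) - v (snd z)\<bar> powr (p - 2) * (v (fst z) - v (snd z)) *
     (\<psi> (fst z) - \<psi> (snd z)) / norm (fst z - snd z) powr r \<partial>lborel)"

lemma plap_form_limit:
  fixes v gl :: "'a::euclidean_space \<Rightarrow> real"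
  assumes p: "1 < p" and [measurable]: "v \<in> borel_measurable borel" "\<And>j. g j \<in> borel_measurable borel" "gl \<in> borel_measurable borel"
    and v: "energy p r v < \<infinity>" and g: "\<And>j. energy p r (g j) \<le> B" "B < \<infinity>"
    and lim: "AE x in lborel. (\<lambda>j. g j x) \<longlonglongrightarrow> gl x"
  shows "(\<lambda>j. plap_form p r v (g j)) \<longlonglongrightarrow> plap_form p r v gl"
proof -
  define k where "k z = 1 / norm (fst z - snd z) powr r" for z :: "'a \<times> 'a"
  have [measurable]: "k \<in> borel_measurable borel" unfolding k_def by measurable
  define M where "M = density (lborel :: ('a \<times> 'a) measure) k"
  have sM [measurable_cong]: "sets M = sets borel" by (simp add: M_def)
  have E: "(\<integral>\<^sup>+z. ennreal (\<bar>w (fst z) - w (snd z)\<bar> powr p) \<partial>M) = energy p r w"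
    if [measurable]: "w \<in> borel_measurable borel" for w
    unfolding M_def energy_def by (subst nn_integral_density) (auto simp: k_def ennreal_mult[symmetric])
  have F: "(\<integral>z. \<bar>v (fst z) - v (snd z)\<bar> powr (p - 2) * (v (fst z) - v (snd z)) * (w (fst z) - w (snd z)) \<partial>M) = plap_form p r v w"
    if [measurable]: "w \<in> borel_measurable borel" for w
    unfolding M_def plap_form_def by (subst integral_density) (auto simp: k_def)
  have "AE z in M. (\<lambda>j. g j (fst z) - g j (snd z)) \<longlonglongrightarrow> gl (fst z) - gl (snd z)"
  proof -
    have "AE z in lborel. (\<lambda>j. g j (fst z) - g j (snd z)) \<longlonglongrightarrow> gl (fst z) - gl (snd z)"
      using AE_lborel_pair[OF lim] by eventually_elim (auto intro: tendsto_diff)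
    then show ?thesis unfolding M_def by (subst AE_density) auto
  qed
  from weak_limit_powr[OF p _ _ _ _ _ g(2) this, of "\<lambda>z. v (fst z) - v (snd z)"]
  show ?thesis using v g(1) by (simp add: E F)
qed

locale tested_equation =
  fixes p s :: real and \<Omega> :: "(real ^ 'n) set" and v f :: "real ^ 'n \<Rightarrow> real" and r :: real
  assumes p: "1 < p" and s: "0 < s" "s < 1" and r: "r = real CARD('n) + s * p"
    and open_\<Omega>: "open \<Omega>" and v_measurable [measurable]: "v \<in> borel_measurable borel"
    and v_energy: "energy p r v < \<infinity>"
    and f_measurable [measurable]: "f \<in> borel_measurable borel" and f_nonneg: "\<And>x. 0 \<le> f x"
    and test_integrable: "\<And>\<psi>. \<psi> \<in> test_functions \<Omega> \<Longrightarrow> integrable lborel (\<lambda>x. f x * \<psi> x)"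
    and test_eq: "\<And>\<psi>. \<psi> \<in> test_functions \<Omega> \<Longrightarrow> plap_form p r v \<psi> = (\<integral>x. f x * \<psi> x \<partial>lborel)"
begin

lemma f_integrable_compact:
  assumes "compact C" "C \<subseteq> \<Omega>"
  shows "integrable lborel (\<lambda>x. f x * indicator C x)"
proof -
  obtain \<psi> where \<psi>: "\<psi> \<in> test_functions \<Omega>" "\<And>x. x \<in> C \<Longrightarrow> \<psi> x = 1"
    using cutoff_exists[OF assms(1) open_\<Omega> assms(2)] by blast
  have "integrable lborel (\<lambda>x. indicator C x *\<^sub>R (f x * \<psi> x))"
    using assms(1) by (intro integrable_mult_indicator test_integrable \<psi>) (simp add: compact_imp_closed)
  moreover have "indicator C x *\<^sub>R (f x * \<psi> x) = f x * indicator C x" for x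
    using \<psi>(2)[of x] by (simp add: indicator_def)
  ultimately show ?thesis by (simp only:)
qed

lemma test_compact:
  assumes [measurable]: "w \<in> borel_measurable borel" and B: "\<And>x. \<bar>w x\<bar> \<le> B"
    and C: "compact C" "C \<subseteq> \<Omega>" and w0: "\<And>x. x \<notin> C \<Longrightarrow> w x = 0" and w: "energy p r w < \<infinity>"
  shows "integrable lborel (\<lambda>x. f x * w x)" and "plap_form p r v w = (\<integral>x. f x * w x \<partial>lborel)"
proof -
  show "integrable lborel (\<lambda>x. f x * w x)"
  proof (rule Bochner_Integration.integrable_bound)
    show "integrable lborel (\<lambda>x. f x * indicator C x * B)"
      by (intro integrable_mult_left f_integrable_compact C)
    show "AE x in lborel. norm (f x * w x) \<le> norm (f x * indicator C x * B)"
    proof (intro AE_I2)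
      fix x
      show "norm (f x * w x) \<le> norm (f x * indicator C x * B)"
        using w0[of x] B[of x] by (cases "x \<in> C") (auto simp: abs_mult intro!: mult_left_mono)
    qed
  qed measurable
  have p1: "1 \<le> p" using p by simp
  obtain C' \<psi> where C': "compact C'" "C' \<subseteq> \<Omega>" and \<psi>: "\<And>j. \<psi> j \<in> test_functions \<Omega>"
    and \<psi>0: "\<And>j x. x \<notin> C' \<Longrightarrow> \<psi> j x = 0" and \<psi>B: "\<And>j x. \<bar>\<psi> j x\<bar> \<le> B"
    and \<psi>e: "\<And>j. energy p r (\<psi> j) \<le> energy p r w" and cont: "\<And>j. continuous_on UNIV (\<psi> j)"
    and lim: "AE x in lborel. (\<lambda>j. \<psi> j x) \<longlonglongrightarrow> w x"
    by (rule mollified_sequence[OF assms(1) B C(1) open_\<Omega> C(2) w0 p1, where r = r], assumption) (rule that)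
  have [measurable]: "\<psi> j \<in> borel_measurable borel" for j
    using cont by (rule borel_measurable_continuous_onI)
  have "(\<lambda>j. \<integral>x. f x * \<psi> j x \<partial>lborel) \<longlonglongrightarrow> (\<integral>x. f x * w x \<partial>lborel)"
  proof (rule integral_dominated_convergence)
    show "integrable lborel (\<lambda>x. f x * indicator C' x * B)"
      by (intro integrable_mult_left f_integrable_compact C')
    show "AE x in lborel. (\<lambda>j. f x * \<psi> j x) \<longlonglongrightarrow> f x * w x"
      using lim by eventually_elim (rule tendsto_mult_left)
    show "AE x in lborel. norm (f x * \<psi> j x) \<le> f x * indicator C' x * B" for j
    proof (intro AE_I2)
      fix x
      show "norm (f x * \<psi> j x) \<le> f x * indicator C' x * B"
        using \<psi>0[of x j] \<psi>B[of j x] f_nonneg[of x] by (cases "x \<in> C'") (auto simp: abs_mult intro!: mult_left_mono)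
    qed
  qed measurable
  moreover have "(\<lambda>j. \<integral>x. f x * \<psi> j x \<partial>lborel) \<longlonglongrightarrow> plap_form p r v w"
    unfolding test_eq[OF \<psi>, symmetric]
    by (rule plap_form_limit[OF p _ _ _ v_energy \<psi>e w lim]) measurable
  ultimately show "plap_form p r v w = (\<integral>x. f x * w x \<partial>lborel)"
    using LIMSEQ_unique by blast
qed

end

lemma min_diff_le:
  fixes a b c d :: real
  shows "\<bar>min a b - min c d\<bar> \<le> \<bar>a - c\<bar> \<or> \<bar>min a b - min c d\<bar> \<le> \<bar>b - d\<bar>"
  by linarith

lemma max_diff_le:
  fixes a b c :: real
  shows "\<bar>max a b - max a c\<bar> \<le> \<bar>b - c\<bar>"
  by linarith

lemma Max_diff_le:
  fixes a b :: "'i \<Rightarrow> real"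
  assumes "finite I" "I \<noteq> {}"
  shows "\<exists>i\<in>I. \<bar>Max (a ` I) - Max (b ` I)\<bar> \<le> \<bar>a i - b i\<bar>"
proof -
  have *: "\<exists>i\<in>I. \<bar>Max (a ` I) - Max (b ` I)\<bar> \<le> \<bar>a i - b i\<bar>" if "Max (b ` I) \<le> Max (a ` I)" for a b :: "'i \<Rightarrow> real"
  proof -
    have "Max (a ` I) \<in> a ` I" using assms by (intro Max_in) auto
    then obtain i where i: "i \<in> I" "Max (a ` I) = a i" by auto
    have "b i \<le> Max (b ` I)" using assms i by (intro Max_ge) auto
    then show ?thesis using i that by (intro bexI[of _ i]) auto
  qed
  show ?thesis
    using *[of b a] *[of a b] by (cases "Max (b ` I) \<le> Max (a ` I)") (auto simp: abs_minus_commute)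
qed

text \<open>The only consequence of the regularity of the boundary that is used.\<close>

definition inward_directions :: "(real ^ 'n) set \<Rightarrow> bool" where
  "inward_directions \<Omega> \<longleftrightarrow> (\<forall>x\<in>closure \<Omega>. \<exists>R>0. \<exists>e. \<exists>t0>0. \<forall>z\<in>closure \<Omega> \<inter> cball x R. \<forall>t. 0 < t \<and> t \<le> t0 \<longrightarrow> z + t *\<^sub>R e \<in> \<Omega>)"

context tested_equation
begin

text \<open>\<open>\<phi>\<close> is cut into finitely many pieces by cones \<open>\<zeta> i\<close>, using \<open>min\<close> and \<open>Max\<close> rather than a partition of
  unity, so that energies simply add up. Each piece is translated into \<open>\<Omega>\<close>, and the minimum with \<open>\<phi>\<close>
  keeps the test function below \<open>\<phi>\<close>, where the possibly singular \<open>f \<phi>\<close> is integrable.\<close>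

lemma test_le:
  assumes bd: "bounded \<Omega>" "\<Omega> \<noteq> {}" "inward_directions \<Omega>"
    and \<phi>[measurable]: "\<phi> \<in> borel_measurable borel" and \<phi>B: "\<And>x. 0 \<le> \<phi> x" "\<And>x. \<phi> x \<le> M" and M: "0 < M"
    and \<phi>0: "\<And>x. x \<notin> \<Omega> \<Longrightarrow> \<phi> x = 0" and \<phi>e: "energy p r \<phi> < \<infinity>"
    and \<phi>I: "integrable lborel (\<lambda>x. f x * \<phi> x)"
  shows "plap_form p r v \<phi> \<le> (\<integral>x. f x * \<phi> x \<partial>lborel)"
proof -
  define S where "S = closure \<Omega>"
  have S: "compact S" using bd(1) by (simp add: S_def compact_closure)
  define good where "good x R e t0 \<longleftrightarrow> 0 < R \<and> 0 < t0 \<and> (\<forall>z\<in>S \<inter> cball x R. \<forall>t. 0 < t \<and> t \<le> t0 \<longrightarrow> z + t *\<^sub>R e \<in> \<Omega>)"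
    for x e :: "real ^ 'n" and R t0 :: real
  have "\<exists>R e t0. good x R e t0" if "x \<in> S" for x
    using bd(3) that unfolding inward_directions_def S_def good_def by blast
  then obtain R e t0 where good: "\<And>x. x \<in> S \<Longrightarrow> good x (R x) (e x) (t0 x)"
    by metis
  have R: "\<And>x. x \<in> S \<Longrightarrow> 0 < R x" and t0: "\<And>x. x \<in> S \<Longrightarrow> 0 < t0 x"
    and inw: "\<And>x z t. x \<in> S \<Longrightarrow> z \<in> S \<Longrightarrow> z \<in> cball x (R x) \<Longrightarrow> 0 < t \<Longrightarrow> t \<le> t0 x \<Longrightarrow> z + t *\<^sub>R e x \<in> \<Omega>"
    using good unfolding good_def by blast+
  have "S \<subseteq> (\<Union>x\<in>S. ball x (R x / 2))" using R by force
  then obtain I where I: "I \<subseteq> S" "finite I" "S \<subseteq> (\<Union>x\<in>I. ball x (R x / 2))"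
    by (rule compactE_image[OF S _ , rotated]) auto
  have Ine: "I \<noteq> {}" using I(3) bd(2) closure_subset[of \<Omega>] by (auto simp: S_def)
  define \<zeta> where "\<zeta> i x = max 0 (2 * M / R i * (R i - norm (x - i)))" for i x :: "real ^ 'n"
  have \<zeta>m [measurable]: "\<zeta> i \<in> borel_measurable borel" for i unfolding \<zeta>_def by measurable
  have \<zeta>0: "0 \<le> \<zeta> i x" for i x by (simp add: \<zeta>_def)
  have \<zeta>s: "\<zeta> i x = 0" if "i \<in> I" "x \<notin> cball i (R i)" for i x
  proof -
    have "R i - norm (x - i) \<le> 0" using that by (simp add: dist_norm norm_minus_commute)
    then show ?thesis using R[of i] I(1) that(1) M unfolding \<zeta>_def
      by (intro max_absorb1 mult_nonneg_nonpos) auto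
  qed
  have \<zeta>e: "energy p r (\<zeta> i) < \<infinity>" if i: "i \<in> I" for i
  proof -
    have Ri: "0 < R i" using R I(1) i by auto
    have c: "0 \<le> 2 * M / R i" using Ri M by simp
    have "energy p (real DIM(real ^ 'n) + s * p) (\<zeta> i) < \<infinity>"
    proof (rule energy_lipschitz_finite[where L = "2 * M / R i" and B = "2 * M" and S = "cball i (R i)"])
      fix x y
      have "\<bar>\<zeta> i x - \<zeta> i y\<bar> \<le> \<bar>2 * M / R i * (R i - norm (x - i)) - 2 * M / R i * (R i - norm (y - i))\<bar>"
        unfolding \<zeta>_def by (rule max_diff_le)
      also have "\<dots> = 2 * M / R i * \<bar>norm (x - i) - norm (y - i)\<bar>"
      proof -
        have "2 * M / R i * (R i - norm (x - i)) - 2 * M / R i * (R i - norm (y - i)) = 2 * M / R i * (norm (y - i) - norm (x - i))"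
          by (simp only: right_diff_distrib[symmetric]) simp
        then show ?thesis
          by (simp only: abs_mult abs_of_nonneg[OF c] abs_minus_commute[of "norm (y - i)"])
      qed
      also have "\<dots> \<le> 2 * M / R i * norm (x - y)"
        using norm_triangle_ineq3[of "x - i" "y - i"] c by (intro mult_left_mono) auto
      finally show "\<bar>\<zeta> i x - \<zeta> i y\<bar> \<le> 2 * M / R i * norm (x - y)" .
      have "2 * M / R i * (R i - norm (x - i)) \<le> 2 * M / R i * R i"
        by (intro mult_left_mono c) simp
      then show "\<bar>\<zeta> i x\<bar> \<le> 2 * M" using Ri M unfolding \<zeta>_def by auto
    qed (use p s \<zeta>s[OF i] in auto)
    then show ?thesis by (simp add: r)
  qed
  define w where "w i x = min (\<phi> x) (\<zeta> i x)" for i x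
  have wm [measurable]: "w i \<in> borel_measurable borel" for i unfolding w_def by measurable
  have w0: "0 \<le> w i x" "w i x \<le> M" for i x using \<phi>B[of x] \<zeta>0[of i x] by (auto simp: w_def)
  have we: "energy p r (w i) < \<infinity>" if "i \<in> I" for i
  proof -
    have "energy p r (w i) \<le> (\<Sum>b\<in>(UNIV :: bool set). energy p r (if b then \<phi> else \<zeta> i))"
    proof (rule energy_le_sum)
      fix x y
      have "\<bar>w i x - w i y\<bar> \<le> \<bar>\<phi> x - \<phi> y\<bar> \<or> \<bar>w i x - w i y\<bar> \<le> \<bar>\<zeta> i x - \<zeta> i y\<bar>"
        unfolding w_def by (rule min_diff_le)
      then show "\<exists>b\<in>UNIV. \<bar>w i x - w i y\<bar> \<le> \<bar>(if b then \<phi> else \<zeta> i) x - (if b then \<phi> else \<zeta> i) y\<bar>"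
        by (metis UNIV_I)
    qed (use p in auto)
    also have "\<dots> < \<infinity>" using \<phi>e \<zeta>e[OF that] by (simp add: UNIV_bool)
    finally show ?thesis .
  qed
  have wsupp: "x \<in> S \<inter> cball i (R i)" if "w i x \<noteq> 0" "i \<in> I" for i x
    using that \<phi>0[of x] \<zeta>s[of i x] \<zeta>0[of i x] \<phi>B(1)[of x] closure_subset[of \<Omega>]
    unfolding w_def S_def by (auto split: if_splits simp: min_def)
  obtain R0 where R0: "\<And>x. x \<in> S \<Longrightarrow> norm x \<le> R0"
    using compact_imp_bounded[OF S] unfolding bounded_iff by blast
  define near where "near k t \<longleftrightarrow> 0 < t \<and> (\<forall>i\<in>I. t \<le> t0 i \<and>
      (\<integral>\<^sup>+x. ennreal \<bar>w i (- (t *\<^sub>R e i) + x) - w i x\<bar> \<partial>lborel) \<le> ennreal (1 / Suc k))" for k :: nat and t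
  have "\<exists>t. near k t" for k
  proof -
    have "\<forall>\<^sub>F t in at_right 0. \<forall>i\<in>I. t \<le> t0 i \<and> (\<integral>\<^sup>+x. ennreal \<bar>w i (- (t *\<^sub>R e i) + x) - w i x\<bar> \<partial>lborel) \<le> ennreal (1 / Suc k)"
    proof (rule eventually_ball_finite[OF I(2)], intro ballI eventually_conj)
      fix i assume i: "i \<in> I"
      then have "0 < t0 i" using t0 I(1) by auto
      then show "\<forall>\<^sub>F t in at_right 0. t \<le> t0 i"
        by (intro eventually_at_rightI[of 0 "t0 i"]) auto
      have "\<exists>d>0. \<forall>h. norm h < d \<longrightarrow> (\<integral>\<^sup>+x. ennreal \<bar>w i (h + x) - w i x\<bar> \<partial>lborel) \<le> ennreal (1 / Suc k)"
      proof (rule nn_integral_translation_continuous[of _ M R0])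
        show "\<bar>w i x\<bar> \<le> M" for x using w0[of i x] by simp
        show "w i x = 0" if "R0 < norm x" for x
          using wsupp[of i x] i R0[of x] that by auto
      qed auto
      then obtain d where d: "0 < d" "\<And>h. norm h < d \<Longrightarrow> (\<integral>\<^sup>+x. ennreal \<bar>w i (h + x) - w i x\<bar> \<partial>lborel) \<le> ennreal (1 / Suc k)"
        by blast
      show "\<forall>\<^sub>F t in at_right 0. (\<integral>\<^sup>+x. ennreal \<bar>w i (- (t *\<^sub>R e i) + x) - w i x\<bar> \<partial>lborel) \<le> ennreal (1 / Suc k)"
      proof (rule eventually_at_rightI[of 0 "d / (norm (e i) + 1)"])
        have pos: "0 < norm (e i) + 1" using norm_ge_zero[of "e i"] by linarith
        then show "0 < d / (norm (e i) + 1)" using d(1) by simp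
        fix t assume t: "t \<in> {0<..<d / (norm (e i) + 1)}"
        have "norm (- (t *\<^sub>R e i)) \<le> t * (norm (e i) + 1)" using t by simp
        also have "\<dots> < d" using t pos by (simp add: field_simps)
        finally show "(\<integral>\<^sup>+x. ennreal \<bar>w i (- (t *\<^sub>R e i) + x) - w i x\<bar> \<partial>lborel) \<le> ennreal (1 / Suc k)" by (rule d(2))
      qed
    qed
    moreover have "\<forall>\<^sub>F t in at_right (0::real). 0 < t" by (rule eventually_at_right_less)
    ultimately have "\<forall>\<^sub>F t in at_right 0. 0 < t \<and> (\<forall>i\<in>I. t \<le> t0 i \<and> (\<integral>\<^sup>+x. ennreal \<bar>w i (- (t *\<^sub>R e i) + x) - w i x\<bar> \<partial>lborel) \<le> ennreal (1 / Suc k))"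
      by eventually_elim blast
    then show ?thesis unfolding near_def by (rule eventually_happens'[rotated]) simp
  qed
  then obtain t where near: "\<And>k. near k (t k)" by metis
  have t: "\<And>k. 0 < t k" "\<And>k i. i \<in> I \<Longrightarrow> t k \<le> t0 i"
    "\<And>k i. i \<in> I \<Longrightarrow> (\<integral>\<^sup>+x. ennreal \<bar>w i (- (t k *\<^sub>R e i) + x) - w i x\<bar> \<partial>lborel) \<le> ennreal (1 / Suc k)"
    using near unfolding near_def by blast+
  define D where "D k x = (\<Sum>i\<in>I. \<bar>w i (- (t k *\<^sub>R e i) + x) - w i x\<bar>)" for k x
  have Dm [measurable]: "D k \<in> borel_measurable borel" for k unfolding D_def by measurable
  have D0: "0 \<le> D k x" for k x unfolding D_def by (intro sum_nonneg) simp
  have Dn: "(\<integral>\<^sup>+x. ennreal (D k x) \<partial>lborel) \<le> ennreal (card I / Suc k)" for k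
  proof -
    have "(\<integral>\<^sup>+x. ennreal (D k x) \<partial>lborel) = (\<Sum>i\<in>I. \<integral>\<^sup>+x. ennreal \<bar>w i (- (t k *\<^sub>R e i) + x) - w i x\<bar> \<partial>lborel)"
      unfolding D_def by (simp add: sum_ennreal[symmetric] nn_integral_sum del: sum_ennreal)
    also have "\<dots> \<le> (\<Sum>i\<in>I. ennreal (1 / Suc k))" by (intro sum_mono t(3))
    also have "\<dots> = ennreal (card I / Suc k)" by (simp add: ennreal_of_nat_eq_real_of_nat ennreal_mult[symmetric])
    finally show ?thesis .
  qed
  have DI: "integrable lborel (D k)" for k
    using Dn[of k] D0 by (intro integrableI_bounded) (auto intro: le_less_trans)
  have "(\<lambda>k. \<integral>x. norm (D k x) \<partial>lborel) \<longlonglongrightarrow> 0"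
  proof (rule tendsto_sandwich[OF _ _ tendsto_const])
    show "(\<lambda>k. real (card I) * inverse (real (Suc k))) \<longlonglongrightarrow> 0"
      using tendsto_mult_right_zero[OF LIMSEQ_inverse_real_of_nat] by simp
    show "\<forall>\<^sub>F k in sequentially. 0 \<le> (\<integral>x. norm (D k x) \<partial>lborel)" by simp
    show "\<forall>\<^sub>F k in sequentially. (\<integral>x. norm (D k x) \<partial>lborel) \<le> real (card I) * inverse (real (Suc k))"
    proof (intro always_eventually allI)
      fix k
      have "ennreal (\<integral>x. D k x \<partial>lborel) \<le> ennreal (card I / Suc k)"
        using Dn[of k] D0 nn_integral_eq_integral[OF DI[of k]] by simp
      then show "(\<integral>x. norm (D k x) \<partial>lborel) \<le> real (card I) * inverse (real (Suc k))"
        using D0 by (subst (asm) ennreal_le_iff) (auto simp: divide_inverse)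
    qed
  qed
  from tendsto_L1_AE_subseq[OF DI this] obtain \<kappa> where \<kappa>: "AE x in lborel. (\<lambda>k. D (\<kappa> k) x) \<longlonglongrightarrow> 0" by blast
  define W where "W k x = Max ((\<lambda>i. w i (- (t k *\<^sub>R e i) + x)) ` I)" for k x
  define u where "u k x = min (\<phi> x) (W k x)" for k x
  have Wm [measurable]: "W k \<in> borel_measurable borel" for k
    unfolding W_def by (rule borel_measurable_Max[OF I(2)]) measurable
  have um [measurable]: "u k \<in> borel_measurable borel" for k unfolding u_def by measurable
  have W0: "0 \<le> W k x" for k x
  proof -
    obtain i where i: "i \<in> I" using Ine by blast
    have "w i (- (t k *\<^sub>R e i) + x) \<le> W k x" unfolding W_def using I(2) i by (intro Max_ge) auto
    then show ?thesis using w0(1) order_trans by blast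
  qed
  have u0: "0 \<le> u k x" "u k x \<le> \<phi> x" for k x using W0 \<phi>B(1) by (auto simp: u_def)
  have ulim: "AE x in lborel. (\<lambda>k. u (\<kappa> k) x) \<longlonglongrightarrow> \<phi> x"
    using \<kappa>
  proof eventually_elim
    case (elim x)
    have base: "\<phi> x = min (\<phi> x) (Max ((\<lambda>i. w i x) ` I))"
    proof (cases "x \<in> S")
      case True
      then obtain i where i: "i \<in> I" "x \<in> ball i (R i / 2)" using I(3) by blast
      have Ri: "0 < R i" using R I(1) i by auto
      have "norm (x - i) \<le> R i / 2" using i(2) by (simp add: dist_norm norm_minus_commute)
      then have "2 * M / R i * (R i / 2) \<le> 2 * M / R i * (R i - norm (x - i))"
        using Ri M by (intro mult_left_mono) auto
      then have "M \<le> \<zeta> i x" using Ri by (simp add: \<zeta>_def)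
      then have "w i x = \<phi> x" using \<phi>B(2)[of x] by (simp add: w_def)
      moreover have "w i x \<le> Max ((\<lambda>i. w i x) ` I)" using I(2) i by (intro Max_ge) auto
      ultimately show ?thesis by simp
    next
      case False
      then have "\<phi> x = 0" using \<phi>0[of x] closure_subset[of \<Omega>] by (auto simp: S_def)
      moreover obtain i where i: "i \<in> I" using Ine by blast
      moreover have "w i x \<le> Max ((\<lambda>i. w i x) ` I)" using I(2) i by (intro Max_ge) auto
      ultimately show ?thesis using w0(1)[of i x] by simp
    qed
    have "norm (u (\<kappa> k) x - \<phi> x) \<le> D (\<kappa> k) x" for k
    proof -
      obtain i where i: "i \<in> I" "\<bar>W (\<kappa> k) x - Max ((\<lambda>i. w i x) ` I)\<bar> \<le> \<bar>w i (- (t (\<kappa> k) *\<^sub>R e i) + x) - w i x\<bar>"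
        using Max_diff_le[OF I(2) Ine] unfolding W_def by blast
      have "norm (u (\<kappa> k) x - \<phi> x) = \<bar>min (\<phi> x) (W (\<kappa> k) x) - min (\<phi> x) (Max ((\<lambda>i. w i x) ` I))\<bar>"
        using base by (simp add: u_def)
      also have "\<dots> \<le> \<bar>W (\<kappa> k) x - Max ((\<lambda>i. w i x) ` I)\<bar>"
        using min_diff_le[of "\<phi> x" "W (\<kappa> k) x" "\<phi> x"] by auto
      also note i(2)
      also have "\<bar>w i (- (t (\<kappa> k) *\<^sub>R e i) + x) - w i x\<bar> \<le> D (\<kappa> k) x"
        unfolding D_def by (rule member_le_sum[OF i(1) _ I(2)]) simp
      finally show ?thesis .
    qed
    then have "(\<lambda>k. u (\<kappa> k) x - \<phi> x) \<longlonglongrightarrow> 0"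
      by (intro Lim_null_comparison[OF _ elim] always_eventually) blast
    then show ?case by (simp add: LIM_zero_iff)
  qed
  define Bd where "Bd = energy p r \<phi> + (\<Sum>i\<in>I. energy p r (w i))"
  have Bd: "Bd < \<infinity>" using \<phi>e we I(2) by (simp add: Bd_def)
  have ue: "energy p r (u k) \<le> Bd" for k
  proof -
    define vv where "vv = case_option \<phi> (\<lambda>i x. w i (- (t k *\<^sub>R e i) + x))"
    have "energy p r (u k) \<le> (\<Sum>c\<in>insert None (Some ` I). energy p r (vv c))"
    proof (rule energy_le_sum)
      show "vv c \<in> borel_measurable borel" for c by (cases c) (auto simp: vv_def)
      fix x y
      obtain i where i: "i \<in> I" "\<bar>W k x - W k y\<bar> \<le> \<bar>w i (- (t k *\<^sub>R e i) + x) - w i (- (t k *\<^sub>R e i) + y)\<bar>"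
        using Max_diff_le[OF I(2) Ine] unfolding W_def by blast
      have "\<bar>u k x - u k y\<bar> \<le> \<bar>\<phi> x - \<phi> y\<bar> \<or> \<bar>u k x - u k y\<bar> \<le> \<bar>W k x - W k y\<bar>"
        unfolding u_def by (rule min_diff_le)
      then show "\<exists>c\<in>insert None (Some ` I). \<bar>u k x - u k y\<bar> \<le> \<bar>vv c x - vv c y\<bar>"
      proof
        assume "\<bar>u k x - u k y\<bar> \<le> \<bar>\<phi> x - \<phi> y\<bar>"
        then show ?thesis by (intro bexI[of _ None]) (auto simp: vv_def)
      next
        assume "\<bar>u k x - u k y\<bar> \<le> \<bar>W k x - W k y\<bar>"
        then show ?thesis using i by (intro bexI[of _ "Some i"]) (auto simp: vv_def)
      qed
    qed (use I(2) p in auto)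
    also have "\<dots> = Bd"
      using I(2) by (simp add: Bd_def vv_def sum.reindex energy_shift del: uminus_add_conv_diff)
    finally show ?thesis .
  qed
  have eq: "integrable lborel (\<lambda>x. f x * u k x)" "plap_form p r v (u k) = (\<integral>x. f x * u k x \<partial>lborel)" for k
  proof -
    define C where "C = (\<Union>i\<in>I. (+) (t k *\<^sub>R e i) ` (S \<inter> cball i (R i)))"
    have 1: "compact C" unfolding C_def using I(2) S
      by (intro compact_UN compact_translation) (auto simp: compact_Int_closed)
    have 2: "C \<subseteq> \<Omega>"
    proof
      fix x assume "x \<in> C"
      then obtain i z where "i \<in> I" "z \<in> S" "z \<in> cball i (R i)" "x = z + t k *\<^sub>R e i"
        by (auto simp: C_def add.commute)
      then show "x \<in> \<Omega>" using inw[of i z "t k"] t I(1) by auto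
    qed
    have 3: "u k x = 0" if "x \<notin> C" for x
    proof -
      have "w i (- (t k *\<^sub>R e i) + x) = 0" if i: "i \<in> I" for i
      proof (rule ccontr)
        assume "w i (- (t k *\<^sub>R e i) + x) \<noteq> 0"
        from wsupp[OF this i] have "t k *\<^sub>R e i + (- (t k *\<^sub>R e i) + x) \<in> C"
          unfolding C_def using i by blast
        then show False using \<open>x \<notin> C\<close> by simp
      qed
      then have "(\<lambda>i. w i (- (t k *\<^sub>R e i) + x)) ` I = {0}" using Ine by auto
      then have "W k x = 0" by (simp add: W_def)
      then show ?thesis using \<phi>B(1)[of x] by (simp add: u_def)
    qed
    have 4: "\<bar>u k x\<bar> \<le> M" for x using u0[of k x] \<phi>B(2)[of x] by linarith
    have 5: "energy p r (u k) < \<infinity>" using ue Bd by (rule le_less_trans)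
    show "integrable lborel (\<lambda>x. f x * u k x)" "plap_form p r v (u k) = (\<integral>x. f x * u k x \<partial>lborel)"
      using test_compact[OF um 4 1 2 3 5] by auto
  qed
  have "(\<lambda>k. plap_form p r v (u (\<kappa> k))) \<longlonglongrightarrow> plap_form p r v \<phi>"
    by (rule plap_form_limit[OF p v_measurable um \<phi> v_energy ue Bd ulim])
  then show ?thesis
  proof (rule LIMSEQ_le_const2)
    have "plap_form p r v (u k) \<le> (\<integral>x. f x * \<phi> x \<partial>lborel)" for k
      unfolding eq(2) using eq(1) \<phi>I u0 f_nonneg by (intro integral_mono mult_left_mono) auto
    then show "\<exists>N. \<forall>n\<ge>N. plap_form p r v (u (\<kappa> n)) \<le> (\<integral>x. f x * \<phi> x \<partial>lborel)" by blast
  qed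
qed

end

subsection \<open>De Giorgi iteration\<close>

lemma fast_geometric_convergence:
  fixes A b \<gamma> :: real
  assumes A: "0 < A" and b: "1 \<le> b" and \<gamma>: "1 < \<gamma>"
  obtains \<epsilon> where "0 < \<epsilon>"
    "\<And>y. \<lbrakk>\<And>j::nat. 0 \<le> y j; y 0 \<le> \<epsilon>; \<And>j. y (Suc j) \<le> (A * b ^ j * y j) powr \<gamma>\<rbrakk> \<Longrightarrow> y \<longlonglongrightarrow> 0"
proof -
  define \<theta> where "\<theta> = (1 / (2 * b powr \<gamma>)) powr (1 / (\<gamma> - 1))"
  define \<epsilon> where "\<epsilon> = (\<theta> / A powr \<gamma>) powr (1 / (\<gamma> - 1))"
  have bg: "1 \<le> b powr \<gamma>" using b \<gamma> by (simp add: ge_one_powr_ge_zero)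
  have \<theta>: "0 < \<theta>" using b by (simp add: \<theta>_def)
  have \<theta>1: "\<theta> < 1"
  proof -
    have "1 / (2 * b powr \<gamma>) < 1" using bg by (simp add: divide_less_eq)
    then show ?thesis
      using powr_less_mono2[of "1 / (\<gamma> - 1)" "1 / (2 * b powr \<gamma>)" 1] \<gamma> by (simp add: \<theta>_def)
  qed
  have \<epsilon>: "0 < \<epsilon>" using \<theta> A by (simp add: \<epsilon>_def)
  have \<epsilon>g: "\<epsilon> powr (\<gamma> - 1) = \<theta> / A powr \<gamma>" using \<gamma> \<theta> A by (simp add: \<epsilon>_def powr_powr)
  have \<theta>g: "\<theta> powr (\<gamma> - 1) = 1 / (2 * b powr \<gamma>)" using \<gamma> b by (simp add: \<theta>_def powr_powr)
  show ?thesis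
  proof (rule that[OF \<epsilon>])
    fix y :: "nat \<Rightarrow> real"
    assume y0: "\<And>j. 0 \<le> y j" and ye: "y 0 \<le> \<epsilon>" and step: "\<And>j. y (Suc j) \<le> (A * b ^ j * y j) powr \<gamma>"
    have bound: "y j \<le> \<epsilon> * \<theta> ^ j" for j
    proof (induction j)
      case (Suc j)
      have "y (Suc j) \<le> (A * b ^ j * (\<epsilon> * \<theta> ^ j)) powr \<gamma>"
        using A b y0[of j] \<gamma> Suc by (intro order_trans[OF step] powr_mono2 mult_left_mono mult_nonneg_nonneg) auto
      also have "\<dots> = A powr \<gamma> * (\<epsilon> powr (\<gamma> - 1) * \<epsilon>) * (b powr \<gamma> * (\<theta> powr (\<gamma> - 1) * \<theta>)) ^ j"
      proof -
        have "\<epsilon> powr (\<gamma> - 1) * \<epsilon> = \<epsilon> powr \<gamma>" "\<theta> powr (\<gamma> - 1) * \<theta> = \<theta> powr \<gamma>"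
          using powr_mult_base[of \<epsilon> "\<gamma> - 1"] powr_mult_base[of \<theta> "\<gamma> - 1"] \<epsilon> \<theta> by (simp_all add: mult.commute)
        moreover have "(x ^ j) powr \<gamma> = (x powr \<gamma>) ^ j" if "0 < x" for x :: real
          using that by (simp add: powr_realpow[symmetric] powr_powr mult.commute)
        ultimately show ?thesis using A b \<epsilon> \<theta> by (simp add: powr_mult power_mult_distrib)
      qed
      also have "\<dots> = \<epsilon> * \<theta> * (\<theta> / 2) ^ j"
        using A b unfolding \<epsilon>g \<theta>g by simp
      also have "\<dots> \<le> \<epsilon> * \<theta> * \<theta> ^ j"
        using \<epsilon> \<theta> by (intro mult_left_mono power_mono) auto
      finally show ?case by (simp add: mult.assoc)
    qed (use ye in simp)
    have lim: "(\<lambda>j. \<epsilon> * \<theta> ^ j) \<longlonglongrightarrow> \<epsilon> * 0"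
      using \<theta> \<theta>1 by (intro tendsto_mult tendsto_const LIMSEQ_realpow_zero) auto
    show "y \<longlonglongrightarrow> 0"
    proof (rule tendsto_sandwich)
      show "(\<lambda>_::nat. 0::real) \<longlonglongrightarrow> 0" by (rule tendsto_const)
      show "(\<lambda>j. \<epsilon> * \<theta> ^ j) \<longlonglongrightarrow> 0" using lim by simp
      show "\<forall>\<^sub>F j in sequentially. 0 \<le> y j" by (intro always_eventually allI y0)
      show "\<forall>\<^sub>F j in sequentially. y j \<le> \<epsilon> * \<theta> ^ j" by (intro always_eventually allI bound)
    qed
  qed
qed

lemma nn_integral_powr_le_truncations:
  fixes w :: "'a \<Rightarrow> real"
  assumes [measurable]: "w \<in> borel_measurable M"
    and K: "\<And>m::nat. (\<integral>\<^sup>+x. ennreal (min (w x) (real (Suc m)) powr P) \<partial>M) \<le> K"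
  shows "(\<integral>\<^sup>+x. ennreal (w x powr P) \<partial>M) \<le> K"
proof -
  have "(\<integral>\<^sup>+x. ennreal (w x powr P) \<partial>M) = (\<integral>\<^sup>+x. liminf (\<lambda>m. ennreal (min (w x) (real (Suc m)) powr P)) \<partial>M)"
  proof (intro nn_integral_cong)
    fix x
    obtain m0 :: nat where "w x < real m0" using reals_Archimedean2 by blast
    then have "\<forall>\<^sub>F m in sequentially. ennreal (min (w x) (real (Suc m)) powr P) = ennreal (w x powr P)"
      by (intro eventually_sequentiallyI[of m0]) (auto simp: min_def)
    then have "(\<lambda>m. ennreal (min (w x) (real (Suc m)) powr P)) \<longlonglongrightarrow> ennreal (w x powr P)"
      by (rule tendsto_eventually)
    then show "ennreal (w x powr P) = liminf (\<lambda>m. ennreal (min (w x) (real (Suc m)) powr P))"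
      by (rule lim_imp_Liminf[OF sequentially_bot, symmetric])
  qed
  also have "\<dots> \<le> liminf (\<lambda>m. \<integral>\<^sup>+x. ennreal (min (w x) (real (Suc m)) powr P) \<partial>M)"
    by (rule nn_integral_liminf) measurable
  also have "\<dots> \<le> liminf (\<lambda>m. K)"
    by (intro Liminf_mono always_eventually allI K)
  finally show ?thesis by (simp add: Liminf_const)
qed

locale critical_equation = tested_equation p s \<Omega> v f r
  for p s :: real and \<Omega> :: "(real ^ 'n) set" and v f :: "real ^ 'n \<Rightarrow> real" and r +
  fixes P \<kappa> :: real
  assumes sp: "s * p < real CARD('n)" and P_def: "P = real CARD('n) * p / (real CARD('n) - s * p)"
    and domain: "bounded \<Omega>" "\<Omega> \<noteq> {}" "inward_directions \<Omega>"
    and v_nonneg: "\<And>x. 0 \<le> v x" and v_outside: "\<And>x. x \<notin> \<Omega> \<Longrightarrow> v x = 0"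
    and \<kappa>: "0 < \<kappa>" and f_le: "\<And>x. 1 \<le> v x \<Longrightarrow> f x \<le> \<kappa> * v x powr (P - 1)"
begin

lemma p_less_P: "p < P"
proof -
  have "p * (real CARD('n) - s * p) < p * real CARD('n)"
    using p s by (intro mult_strict_left_mono) auto
  then show ?thesis using sp by (simp add: P_def less_divide_eq mult.commute)
qed

lemma nn_integral_powr_le:
  obtains C where "0 < C" "\<And>w E. \<lbrakk>w \<in> borel_measurable borel; \<And>x. 0 \<le> w x; \<And>x. x \<notin> \<Omega> \<Longrightarrow> w x = 0;
      \<And>m::nat. energy p r (\<lambda>x. min (w x) (real (Suc m))) \<le> ennreal E; 0 \<le> E\<rbrakk>
    \<Longrightarrow> (\<integral>\<^sup>+x. ennreal (w x powr P) \<partial>lborel) \<le> ennreal ((C * E) powr (P / p))"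
proof -
  have dim: "real DIM(real ^ 'n) = real CARD('n)" by simp
  have \<sigma>: "0 < s * p" "s * p < real DIM(real ^ 'n)" using s p sp by auto
  obtain C where C: "0 < C" and sob: "\<And>w T. \<lbrakk>w \<in> borel_measurable borel; \<And>x::real^'n. 0 \<le> w x;
       (\<integral>\<^sup>+x. ennreal (w x powr P) \<partial>lborel) = ennreal T; 0 \<le> T\<rbrakk>
      \<Longrightarrow> ennreal (T powr (p / P)) \<le> ennreal C * energy p r w"
    using sobolev[OF p \<sigma>, of P] unfolding dim P_def[symmetric] r[symmetric] by blast
  show ?thesis
  proof (rule that[OF C])
    fix w :: "real ^ 'n \<Rightarrow> real" and E :: real
    assume [measurable]: "w \<in> borel_measurable borel" and w0: "\<And>x. 0 \<le> w x" and w\<Omega>: "\<And>x. x \<notin> \<Omega> \<Longrightarrow> w x = 0"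
      and E: "\<And>m::nat. energy p r (\<lambda>x. min (w x) (real (Suc m))) \<le> ennreal E" "0 \<le> E"
    show "(\<integral>\<^sup>+x. ennreal (w x powr P) \<partial>lborel) \<le> ennreal ((C * E) powr (P / p))"
    proof (rule nn_integral_powr_le_truncations)
      fix m :: nat
      define g where "g x = min (w x) (real (Suc m))" for x
      have [measurable]: "g \<in> borel_measurable borel" unfolding g_def by measurable
      have g0: "0 \<le> g x" for x using w0[of x] by (simp add: g_def)
      have "(\<integral>\<^sup>+x. ennreal (g x powr P) \<partial>lborel) \<le> (\<integral>\<^sup>+x. ennreal (real (Suc m) powr P) * indicator \<Omega> x \<partial>lborel)"
      proof (rule nn_integral_mono)
        fix x
        show "ennreal (g x powr P) \<le> ennreal (real (Suc m) powr P) * indicator \<Omega> x"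
        proof (cases "x \<in> \<Omega>")
          case True
          have "g x powr P \<le> real (Suc m) powr P"
            using g0[of x] p p_less_P by (intro powr_mono2) (auto simp: g_def)
          then show ?thesis using True by (simp add: ennreal_leI)
        qed (simp add: g_def w\<Omega>)
      qed
      also have "\<dots> < \<infinity>"
        using open_\<Omega> emeasure_bounded_finite[OF domain(1)]
        by (simp add: nn_integral_cmult_indicator borel_open ennreal_mult_less_top)
      finally obtain T where T: "(\<integral>\<^sup>+x. ennreal (g x powr P) \<partial>lborel) = ennreal T" "0 \<le> T"
        by (cases "\<integral>\<^sup>+x. ennreal (g x powr P) \<partial>lborel") auto
      have "ennreal (T powr (p / P)) \<le> ennreal C * energy p r g"
        by (rule sob[OF _ g0 T]) measurable
      also have "\<dots> \<le> ennreal C * ennreal E"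
        using E(1)[of m] unfolding g_def[abs_def] by (rule mult_left_mono) simp
      also have "\<dots> = ennreal (C * E)" using C E(2) by (simp add: ennreal_mult)
      finally have "T powr (p / P) \<le> C * E"
        using C E(2) by (subst (asm) ennreal_le_iff) auto
      then have "(T powr (p / P)) powr (P / p) \<le> (C * E) powr (P / p)"
        using p p_less_P by (intro powr_mono2) auto
      moreover have "(T powr (p / P)) powr (P / p) = T"
        using p p_less_P T(2) by (simp add: powr_powr)
      ultimately show "(\<integral>\<^sup>+x. ennreal (min (w x) (real (Suc m)) powr P) \<partial>lborel) \<le> ennreal ((C * E) powr (P / p))"
        using T by (simp add: g_def ennreal_leI)
    qed measurable
  qed
qed

lemma v_powr_integrable: "integrable lborel (\<lambda>x. v x powr P)"
proof (rule integrableI_bounded)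
  obtain E where E: "energy p r v = ennreal E" "0 \<le> E"
    using v_energy by (cases "energy p r v") auto
  obtain C where "(\<integral>\<^sup>+x. ennreal (v x powr P) \<partial>lborel) \<le> ennreal ((C * E) powr (P / p))"
  proof (rule nn_integral_powr_le)
    fix C assume *: "\<And>w E. \<lbrakk>w \<in> borel_measurable borel; \<And>x. 0 \<le> w x; \<And>x. x \<notin> \<Omega> \<Longrightarrow> w x = 0;
      \<And>m::nat. energy p r (\<lambda>x. min (w x) (real (Suc m))) \<le> ennreal E; 0 \<le> E\<rbrakk>
    \<Longrightarrow> (\<integral>\<^sup>+x. ennreal (w x powr P) \<partial>lborel) \<le> ennreal ((C * E) powr (P / p))"
    have "(\<integral>\<^sup>+x. ennreal (v x powr P) \<partial>lborel) \<le> ennreal ((C * E) powr (P / p))"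
    proof (rule *[OF v_measurable v_nonneg v_outside _ E(2)])
      show "energy p r (\<lambda>x. min (v x) (real (Suc m))) \<le> ennreal E" for m
        unfolding E(1)[symmetric] by (rule energy_mono) (use p in \<open>auto simp: min_def\<close>)
    qed
    then show thesis by (rule that)
  qed
  then show "(\<integral>\<^sup>+x. ennreal (norm (v x powr P)) \<partial>lborel) < \<infinity>" by (simp add: le_less_trans)
qed measurable

definition J :: "real \<Rightarrow> real" where "J k = (\<integral>x. v x powr (P - 1) * max (v x - k) 0 \<partial>lborel)"
definition W :: "real \<Rightarrow> real" where "W k = (\<integral>x. max (v x - k) 0 powr P \<partial>lborel)"

lemma v_powr_mult_le:
  assumes "0 \<le> k"
  shows "v x powr (P - 1) * max (v x - k) 0 \<le> v x powr P"
proof -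
  have "v x powr (P - 1) * max (v x - k) 0 \<le> v x powr (P - 1) * v x"
    using assms v_nonneg[of x] by (intro mult_left_mono) auto
  also have "\<dots> = v x powr P"
    using powr_mult_base[OF v_nonneg[of x], of "P - 1"] by (simp add: mult.commute)
  finally show ?thesis .
qed

lemma J_integrable: "0 \<le> k \<Longrightarrow> integrable lborel (\<lambda>x. v x powr (P - 1) * max (v x - k) 0)"
  by (rule Bochner_Integration.integrable_bound[OF v_powr_integrable])
     (use v_powr_mult_le in \<open>auto simp: abs_mult\<close>)

lemma W_bound:
  assumes "0 \<le> k"
  shows "max (v x - k) 0 powr P \<le> v x powr P"
  using assms v_nonneg[of x] p p_less_P by (intro powr_mono2) auto

lemma W_integrable: "0 \<le> k \<Longrightarrow> integrable lborel (\<lambda>x. max (v x - k) 0 powr P)"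
  by (rule Bochner_Integration.integrable_bound[OF v_powr_integrable]) (use W_bound in auto)

lemma W_nonneg: "0 \<le> W k"
  unfolding W_def by (intro integral_nonneg_AE AE_I2) simp

lemma level_energy:
  assumes k: "1 \<le> k" and M: "0 < M"
  shows "energy p r (\<lambda>x. min (max (v x - k) 0) M) \<le> ennreal (\<kappa> * J k)"
proof -
  define \<phi> where "\<phi> x = min (max (v x - k) 0) M" for x
  have [measurable]: "\<phi> \<in> borel_measurable borel" unfolding \<phi>_def by measurable
  have lip: "\<bar>\<phi> x - \<phi> y\<bar> \<le> \<bar>v x - v y\<bar>" for x y
    unfolding \<phi>_def by linarith
  have mono: "0 \<le> (v x - v y) * (\<phi> x - \<phi> y)" for x y
  proof -
    have "v x \<le> v y \<Longrightarrow> \<phi> x \<le> \<phi> y" "v y \<le> v x \<Longrightarrow> \<phi> y \<le> \<phi> x" unfolding \<phi>_def by linarith+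
    then show ?thesis by (cases "v x \<le> v y") (auto intro: mult_nonneg_nonneg mult_nonpos_nonpos)
  qed
  have "energy p r \<phi> \<le> energy p r v" by (rule energy_mono) (use p lip in auto)
  then have \<phi>e: "energy p r \<phi> < \<infinity>" using v_energy by (rule le_less_trans)
  have \<phi>0: "0 \<le> \<phi> x" "\<phi> x \<le> M" "\<phi> x \<le> max (v x - k) 0" for x using M by (auto simp: \<phi>_def)
  have f\<phi>: "f x * \<phi> x \<le> \<kappa> * (v x powr (P - 1) * max (v x - k) 0)" for x
  proof (cases "k < v x")
    case True
    then have "f x * \<phi> x \<le> (\<kappa> * v x powr (P - 1)) * max (v x - k) 0"
      using k \<phi>0[of x] \<kappa> by (intro mult_mono f_le) auto
    then show ?thesis by (simp add: mult.assoc)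
  qed (use M in \<open>simp add: \<phi>_def\<close>)
  have \<phi>I: "integrable lborel (\<lambda>x. f x * \<phi> x)"
  proof (rule Bochner_Integration.integrable_bound)
    show "integrable lborel (\<lambda>x. \<kappa> * (v x powr (P - 1) * max (v x - k) 0))"
      using k by (intro integrable_mult_right J_integrable) auto
    show "AE x in lborel. norm (f x * \<phi> x) \<le> norm (\<kappa> * (v x powr (P - 1) * max (v x - k) 0))"
      using f\<phi> \<phi>0 f_nonneg order_trans[OF f\<phi> abs_ge_self] by (intro AE_I2) (auto simp: abs_of_nonneg)
  qed measurable
  have \<phi>\<Omega>: "\<phi> x = 0" if "x \<notin> \<Omega>" for x using v_outside[OF that] k M by (simp add: \<phi>_def)
  define G where "G z = \<bar>v (fst z) - v (snd z)\<bar> powr (p - 2) * (v (fst z) - v (snd z)) * (\<phi> (fst z) - \<phi> (snd z)) / norm (fst z - snd z) powr r"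
    for z :: "(real ^ 'n) \<times> (real ^ 'n)"
  have [measurable]: "G \<in> borel_measurable borel" unfolding G_def by measurable
  have absG: "\<bar>a\<bar> powr (p - 2) * a * b = \<bar>a\<bar> powr (p - 1) * \<bar>b\<bar>" if "0 \<le> a * b" for a b :: real
  proof -
    have "\<bar>a\<bar> powr (p - 2) * \<bar>a\<bar> = \<bar>a\<bar> powr (p - 1)"
      using powr_mult_base[of "\<bar>a\<bar>" "p - 2"] by (simp add: mult.commute)
    moreover have "a * b = \<bar>a\<bar> * \<bar>b\<bar>" using that by (simp flip: abs_mult)
    ultimately show ?thesis by (metis mult.assoc)
  qed
  have sand: "\<bar>b\<bar> powr p \<le> \<bar>a\<bar> powr (p - 1) * \<bar>b\<bar>" "\<bar>a\<bar> powr (p - 1) * \<bar>b\<bar> \<le> \<bar>a\<bar> powr p" if "\<bar>b\<bar> \<le> \<bar>a\<bar>" for a b :: real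
  proof -
    have "\<bar>b\<bar> powr p = \<bar>b\<bar> powr (p - 1) * \<bar>b\<bar>" using powr_mult_base[of "\<bar>b\<bar>" "p - 1"] by (simp add: mult.commute)
    also have "\<dots> \<le> \<bar>a\<bar> powr (p - 1) * \<bar>b\<bar>" using that p by (intro mult_right_mono powr_mono2) auto
    finally show "\<bar>b\<bar> powr p \<le> \<bar>a\<bar> powr (p - 1) * \<bar>b\<bar>" .
    have "\<bar>a\<bar> powr (p - 1) * \<bar>b\<bar> \<le> \<bar>a\<bar> powr (p - 1) * \<bar>a\<bar>" using that by (intro mult_left_mono) auto
    also have "\<dots> = \<bar>a\<bar> powr p" using powr_mult_base[of "\<bar>a\<bar>" "p - 1"] by (simp add: mult.commute)
    finally show "\<bar>a\<bar> powr (p - 1) * \<bar>b\<bar> \<le> \<bar>a\<bar> powr p" .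
  qed
  have Glo: "\<bar>\<phi> (fst z) - \<phi> (snd z)\<bar> powr p / norm (fst z - snd z) powr r \<le> G z"
    and Ghi: "G z \<le> \<bar>v (fst z) - v (snd z)\<bar> powr p / norm (fst z - snd z) powr r" for z
    unfolding G_def absG[OF mono] by (intro divide_right_mono sand lip; simp)+
  have G0: "0 \<le> G z" for z by (rule order_trans[OF _ Glo]) simp
  have GI: "integrable lborel G"
  proof (rule integrableI_bounded)
    have "(\<integral>\<^sup>+z. ennreal (norm (G z)) \<partial>lborel) \<le> energy p r v"
      unfolding energy_def using G0 Ghi by (intro nn_integral_mono) (simp add: ennreal_leI)
    then show "(\<integral>\<^sup>+z. ennreal (norm (G z)) \<partial>lborel) < \<infinity>" using v_energy by (rule le_less_trans)
  qed measurable
  have "energy p r \<phi> \<le> (\<integral>\<^sup>+z. ennreal (G z) \<partial>lborel)"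
    unfolding energy_def by (intro nn_integral_mono ennreal_leI Glo)
  also have "\<dots> = ennreal (plap_form p r v \<phi>)"
    unfolding plap_form_def G_def[symmetric] by (rule nn_integral_eq_integral[OF GI]) (simp add: G0)
  also have "\<dots> \<le> ennreal (\<integral>x. f x * \<phi> x \<partial>lborel)"
    by (intro ennreal_leI test_le[OF domain _ \<phi>0(1,2) M \<phi>\<Omega> \<phi>e \<phi>I]) measurable
  also have "\<dots> \<le> ennreal (\<integral>x. \<kappa> * (v x powr (P - 1) * max (v x - k) 0) \<partial>lborel)"
    using k by (intro ennreal_leI integral_mono \<phi>I integrable_mult_right J_integrable f\<phi>) auto
  also have "\<dots> = ennreal (\<kappa> * J k)" by (simp add: J_def)
  finally show ?thesis by (simp add: \<phi>_def[abs_def])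
qed

lemma J_nonneg: "0 \<le> J k"
  unfolding J_def by (intro integral_nonneg_AE AE_I2) simp

lemma J_le:
  assumes "0 < k" "k < l"
  shows "J l \<le> (l / (l - k)) powr (P - 1) * W k"
proof -
  define c where "c = l / (l - k)"
  have c: "0 < c" using assms by (simp add: c_def)
  have "J l \<le> (\<integral>x. c powr (P - 1) * max (v x - k) 0 powr P \<partial>lborel)"
    unfolding J_def
  proof (rule integral_mono)
    show "integrable lborel (\<lambda>x. v x powr (P - 1) * max (v x - l) 0)" using assms by (intro J_integrable) auto
    show "integrable lborel (\<lambda>x. c powr (P - 1) * max (v x - k) 0 powr P)" using assms by (intro integrable_mult_right W_integrable) auto
    fix x
    show "v x powr (P - 1) * max (v x - l) 0 \<le> c powr (P - 1) * max (v x - k) 0 powr P"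
    proof (cases "l < v x")
      case True
      define y where "y = v x - k"
      have y: "0 < y" using True assms by (simp add: y_def)
      have "v x * (l - k) \<le> l * (v x - k)"
        using True assms by (simp add: algebra_simps)
      then have "v x \<le> c * y" using assms by (simp add: c_def y_def field_simps)
      then have "v x powr (P - 1) \<le> (c * y) powr (P - 1)"
        using v_nonneg p p_less_P by (intro powr_mono2) auto
      then have "v x powr (P - 1) * max (v x - l) 0 \<le> (c * y) powr (P - 1) * y"
        using True assms by (intro mult_mono) (auto simp: y_def)
      also have "\<dots> = c powr (P - 1) * (y * y powr (P - 1))" using c y by (simp add: powr_mult)
      also have "y * y powr (P - 1) = y powr P" using y powr_mult_base[of y "P - 1"] by simp
      finally show ?thesis using y by (simp add: y_def)
    qed simp
  qed
  then show ?thesis by (simp add: W_def c_def)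
qed

lemma W_tendsto_0: "(\<lambda>m::nat. W (real m)) \<longlonglongrightarrow> 0"
proof -
  have "(\<lambda>m::nat. W (real m)) \<longlonglongrightarrow> (\<integral>x. 0 \<partial>(lborel :: (real ^ 'n) measure))"
    unfolding W_def
  proof (rule integral_dominated_convergence[OF _ _ v_powr_integrable])
    show "AE x in lborel. (\<lambda>m. max (v x - real m) 0 powr P) \<longlonglongrightarrow> 0"
    proof (intro AE_I2)
      fix x
      obtain m0 :: nat where m0: "v x < real m0" using reals_Archimedean2 by blast
      have "\<forall>\<^sub>F m in sequentially. max (v x - real m) 0 powr P = 0"
        by (rule eventually_sequentiallyI[of m0]) (use m0 in auto)
      then show "(\<lambda>m. max (v x - real m) 0 powr P) \<longlonglongrightarrow> 0" by (rule tendsto_eventually)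
    qed
    show "AE x in lborel. norm (max (v x - real m) 0 powr P) \<le> v x powr P" for m
      using W_bound by simp
  qed measurable
  then show ?thesis by simp
qed

lemma W_step:
  obtains A where "0 < A" "\<And>k l. \<lbrakk>1 \<le> k; k < l\<rbrakk> \<Longrightarrow> W l \<le> (A * (l / (l - k)) powr (P - 1) * W k) powr (P / p)"
proof (rule nn_integral_powr_le)
  fix C assume C: "0 < C" and *: "\<And>w E. \<lbrakk>w \<in> borel_measurable borel; \<And>x. 0 \<le> w x; \<And>x. x \<notin> \<Omega> \<Longrightarrow> w x = 0;
      \<And>m::nat. energy p r (\<lambda>x. min (w x) (real (Suc m))) \<le> ennreal E; 0 \<le> E\<rbrakk>
    \<Longrightarrow> (\<integral>\<^sup>+x. ennreal (w x powr P) \<partial>lborel) \<le> ennreal ((C * E) powr (P / p))"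
  show thesis
  proof (rule that[of "C * \<kappa>"])
    show "0 < C * \<kappa>" using C \<kappa> by simp
    fix k l :: real assume k: "1 \<le> k" and l: "k < l"
    have "ennreal (W l) = (\<integral>\<^sup>+x. ennreal (max (v x - l) 0 powr P) \<partial>lborel)"
      unfolding W_def using k l by (intro nn_integral_eq_integral[symmetric] W_integrable) auto
    also have "\<dots> \<le> ennreal ((C * (\<kappa> * J l)) powr (P / p))"
      using k l \<kappa> J_nonneg v_outside by (intro * level_energy mult_nonneg_nonneg) auto
    finally have "W l \<le> (C * (\<kappa> * J l)) powr (P / p)" by (subst (asm) ennreal_le_iff) auto
    also have "\<dots> \<le> (C * (\<kappa> * ((l / (l - k)) powr (P - 1) * W k))) powr (P / p)"
      using k l C \<kappa> p p_less_P J_nonneg by (intro powr_mono2 mult_left_mono J_le mult_nonneg_nonneg) auto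
    finally show "W l \<le> (C * \<kappa> * (l / (l - k)) powr (P - 1) * W k) powr (P / p)" by (simp add: mult.assoc)
  qed
qed

lemma W_mono: "0 \<le> k \<Longrightarrow> k \<le> l \<Longrightarrow> W l \<le> W k"
  unfolding W_def using p p_less_P by (intro integral_mono W_integrable powr_mono2) auto

lemma essentially_bounded: "\<exists>K. AE x in lborel. v x \<le> K"
proof -
  obtain A where A: "0 < A" and step: "\<And>k l. \<lbrakk>1 \<le> k; k < l\<rbrakk> \<Longrightarrow> W l \<le> (A * (l / (l - k)) powr (P - 1) * W k) powr (P / p)"
    using W_step by blast
  have g: "1 < P / p" using p p_less_P by simp
  have A': "0 < A * 4 powr (P - 1)" using A by simp
  have b': "1 \<le> 2 powr (P - 1)" using p p_less_P by (intro ge_one_powr_ge_zero) auto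
  obtain \<epsilon> where \<epsilon>: "0 < \<epsilon>" and conv: "\<And>y. \<lbrakk>\<And>j::nat. 0 \<le> y j; y 0 \<le> \<epsilon>;
      \<And>j. y (Suc j) \<le> (A * 4 powr (P - 1) * (2 powr (P - 1)) ^ j * y j) powr (P / p)\<rbrakk> \<Longrightarrow> y \<longlonglongrightarrow> 0"
    using fast_geometric_convergence[OF A' b' g] by blast
  have "\<forall>\<^sub>F m in sequentially. W (real m) < \<epsilon> \<and> 1 \<le> m"
    using order_tendstoD(2)[OF W_tendsto_0 \<epsilon>] eventually_ge_at_top[of 1] by (rule eventually_conj)
  then obtain m :: nat where m: "W (real m) < \<epsilon>" "1 \<le> m"
    by (auto simp: eventually_sequentially)
  define K where "K = real m"
  have K: "1 \<le> K" using m(2) by (simp add: K_def)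
  define l where "l j = K * (2 - 1 / 2 ^ j)" for j :: nat
  have l1: "K \<le> l j" "l j \<le> 2 * K" "l j < l (Suc j)" for j
  proof -
    have "1 / 2 ^ j \<le> (1::real)" "0 < 1 / (2::real) ^ j" by simp_all
    moreover have "1 / (2::real) ^ Suc j < 1 / 2 ^ j" by (intro divide_strict_left_mono) auto
    ultimately have "K * 1 \<le> K * (2 - 1 / 2 ^ j)" "K * (2 - 1 / 2 ^ j) \<le> K * 2" "K * (2 - 1 / 2 ^ j) < K * (2 - 1 / 2 ^ Suc j)"
      using K by (intro mult_left_mono mult_strict_left_mono; simp)+
    then show "K \<le> l j" "l j \<le> 2 * K" "l j < l (Suc j)" by (auto simp: l_def)
  qed
  have "(\<lambda>j. W (l j)) \<longlonglongrightarrow> 0"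
  proof (rule conv)
    show "0 \<le> W (l j)" for j by (rule W_nonneg)
    show "W (l 0) \<le> \<epsilon>" using m(1) by (simp add: l_def K_def)
    fix j
    have diff: "l (Suc j) - l j = K / (2 * 2 ^ j)" by (simp add: l_def field_simps)
    have "l (Suc j) / (l (Suc j) - l j) \<le> 2 * K / (K / (2 * 2 ^ j))"
      unfolding diff using l1(2)[of "Suc j"] K by (intro divide_right_mono) auto
    also have "\<dots> = 4 * 2 ^ j" using K by simp
    finally have "(l (Suc j) / (l (Suc j) - l j)) powr (P - 1) \<le> (4 * 2 ^ j) powr (P - 1)"
      using l1[of j] l1[of "Suc j"] K p p_less_P by (intro powr_mono2) auto
    also have "\<dots> = 4 powr (P - 1) * (2 powr (P - 1)) ^ j"
      by (simp add: powr_mult powr_realpow[symmetric] powr_powr mult.commute)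
    finally have *: "(l (Suc j) / (l (Suc j) - l j)) powr (P - 1) \<le> 4 powr (P - 1) * (2 powr (P - 1)) ^ j" .
    have "W (l (Suc j)) \<le> (A * (l (Suc j) / (l (Suc j) - l j)) powr (P - 1) * W (l j)) powr (P / p)"
      using l1[of j] K by (intro step) auto
    also have "\<dots> \<le> (A * (4 powr (P - 1) * (2 powr (P - 1)) ^ j) * W (l j)) powr (P / p)"
      using * A W_nonneg g by (intro powr_mono2 mult_right_mono mult_left_mono mult_nonneg_nonneg) auto
    finally show "W (l (Suc j)) \<le> (A * 4 powr (P - 1) * (2 powr (P - 1)) ^ j * W (l j)) powr (P / p)"
      by (simp only: mult.assoc)
  qed
  moreover have "W (2 * K) \<le> W (l j)" for j
    using l1[of j] K by (intro W_mono) auto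
  ultimately have "W (2 * K) \<le> 0"
    by (intro LIMSEQ_le_const[of "\<lambda>j. W (l j)"]) auto
  then have "W (2 * K) = 0" using W_nonneg[of "2 * K"] by simp
  then have "AE x in lborel. max (v x - 2 * K) 0 powr P = 0"
    unfolding W_def using K by (subst (asm) integral_nonneg_eq_0_iff_AE) (auto intro!: W_integrable)
  then have "AE x in lborel. v x \<le> 2 * K"
    by eventually_elim (auto simp: max_def split: if_splits)
  then show ?thesis by blast
qed

end

subsection \<open>Reduction to a Borel representative\<close>

lemma smooth_continuous: "smooth f \<Longrightarrow> continuous_on UNIV f"
  unfolding smooth_def using Ck.simps(1) by blast

lemma smooth_domain_inward_directions:
  assumes "smooth_bounded_domain \<Omega>"
  shows "inward_directions \<Omega>"
  unfolding inward_directions_def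
proof
  fix x assume x: "x \<in> closure \<Omega>"
  have op: "open \<Omega>" and sb: "smooth_boundary \<Omega>" using assms by (auto simp: smooth_bounded_domain_def)
  show "\<exists>R>0. \<exists>e. \<exists>t0>0. \<forall>z\<in>closure \<Omega> \<inter> cball x R. \<forall>t. 0 < t \<and> t \<le> t0 \<longrightarrow> z + t *\<^sub>R e \<in> \<Omega>"
  proof (cases "x \<in> \<Omega>")
    case True
    then obtain R where "0 < R" "cball x R \<subseteq> \<Omega>" using op open_contains_cball by blast
    then show ?thesis by (intro exI[of _ R] conjI exI[of _ 0] exI[of _ 1]) auto
  next
    case False
    then have "x \<in> frontier \<Omega>" using x op by (simp add: frontier_def interior_open)
    then obtain R e \<gamma> where R: "0 < R" and e: "norm e = 1" and \<gamma>: "smooth \<gamma>" and inv: "\<And>y t. \<gamma> (y + t *\<^sub>R e) = \<gamma> y"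
      and eq: "\<Omega> \<inter> ball x R = {y \<in> ball x R. \<gamma> y < y \<bullet> e}"
      using sb unfolding smooth_boundary_def by blast
    have "closed {y. \<gamma> y \<le> y \<bullet> e}"
      by (intro closed_Collect_le smooth_continuous \<gamma> continuous_intros)
    moreover have "ball x R \<inter> \<Omega> \<subseteq> {y. \<gamma> y \<le> y \<bullet> e}"
      unfolding Int_commute[of "ball x R"] eq by auto
    ultimately have "closure (ball x R \<inter> \<Omega>) \<subseteq> {y. \<gamma> y \<le> y \<bullet> e}"
      by (intro closure_minimal)
    then have le: "\<gamma> z \<le> z \<bullet> e" if "z \<in> closure \<Omega>" "z \<in> ball x R" for z
      using open_Int_closure_subset[of "ball x R" \<Omega>] that by auto
    have "z + t *\<^sub>R e \<in> \<Omega>" if z: "z \<in> closure \<Omega>" "z \<in> cball x (R / 2)" and t: "0 < t" "t \<le> R / 4" for z t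
    proof -
      have "dist x (z + t *\<^sub>R e) \<le> dist x z + norm (t *\<^sub>R e)"
        using dist_triangle[of x "z + t *\<^sub>R e" z] by (simp add: dist_norm)
      then have "z + t *\<^sub>R e \<in> ball x R" using z t e R by simp
      moreover have "\<gamma> (z + t *\<^sub>R e) < (z + t *\<^sub>R e) \<bullet> e"
        using le[of z] z t R e by (simp add: inv inner_add_left dot_square_norm)
      ultimately have "z + t *\<^sub>R e \<in> \<Omega> \<inter> ball x R" using eq by simp
      then show ?thesis by simp
    qed
    then show ?thesis
      using R by (intro exI[of _ "R / 2"] conjI exI[of _ e] exI[of _ "R / 4"]) auto
  qed
qed

lemma lebesgue_integral_AE_borel:
  fixes f g :: "'a::euclidean_space \<Rightarrow> real"
  assumes g: "g \<in> borel_measurable borel" and eq: "AE x in lborel. f x = g x"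
  shows "(\<integral>x. f x \<partial>lebesgue) = (\<integral>x. g x \<partial>lborel)" "integrable lebesgue f \<longleftrightarrow> integrable lborel g"
proof -
  have gm: "g \<in> borel_measurable lebesgue" using g by (simp add: measurable_completion)
  have "AE x in lebesgue. g x = f x"
    using eq by (intro AE_completion) (auto elim: eventually_mono)
  then have fm: "f \<in> borel_measurable lebesgue" by (rule borel_measurable_AE[OF gm])
  have eq': "AE x in lebesgue. f x = g x" using eq by (rule AE_completion)
  show "(\<integral>x. f x \<partial>lebesgue) = (\<integral>x. g x \<partial>lborel)"
    using integral_cong_AE[OF fm gm eq'] g by (simp add: integral_completion)
  show "integrable lebesgue f \<longleftrightarrow> integrable lborel g"
    using integrable_cong_AE[OF fm gm eq'] g by (simp add: integrable_completion)
qed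

theorem theorem6p4:
  fixes \<Omega> :: "(real ^ 'n) set" and u :: "real ^ 'n \<Rightarrow> real" and p s q \<alpha> \<mu> :: real
  assumes "1 < p" and "0 < s" and "s < 1" and "s * p < real CARD('n)"
    and "smooth_bounded_domain \<Omega>"
    and "0 < \<mu>" and "0 < q" and "q \<le> 1"
    and "\<alpha> \<le> sobolev_exponent (real CARD('n)) p s - 1"
    and "positive_weak_solution p s q \<alpha> \<mu> \<Omega> u"
  shows "u \<in> Linfty \<Omega>"
proof -
  define r where "r = real CARD('n) + s * p"
  define P where "P = real CARD('n) * p / (real CARD('n) - s * p)"
  have op: "open \<Omega>" and bd: "bounded \<Omega>" "\<Omega> \<noteq> {}"
    using assms(5) by (auto simp: smooth_bounded_domain_def)
  have [measurable]: "\<Omega> \<in> sets borel" using op by simp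
  have sol: "u \<in> X0 p s \<Omega>" "AE x in lebesgue. x \<in> \<Omega> \<longrightarrow> 0 < u x"
    "\<And>\<psi>. \<psi> \<in> test_functions \<Omega> \<Longrightarrow> set_integrable lebesgue \<Omega> (\<lambda>x. (\<mu> * u x powr (- q) + u x powr \<alpha>) * \<psi> x)"
    "\<And>\<psi>. \<psi> \<in> test_functions \<Omega> \<Longrightarrow> frac_plap_form p s \<Omega> u \<psi> = (LINT x : \<Omega> | lebesgue. (\<mu> * u x powr (- q) + u x powr \<alpha>) * \<psi> x)"
    using assms(10) by (auto simp: positive_weak_solution_def)
  have um: "u \<in> borel_measurable lebesgue" and u0: "AE x in lebesgue. x \<notin> \<Omega> \<longrightarrow> u x = 0"
    and ue: "(\<integral>\<^sup>+ z \<in> Q_set \<Omega>. (case z of (x, y) \<Rightarrow> ennreal (\<bar>u x - u y\<bar> powr p / norm (x - y) powr r)) \<partial>lebesgue) < \<infinity>"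
    using sol(1) by (auto simp: X0_def r_def)
  obtain u' where [measurable]: "u' \<in> borel_measurable borel" and u': "AE x in lborel. u x = u' x"
    using completion_ex_borel_measurable_real[OF um] by auto
  define v where "v x = indicator \<Omega> x * max 0 (u' x)" for x
  have vm [measurable]: "v \<in> borel_measurable borel" unfolding v_def by measurable
  have uv: "AE x in lborel. u x = v x"
    using u' sol(2)[unfolded AE_completion_iff] u0[unfolded AE_completion_iff]
    by eventually_elim (auto simp: v_def indicator_def max_def)
  have v0: "0 \<le> v x" for x by (simp add: v_def)
  have v\<Omega>: "v x = 0" if "x \<notin> \<Omega>" for x using that by (simp add: v_def)
  define f where "f x = indicator \<Omega> x * (\<mu> * v x powr (- q) + v x powr \<alpha>)" for x
  have fm [measurable]: "f \<in> borel_measurable borel" unfolding f_def by measurable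
  have test: "integrable lborel (\<lambda>x. f x * \<psi> x) \<and> plap_form p r v \<psi> = (\<integral>x. f x * \<psi> x \<partial>lborel)"
    if \<psi>: "\<psi> \<in> test_functions \<Omega>" for \<psi>
  proof -
    have "smooth \<psi>" using \<psi> by (simp add: test_functions_def)
    then have [measurable]: "\<psi> \<in> borel_measurable borel"
      by (intro borel_measurable_continuous_onI smooth_continuous)
    have \<psi>0: "\<psi> x = 0" if "x \<notin> \<Omega>" for x
      using \<psi> that closure_subset[of "{x. \<psi> x \<noteq> 0}"] by (auto simp: test_functions_def)
    have ae: "AE x in lborel. indicator \<Omega> x *\<^sub>R ((\<mu> * u x powr (- q) + u x powr \<alpha>) * \<psi> x) = f x * \<psi> x"
      using uv by eventually_elim (simp add: f_def)
    have "(\<lambda>x. f x * \<psi> x) \<in> borel_measurable borel" by measurable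
    note rhs = lebesgue_integral_AE_borel[OF this ae]
    define G where "G z = \<bar>v (fst z) - v (snd z)\<bar> powr (p - 2) * (v (fst z) - v (snd z)) * (\<psi> (fst z) - \<psi> (snd z))
      / norm (fst z - snd z) powr r" for z
    have [measurable]: "G \<in> borel_measurable borel" unfolding G_def by measurable
    have "AE z in lborel. indicator (Q_set \<Omega>) z *\<^sub>R (case z of (x, y) \<Rightarrow>
        \<bar>u x - u y\<bar> powr (p - 2) * (u x - u y) * (\<psi> x - \<psi> y) / norm (x - y) powr r) = G z"
      using AE_lborel_pair[OF uv]
    proof eventually_elim
      case (elim z)
      then show ?case
        by (cases z) (auto simp: G_def Q_set_def indicator_def v\<Omega>)
    qed
    from lebesgue_integral_AE_borel(1)[OF _ this]
    have "frac_plap_form p s \<Omega> u \<psi> = plap_form p r v \<psi>"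
      unfolding frac_plap_form_def plap_form_def set_lebesgue_integral_def G_def[symmetric] r_def[symmetric] by simp
    moreover have "(LINT x : \<Omega> | lebesgue. (\<mu> * u x powr (- q) + u x powr \<alpha>) * \<psi> x) = (\<integral>x. f x * \<psi> x \<partial>lborel)"
      unfolding set_lebesgue_integral_def by (rule rhs(1))
    moreover have "integrable lborel (\<lambda>x. f x * \<psi> x)"
      using sol(3)[OF \<psi>] rhs(2) by (simp add: set_integrable_def)
    ultimately show ?thesis using sol(4)[OF \<psi>] by simp
  qed
  have ve: "energy p r v < \<infinity>"
  proof -
    have "energy p r v = (\<integral>\<^sup>+ z. (case z of (x, y) \<Rightarrow> ennreal (\<bar>u x - u y\<bar> powr p / norm (x - y) powr r)) * indicator (Q_set \<Omega>) z \<partial>lborel)"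
      unfolding energy_def
    proof (rule nn_integral_cong_AE)
      show "AE z in lborel. ennreal (\<bar>v (fst z) - v (snd z)\<bar> powr p / norm (fst z - snd z) powr r)
        = (case z of (x, y) \<Rightarrow> ennreal (\<bar>u x - u y\<bar> powr p / norm (x - y) powr r)) * indicator (Q_set \<Omega>) z"
        using AE_lborel_pair[OF uv]
      proof eventually_elim
        case (elim z)
        then show ?case by (cases z) (auto simp: Q_set_def indicator_def v\<Omega>)
      qed
    qed
    then show ?thesis using ue by (simp add: nn_integral_completion)
  qed
  have P1: "1 < P"
  proof -
    have "1 * (real CARD('n) - s * p) < p * real CARD('n)"
      using assms(1,2,4) by (intro mult_strict_mono) auto
    then show ?thesis using assms(4) by (simp add: P_def less_divide_eq mult.commute)
  qed
  have fle: "f x \<le> (\<mu> + 1) * v x powr (P - 1)" if "1 \<le> v x" for x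
  proof -
    have "v x powr (- q) \<le> v x powr (P - 1)" "v x powr \<alpha> \<le> v x powr (P - 1)"
      using that assms(7,9) P1 by (auto intro!: powr_mono simp: P_def sobolev_exponent_def)
    then have "\<mu> * v x powr (- q) + v x powr \<alpha> \<le> \<mu> * v x powr (P - 1) + v x powr (P - 1)"
      using assms(6) by (intro add_mono mult_left_mono) auto
    moreover have "x \<in> \<Omega>" using that v\<Omega>[of x] by fastforce
    ultimately show ?thesis by (simp add: f_def algebra_simps)
  qed
  interpret critical_equation p s \<Omega> v f r P "\<mu> + 1"
    using assms op bd smooth_domain_inward_directions[OF assms(5)] ve test v0 v\<Omega> fle
    by unfold_locales (auto simp: r_def P_def f_def)
  obtain K where K: "AE x in lborel. v x \<le> K" using essentially_bounded by blast
  have "AE x in lborel. \<bar>u x\<bar> \<le> K"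
    using K uv by eventually_elim (use v0 in auto)
  then have "AE x in lebesgue_on \<Omega>. ereal \<bar>u x\<bar> \<le> ereal K"
    using op by (subst AE_restrict_space_iff) (auto simp: AE_completion_iff elim: eventually_mono)
  moreover have uM: "u \<in> borel_measurable (lebesgue_on \<Omega>)"
    using um by (rule measurable_restrict_space1)
  moreover have "(\<lambda>x. ereal \<bar>u x\<bar>) \<in> borel_measurable (lebesgue_on \<Omega>)"
    using uM by measurable
  ultimately have "esssup (lebesgue_on \<Omega>) (\<lambda>x. ereal \<bar>u x\<bar>) \<le> ereal K" by (intro esssup_I)
  then show ?thesis using uM by (auto simp: Linfty_def intro: le_less_trans)
qed

end
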